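(* Let $M$ be a smooth Riemannian manifold of dimension $n\geqslant3$, let $W=W(p,v)$ be a smooth function on $M\times(0,+\infty)$ with $W_v=\partial W/\partial v\neq0$ everywhere, let $h$ be a smooth function of one variable, and consider the Newtonian dynamical system on $M$ with force field $$F_k=\frac{h(W)\,N_k}{W_v}-|\mathbf v|\sum_{i=1}^n\frac{\nabla_iW}{W_v}\,\bigl(2\,N^iN_k-\delta^i_k\bigr),\qquad W=W(p,|\mathbf v|).$$ Let $S$ be a connected hypersurface in $M$ with smooth unit normal field $\mathbf n(p)$, given parametrically by functions $x^i(p)=x^i(u^1,\dots,u^{n-1})$, let $p_0\in S$, $\nu_0>0$, and let $\nu$ be a smooth positive function on $S$ with $\nu(p_0)=\nu_0$. Suppose $\varepsilon>0$ is such that for $|t|<\varepsilon$ the shift maps $f_t\colon S\to S_t$ along trajectories of this system with initial velocities $\nu(p)\,\mathbf n(p)$ are defined and are diffeomorphisms onto hypersurfaces $S_t$. Then the shift $f_t\colon S\to S_t$ is a normal shift if and only if $$W(x^1(p),\dots,x^n(p),\nu(p))=W_0=\mathrm{const}\quad\text{for all }p\in S,$$ where $W_0=W(x^1(p_0),\dots,x^n(p_0),\nu_0)$.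
   Context: $M$ has metric $\mathbf g=(g_{ij})$ and Levi-Civita connection with components $\Gamma^k_{ij}$. A Newtonian dynamical system on $M$ with force field $\mathbf F$ (a smooth function assigning to each $(p,\mathbf v)$, $\mathbf v\in T_p(M)\setminus\{0\}$, a vector in $T_p(M)$) is the system of ODEs, in local coordinates, $\ddot x^k+\sum_{i,j}\Gamma^k_{ij}\dot x^i\dot x^j=F^k(x,\dot x)$. Trajectories are solutions with nonzero velocity. $\mathbf N=\mathbf v/|\mathbf v|$, with components $N^i$ and $N_i=\sum_jg_{ij}N^j$; $F_k=\sum_jg_{kj}F^j$. $\nabla_iW=\partial W(x^1,\dots,x^n,v)/\partial x^i$ with $v$ held fixed. Shift: for $p\in S$ let $r(t,p)$ be the trajectory with $r(0,p)=p$ and initial velocity $\nu(p)\,\mathbf n(p)$; $f_t(p)=r(t,p)$, $S_t=f_t(S)$. The shift is a normal shift if all hypersurfaces $S_t$ are orthogonal to the trajectories $t\mapsto r(t,p)$. *)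

theory Defs
  imports "HOL-Analysis.Analysis"
begin

text \<open>Derivatives are taken in the full space, so these notions are meant for open sets \<open>S\<close> only.\<close>

primrec Ck_on :: "nat \<Rightarrow> 'a set \<Rightarrow> ('a::real_normed_vector \<Rightarrow> 'b::real_normed_vector) \<Rightarrow> bool" where
  "Ck_on 0 S f = continuous_on S f"
| "Ck_on (Suc k) S f =
    ((\<forall>x\<in>S. f differentiable (at x)) \<and> (\<forall>v. Ck_on k S (\<lambda>x. frechet_derivative f (at x) v)))"

definition smooth_on :: "'a set \<Rightarrow> ('a::real_normed_vector \<Rightarrow> 'b::real_normed_vector) \<Rightarrow> bool" where
  "smooth_on S f \<longleftrightarrow> (\<forall>k. Ck_on k S f)"

text \<open>A chart is a pair of its domain and its coordinate map; the latter is relevant on the domain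
  only.  The manifold is the union of the domains of the charts of an atlas.\<close>

type_synonym ('a, 'n) chart = "'a set \<times> ('a \<Rightarrow> real^'n)"

abbreviation cdom :: "('a, 'n) chart \<Rightarrow> 'a set" where
  "cdom c \<equiv> fst c"

abbreviation coord :: "('a, 'n) chart \<Rightarrow> 'a \<Rightarrow> real^'n" where
  "coord c \<equiv> snd c"

definition point_at :: "('a, 'n) chart \<Rightarrow> real^'n \<Rightarrow> 'a" where
  "point_at c = inv_into (cdom c) (coord c)"

definition points :: "('a, 'n) chart set \<Rightarrow> 'a set" where
  "points A = (\<Union>c\<in>A. cdom c)"

definition smooth_atlas ::
  "('a::{t2_space,second_countable_topology}, 'n::finite) chart set \<Rightarrow> bool" where
  "smooth_atlas A \<longleftrightarrow>
    (\<forall>c\<in>A. open (cdom c) \<and> open (coord c ` cdom c)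
        \<and> homeomorphism (cdom c) (coord c ` cdom c) (coord c) (point_at c))
    \<and> (\<forall>c\<in>A. \<forall>c'\<in>A. smooth_on (coord c ` (cdom c \<inter> cdom c')) (coord c' \<circ> point_at c))"

definition jacobian :: "('a, 'n::finite) chart \<Rightarrow> ('a, 'n) chart \<Rightarrow> 'a \<Rightarrow> real^'n^'n" where
  "jacobian c c' p = matrix (frechet_derivative (coord c' \<circ> point_at c) (at (coord c p)))"

definition partial :: "('a, 'n::finite) chart \<Rightarrow> 'n \<Rightarrow> ('a \<Rightarrow> real) \<Rightarrow> 'a \<Rightarrow> real" where
  "partial c i \<phi> p = frechet_derivative (\<lambda>x. \<phi> (point_at c x)) (at (coord c p)) (axis i 1)"

text \<open>Tensors are given by their components: \<open>g c p $ i $ j\<close> is \<open>g_ij\<close> at the point \<open>p\<close> with respect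
  to the chart \<open>c\<close>.  Components in different charts are tied together by the transformation law.\<close>

type_synonym ('a, 'n) metric_tensor = "('a, 'n) chart \<Rightarrow> 'a \<Rightarrow> real^'n^'n"

definition metric :: "('a, 'n::finite) metric_tensor \<Rightarrow> ('a, 'n) chart \<Rightarrow> 'a \<Rightarrow> real^'n \<Rightarrow> real^'n \<Rightarrow> real" where
  "metric g c p v w = (\<Sum>i\<in>UNIV. \<Sum>j\<in>UNIV. g c p $ i $ j * v $ i * w $ j)"

definition gnorm :: "('a, 'n::finite) metric_tensor \<Rightarrow> ('a, 'n) chart \<Rightarrow> 'a \<Rightarrow> real^'n \<Rightarrow> real" where
  "gnorm g c p v = sqrt (metric g c p v v)"

definition lower :: "('a, 'n::finite) metric_tensor \<Rightarrow> ('a, 'n) chart \<Rightarrow> 'a \<Rightarrow> real^'n \<Rightarrow> real^'n" where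
  "lower g c p v = (\<chi> k. \<Sum>j\<in>UNIV. g c p $ k $ j * v $ j)"

definition riemannian_metric ::
  "('a::{t2_space,second_countable_topology}, 'n::finite) chart set \<Rightarrow> ('a, 'n) metric_tensor \<Rightarrow> bool" where
  "riemannian_metric A g \<longleftrightarrow>
    (\<forall>c\<in>A. smooth_on (coord c ` cdom c) (\<lambda>x. g c (point_at c x))
        \<and> (\<forall>p\<in>cdom c. transpose (g c p) = g c p \<and> (\<forall>v. v \<noteq> 0 \<longrightarrow> metric g c p v v > 0)))
    \<and> (\<forall>c\<in>A. \<forall>c'\<in>A. \<forall>p\<in>cdom c \<inter> cdom c'.
        g c p = transpose (jacobian c c' p) ** g c' p ** jacobian c c' p)"

text \<open>The coefficient with upper index \<open>k\<close> and lower indices \<open>i\<close>, \<open>j\<close> of the Levi-Civita connection.\<close>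

definition christoffel ::
  "('a, 'n::finite) metric_tensor \<Rightarrow> ('a, 'n) chart \<Rightarrow> 'a \<Rightarrow> 'n \<Rightarrow> 'n \<Rightarrow> 'n \<Rightarrow> real" where
  "christoffel g c p k i j =
    1/2 * (\<Sum>s\<in>UNIV. matrix_inv (g c p) $ k $ s *
      (partial c i (\<lambda>q. g c q $ s $ j) p + partial c j (\<lambda>q. g c q $ i $ s) p
        - partial c s (\<lambda>q. g c q $ i $ j) p))"

definition velocity :: "('a, 'n::finite) chart \<Rightarrow> (real \<Rightarrow> 'a) \<Rightarrow> real \<Rightarrow> real^'n" where
  "velocity c r t = vector_derivative (\<lambda>s. coord c (r s)) (at t)"

text \<open>\<open>F c p v $ k\<close> is the contravariant component of the force at the point \<open>p\<close> and the velocity with components \<open>v\<close> in the chart \<open>c\<close>.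
  The time domain \<open>I\<close> is meant to be an open interval.\<close>

definition newtonian_trajectory ::
  "('a::topological_space, 'n::finite) chart set \<Rightarrow> ('a, 'n) metric_tensor \<Rightarrow>
   (('a, 'n) chart \<Rightarrow> 'a \<Rightarrow> real^'n \<Rightarrow> real^'n) \<Rightarrow> real set \<Rightarrow> (real \<Rightarrow> 'a) \<Rightarrow> bool" where
  "newtonian_trajectory A g F I r \<longleftrightarrow>
    continuous_on I r \<and> r ` I \<subseteq> points A \<and>
    (\<forall>c\<in>A. \<forall>t\<in>I. r t \<in> cdom c \<longrightarrow>
      ((\<lambda>s. coord c (r s)) has_vector_derivative velocity c r t) (at t)
      \<and> velocity c r t \<noteq> 0
      \<and> (\<exists>a. (velocity c r has_vector_derivative a) (at t)
          \<and> (\<forall>k. a $ k + (\<Sum>i\<in>UNIV. \<Sum>j\<in>UNIV. christoffel g c (r t) k i j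
                              * velocity c r t $ i * velocity c r t $ j)
                = F c (r t) (velocity c r t) $ k)))"

text \<open>Hypersurfaces are embedded: they carry the subspace topology.  The parameters
  \<open>u\<close> range over open subsets of \<open>real^'m\<close>; the codimension is one if
  \<open>CARD('n) = CARD('m) + 1\<close>, which is not part of the following definitions.\<close>

definition parametrizations ::
  "('a::topological_space, 'n::finite) chart set \<Rightarrow> 'a set \<Rightarrow> ((real^'m::finite) set \<times> (real^'m \<Rightarrow> 'a)) set" where
  "parametrizations A S =
    {(V, X). open V \<and> openin (top_of_set S) (X ` V)
      \<and> homeomorphism V (X ` V) X (inv_into V X)
      \<and> (\<forall>c\<in>A. smooth_on {u\<in>V. X u \<in> cdom c} (\<lambda>u. coord c (X u))
          \<and> (\<forall>u\<in>V. X u \<in> cdom c \<longrightarrow> inj (frechet_derivative (\<lambda>u. coord c (X u)) (at u))))}"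

definition hypersurface ::
  "'m::finite itself \<Rightarrow> ('a::topological_space, 'n::finite) chart set \<Rightarrow> 'a set \<Rightarrow> bool" where
  "hypersurface T A S \<longleftrightarrow> S \<subseteq> points A \<and>
    (\<forall>p\<in>S. \<exists>(V, X) \<in> (parametrizations A S :: ((real^'m) set \<times> (real^'m \<Rightarrow> 'a)) set). p \<in> X ` V)"

definition tangent_space ::
  "'m::finite itself \<Rightarrow> ('a::topological_space, 'n::finite) chart set \<Rightarrow> ('a, 'n) chart \<Rightarrow>
   'a set \<Rightarrow> 'a \<Rightarrow> (real^'n) set" where
  "tangent_space T A c S p =
    {w. \<exists>(V, X) \<in> (parametrizations A S :: ((real^'m) set \<times> (real^'m \<Rightarrow> 'a)) set).
          \<exists>u\<in>V. X u = p \<and> w \<in> range (frechet_derivative (\<lambda>u. coord c (X u)) (at u))}"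

definition smooth_function ::
  "'m::finite itself \<Rightarrow> ('a::topological_space, 'n::finite) chart set \<Rightarrow> 'a set \<Rightarrow> ('a \<Rightarrow> real) \<Rightarrow> bool" where
  "smooth_function T A S f \<longleftrightarrow>
    (\<forall>(V, X) \<in> (parametrizations A S :: ((real^'m) set \<times> (real^'m \<Rightarrow> 'a)) set).
      smooth_on V (\<lambda>u. f (X u)))"

definition smooth_map ::
  "'m::finite itself \<Rightarrow> ('a::topological_space, 'n::finite) chart set \<Rightarrow> 'a set \<Rightarrow> 'a set \<Rightarrow> ('a \<Rightarrow> 'a) \<Rightarrow> bool" where
  "smooth_map T A S S' f \<longleftrightarrow> continuous_on S f \<and> f ` S \<subseteq> S' \<and>
    (\<forall>(V, X) \<in> (parametrizations A S :: ((real^'m) set \<times> (real^'m \<Rightarrow> 'a)) set).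
     \<forall>(V', X') \<in> (parametrizations A S' :: ((real^'m) set \<times> (real^'m \<Rightarrow> 'a)) set).
      smooth_on {u\<in>V. f (X u) \<in> X' ` V'} (\<lambda>u. inv_into V' X' (f (X u))))"

definition hypersurface_diffeomorphism ::
  "'m::finite itself \<Rightarrow> ('a::topological_space, 'n::finite) chart set \<Rightarrow> 'a set \<Rightarrow> 'a set \<Rightarrow> ('a \<Rightarrow> 'a) \<Rightarrow> bool" where
  "hypersurface_diffeomorphism T A S S' f \<longleftrightarrow>
    bij_betw f S S' \<and> smooth_map T A S S' f \<and> smooth_map T A S' S (inv_into S f)"

text \<open>\<open>N c p\<close> are the components in the chart \<open>c\<close> of the normal vector at \<open>p\<close>.\<close>

definition unit_normal_field ::
  "'m::finite itself \<Rightarrow> ('a::topological_space, 'n::finite) chart set \<Rightarrow> ('a, 'n) metric_tensor \<Rightarrow>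
   'a set \<Rightarrow> (('a, 'n) chart \<Rightarrow> 'a \<Rightarrow> real^'n) \<Rightarrow> bool" where
  "unit_normal_field T A g S N \<longleftrightarrow>
    (\<forall>c\<in>A. \<forall>c'\<in>A. \<forall>p\<in>S \<inter> cdom c \<inter> cdom c'. N c' p = jacobian c c' p *v N c p)
    \<and> (\<forall>c\<in>A. \<forall>(V, X) \<in> (parametrizations A S :: ((real^'m) set \<times> (real^'m \<Rightarrow> 'a)) set).
        smooth_on {u\<in>V. X u \<in> cdom c} (\<lambda>u. N c (X u)))
    \<and> (\<forall>c\<in>A. \<forall>p\<in>S \<inter> cdom c. gnorm g c p (N c p) = 1
        \<and> (\<forall>w\<in>tangent_space T A c S p. metric g c p (N c p) w = 0))"

text \<open>\<open>f t p\<close> is the position at time \<open>t\<close> of the trajectory starting at \<open>p\<close>.\<close>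

definition newtonian_shift ::
  "('a::topological_space, 'n::finite) chart set \<Rightarrow> ('a, 'n) metric_tensor \<Rightarrow>
   (('a, 'n) chart \<Rightarrow> 'a \<Rightarrow> real^'n \<Rightarrow> real^'n) \<Rightarrow> 'a set \<Rightarrow> (('a, 'n) chart \<Rightarrow> 'a \<Rightarrow> real^'n) \<Rightarrow>
   ('a \<Rightarrow> real) \<Rightarrow> real \<Rightarrow> (real \<Rightarrow> 'a \<Rightarrow> 'a) \<Rightarrow> bool" where
  "newtonian_shift A g F S N \<nu> \<epsilon> f \<longleftrightarrow>
    (\<forall>p\<in>S. newtonian_trajectory A g F {-\<epsilon><..<\<epsilon>} (\<lambda>t. f t p) \<and> f 0 p = p
      \<and> (\<forall>c\<in>A. p \<in> cdom c \<longrightarrow> velocity c (\<lambda>t. f t p) 0 = \<nu> p *\<^sub>R N c p))"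

definition normal_shift ::
  "'m::finite itself \<Rightarrow> ('a::topological_space, 'n::finite) chart set \<Rightarrow> ('a, 'n) metric_tensor \<Rightarrow>
   'a set \<Rightarrow> real \<Rightarrow> (real \<Rightarrow> 'a \<Rightarrow> 'a) \<Rightarrow> bool" where
  "normal_shift T A g S \<epsilon> f \<longleftrightarrow>
    (\<forall>t\<in>{-\<epsilon><..<\<epsilon>}. \<forall>p\<in>S. \<forall>c\<in>A. f t p \<in> cdom c \<longrightarrow>
      (\<forall>w\<in>tangent_space T A c (f t ` S) (f t p).
        metric g c (f t p) (velocity c (\<lambda>s. f s p) t) w = 0))"

end

theory Submission
  imports Defs
begin

text \<open>
  Along a trajectory the quantity \<open>W(p, |v|)\<close> satisfies the scalar equation \<open>W' = h(W)\<close>.  For a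
  curve \<open>\<gamma>(s)\<close> in the hypersurface, let \<open>\<zeta>(t)\<close> be the derivative of \<open>f_t(\<gamma>(s))\<close> at \<open>s = 0\<close>,
  let \<open>v\<close> be the velocity, and let \<open>\<psi> = \<langle>\<zeta>, v\<rangle>\<close> be the deviation from orthogonality.  The special
  form of the force makes all other terms cancel in \<open>\<psi>' = |v|/W_v \<cdot> \<partial>_s W + \<kappa> \<psi>\<close>, and \<open>\<psi>(0) = 0\<close>.

  If \<open>W\<close> is constant on the initial data, uniqueness for \<open>W' = h(W)\<close> keeps it independent of \<open>s\<close>
  at all times, so \<open>\<psi>\<close> solves a homogeneous linear equation and vanishes.  Conversely, if \<open>\<psi>\<close>
  vanishes near \<open>t = 0\<close>, then \<open>\<partial>_s W = 0\<close> at \<open>t = 0\<close> for every curve, so \<open>W\<close> is locally constant on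
  the connected hypersurface.

  No theorem on smooth dependence on initial data is needed to commute \<open>\<partial>_s\<close> with \<open>\<partial>_t\<close>.  A Gronwall
  estimate gives Lipschitz dependence on \<open>s\<close>; since every \<open>f_t\<close> is assumed smooth, the positions are
  differentiable in \<open>s\<close>, and interpolation in \<open>t\<close> transfers this to the velocities.
\<close>

section \<open>Locally Lipschitz maps\<close>

text \<open>Each \<open>f t\<close> is assumed smooth for one \<open>t\<close> at a time, so no
  joint regularity in time and parameter is at hand; the mixed derivative must come out of the
  equation of motion itself. For this a locally Lipschitz right-hand side suffices, and that
  property is easily followed through the explicit formula of the force. The estimates live in a
  single chart, while a trajectory may cross many. They are made on short time intervals, carried
  over to other charts by the transition maps, and spread over the whole time interval by its
  connectedness.

  The cancellation has a simple source. The force is the sum of a multiple of the lowered velocity,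
  which paired with \<zeta> gives \<kappa>\<psi>, and of \<open>|v| / W_v\<close> times the gradient
  of \<open>W\<close>. In \<open>|v| / W_v\<close> times the derivative of \<open>W\<close> along
  the family the same gradient term appears, and the remaining part is \<open>|v|\<close> times the
  derivative of the speed. This is exactly what the Levi-Civita terms and the variation of the
  velocity contribute to the derivative of \<psi>.\<close>

definition loclip_at :: "('a::real_normed_vector \<Rightarrow> 'b::real_normed_vector) \<Rightarrow> 'a \<Rightarrow> bool" where
  "loclip_at f z \<longleftrightarrow>
    (\<exists>L. \<forall>\<^sub>F p in nhds (z, z). norm (f (fst p) - f (snd p)) \<le> L * norm (fst p - snd p))"

lemma loclip_atE:
  assumes "loclip_at f z"
  obtains L where "L \<ge> 0"
    "\<forall>\<^sub>F p in nhds (z, z). norm (f (fst p) - f (snd p)) \<le> L * norm (fst p - snd p)"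
proof -
  obtain L where L: "\<forall>\<^sub>F p in nhds (z, z). norm (f (fst p) - f (snd p)) \<le> L * norm (fst p - snd p)"
    using assms loclip_at_def by blast
  have "\<forall>\<^sub>F p in nhds (z, z). norm (f (fst p) - f (snd p)) \<le> max L 0 * norm (fst p - snd p)"
    using L
  proof eventually_elim
    case (elim p)
    also have "L * norm (fst p - snd p) \<le> max L 0 * norm (fst p - snd p)"
      by (rule mult_right_mono) auto
    finally show ?case .
  qed
  then show ?thesis using that[of "max L 0"] by simp
qed

lemma loclip_atE_snd:
  assumes "loclip_at f z"
  obtains L where "L \<ge> 0" "\<forall>\<^sub>F x in nhds z. norm (f x - f z) \<le> L * norm (x - z)"
proof -
  obtain L where L: "L \<ge> 0" "\<forall>\<^sub>F p in nhds (z, z). norm (f (fst p) - f (snd p)) \<le> L * norm (fst p - snd p)"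
    by (rule loclip_atE[OF assms])
  have "filterlim (\<lambda>x. (x, z)) (nhds (z, z)) (nhds z)"
    by (intro tendsto_Pair filterlim_ident tendsto_const)
  from eventually_compose_filterlim[OF L(2) this] show ?thesis using that L(1) by simp
qed

lemma tendsto_fst_nhds: "filterlim fst (nhds z) (nhds (z, z))"
  by (rule tendsto_fst[of "\<lambda>p. p" "(z, z)", simplified]) (simp add: filterlim_ident)

lemma tendsto_snd_nhds: "filterlim snd (nhds z) (nhds (z, z))"
  by (rule tendsto_snd[of "\<lambda>p. p" "(z, z)", simplified]) (simp add: filterlim_ident)

lemma loclip_at_isCont: assumes "loclip_at f z" shows "isCont f z"
proof -
  obtain L where "L \<ge> 0" and L: "\<forall>\<^sub>F x in nhds z. norm (f x - f z) \<le> L * norm (x - z)"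
    by (rule loclip_atE_snd[OF assms])
  have "((\<lambda>x. L * norm (x - z)) \<longlongrightarrow> L * norm (z - z)) (at z)"
    by (intro tendsto_intros)
  then have lim: "((\<lambda>x. L * norm (x - z)) \<longlongrightarrow> 0) (at z)" by simp
  have "((\<lambda>x. f x - f z) \<longlongrightarrow> 0) (at z)"
    by (rule Lim_null_comparison[OF _ lim])
      (use L in \<open>auto simp: eventually_at_filter elim: eventually_mono\<close>)
  then show ?thesis by (simp add: isCont_def LIM_zero_iff)
qed

lemma loclip_at_cong:
  assumes "\<forall>\<^sub>F x in nhds z. f x = g x" "loclip_at f z"
  shows "loclip_at g z"
proof -
  obtain L where L: "\<forall>\<^sub>F p in nhds (z, z). norm (f (fst p) - f (snd p)) \<le> L * norm (fst p - snd p)"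
    using assms(2) loclip_at_def by blast
  have "\<forall>\<^sub>F p in nhds (z, z). norm (g (fst p) - g (snd p)) \<le> L * norm (fst p - snd p)"
    using L eventually_compose_filterlim[OF assms(1) tendsto_fst_nhds]
      eventually_compose_filterlim[OF assms(1) tendsto_snd_nhds]
    by eventually_elim auto
  then show ?thesis using loclip_at_def by blast
qed

lemma loclip_at_const [simp]: "loclip_at (\<lambda>_. c) z"
  unfolding loclip_at_def by (intro exI[of _ 0]) simp

lemma loclip_at_bounded_linear:
  assumes "bounded_linear f" shows "loclip_at f z"
proof -
  interpret f: bounded_linear f by fact
  obtain K where "\<And>x. norm (f x) \<le> norm x * K" using f.bounded by blast
  then show ?thesis unfolding loclip_at_def
    by (intro exI[of _ K]) (simp add: f.diff[symmetric] mult.commute)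
qed

text \<open>Stating the property through \<open>nhds (z, z)\<close> makes this a plain composition
  of limits: the pair \<open>(f (fst p), f (snd p))\<close> tends to \<open>(f z, f z)\<close>
  because a locally Lipschitz map is continuous.\<close>

lemma loclip_at_compose:
  assumes "loclip_at g (f z)" "loclip_at f z"
  shows "loclip_at (\<lambda>x. g (f x)) z"
proof -
  obtain K where K: "K \<ge> 0" "\<forall>\<^sub>F p in nhds (f z, f z). norm (g (fst p) - g (snd p)) \<le> K * norm (fst p - snd p)"
    by (rule loclip_atE[OF assms(1)])
  obtain L where L: "L \<ge> 0" "\<forall>\<^sub>F p in nhds (z, z). norm (f (fst p) - f (snd p)) \<le> L * norm (fst p - snd p)"
    by (rule loclip_atE[OF assms(2)])
  have "isCont f z" by (rule loclip_at_isCont[OF assms(2)])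
  then have f: "filterlim f (nhds (f z)) (nhds z)"
    by (metis continuous_at tendsto_at_iff_tendsto_nhds)
  have "filterlim (\<lambda>p. (f (fst p), f (snd p))) (nhds (f z, f z)) (nhds (z, z))"
    by (intro tendsto_Pair filterlim_compose[OF f tendsto_fst_nhds] filterlim_compose[OF f tendsto_snd_nhds])
  from eventually_compose_filterlim[OF K(2) this] L(2)
  have "\<forall>\<^sub>F p in nhds (z, z). norm (g (f (fst p)) - g (f (snd p))) \<le> (K * L) * norm (fst p - snd p)"
  proof eventually_elim
    case (elim p)
    have "norm (g (f (fst p)) - g (f (snd p))) \<le> K * norm (f (fst p) - f (snd p))" using elim by simp
    also have "\<dots> \<le> K * (L * norm (fst p - snd p))" by (rule mult_left_mono) (use elim K in auto)
    finally show ?case by (simp add: mult.assoc)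
  qed
  then show ?thesis using loclip_at_def by blast
qed

lemma loclip_at_linear_compose:
  assumes "bounded_linear g" "loclip_at f z"
  shows "loclip_at (\<lambda>x. g (f x)) z"
  using loclip_at_compose loclip_at_bounded_linear assms by blast

lemma loclip_at_add:
  assumes "loclip_at f z" "loclip_at g z"
  shows "loclip_at (\<lambda>x. f x + g x) z"
proof -
  obtain K where "K \<ge> 0" and K: "\<forall>\<^sub>F p in nhds (z, z). norm (f (fst p) - f (snd p)) \<le> K * norm (fst p - snd p)"
    by (rule loclip_atE[OF assms(1)])
  obtain L where "L \<ge> 0" and L: "\<forall>\<^sub>F p in nhds (z, z). norm (g (fst p) - g (snd p)) \<le> L * norm (fst p - snd p)"
    by (rule loclip_atE[OF assms(2)])
  have "\<forall>\<^sub>F p in nhds (z, z). norm (f (fst p) + g (fst p) - (f (snd p) + g (snd p)))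
          \<le> (K + L) * norm (fst p - snd p)"
    using K L
  proof eventually_elim
    case (elim p)
    then show ?case
      using norm_triangle_ineq[of "f (fst p) - f (snd p)" "g (fst p) - g (snd p)"]
      by (simp add: algebra_simps)
  qed
  then show ?thesis using loclip_at_def by blast
qed

lemma loclip_at_minus: "loclip_at f z \<Longrightarrow> loclip_at (\<lambda>x. - f x) z"
  by (rule loclip_at_linear_compose[OF bounded_linear_minus[OF bounded_linear_ident]])

lemma loclip_at_diff:
  assumes "loclip_at f z" "loclip_at g z"
  shows "loclip_at (\<lambda>x. f x - g x) z"
  using loclip_at_add[OF assms(1) loclip_at_minus[OF assms(2)]] by simp

lemma isCont_norm_bounded:
  assumes "isCont k z" shows "\<forall>\<^sub>F x in nhds z. norm (k x) \<le> norm (k z) + 1"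
proof -
  have "((\<lambda>x. norm (k x)) \<longlongrightarrow> norm (k z)) (nhds z)"
    using assms by (metis continuous_at tendsto_at_iff_tendsto_nhds tendsto_norm)
  from order_tendstoD(2)[OF this, of "norm (k z) + 1"] show ?thesis by (auto elim: eventually_mono)
qed

text \<open>The usual splitting of a difference of products; the factors are bounded near
  \<open>z\<close> because they are continuous there.\<close>

lemma loclip_at_bilinear:
  assumes "bounded_bilinear m" "loclip_at f z" "loclip_at g z"
  shows "loclip_at (\<lambda>x. m (f x) (g x)) z"
proof -
  interpret m: bounded_bilinear m by fact
  obtain B where B: "B > 0" "\<And>a b. norm (m a b) \<le> norm a * norm b * B"
    using m.pos_bounded by blast
  obtain K where K0: "K \<ge> 0" and K: "\<forall>\<^sub>F p in nhds (z, z). norm (f (fst p) - f (snd p)) \<le> K * norm (fst p - snd p)"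
    by (rule loclip_atE[OF assms(2)])
  obtain L where L0: "L \<ge> 0" and L: "\<forall>\<^sub>F p in nhds (z, z). norm (g (fst p) - g (snd p)) \<le> L * norm (fst p - snd p)"
    by (rule loclip_atE[OF assms(3)])
  note bnd = isCont_norm_bounded[OF loclip_at_isCont]
  have "\<forall>\<^sub>F p in nhds (z, z). norm (m (f (fst p)) (g (fst p)) - m (f (snd p)) (g (snd p)))
          \<le> ((norm (f z) + 1) * L * B + K * (norm (g z) + 1) * B) * norm (fst p - snd p)"
    using K L eventually_compose_filterlim[OF bnd[OF assms(2)] tendsto_fst_nhds]
      eventually_compose_filterlim[OF bnd[OF assms(3)] tendsto_snd_nhds]
  proof eventually_elim
    case (elim p)
    let ?d = "norm (fst p - snd p)"
    have "m (f (fst p)) (g (fst p)) - m (f (snd p)) (g (snd p)) =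
        m (f (fst p)) (g (fst p) - g (snd p)) + m (f (fst p) - f (snd p)) (g (snd p))"
      by (simp add: m.diff_left m.diff_right)
    also have "norm \<dots> \<le> norm (m (f (fst p)) (g (fst p) - g (snd p))) + norm (m (f (fst p) - f (snd p)) (g (snd p)))"
      by (rule norm_triangle_ineq)
    also have "\<dots> \<le> norm (f (fst p)) * norm (g (fst p) - g (snd p)) * B + norm (f (fst p) - f (snd p)) * norm (g (snd p)) * B"
      using B(2) by (intro add_mono) auto
    also have "\<dots> \<le> (norm (f z) + 1) * (L * ?d) * B + (K * ?d) * (norm (g z) + 1) * B"
      using elim B(1) K0 L0 by (intro add_mono mult_right_mono mult_mono) auto
    finally show ?case by (simp add: algebra_simps)
  qed
  then show ?thesis using loclip_at_def by blast
qed

lemmas loclip_at_mult = loclip_at_bilinear[OF bounded_bilinear_mult]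
lemmas loclip_at_scaleR = loclip_at_bilinear[OF bounded_bilinear_scaleR]
lemmas loclip_at_inner = loclip_at_bilinear[OF bounded_bilinear_inner]

lemma loclip_at_sum:
  "(\<And>i. i \<in> I \<Longrightarrow> loclip_at (f i) z) \<Longrightarrow> loclip_at (\<lambda>x. \<Sum>i\<in>I. f i x) z"
  by (induction I rule: infinite_finite_induct) (auto intro: loclip_at_add)

lemma loclip_at_prod:
  fixes f :: "'i \<Rightarrow> 'a::real_normed_vector \<Rightarrow> real"
  shows "(\<And>i. i \<in> I \<Longrightarrow> loclip_at (f i) z) \<Longrightarrow> loclip_at (\<lambda>x. \<Prod>i\<in>I. f i x) z"
  by (induction I rule: infinite_finite_induct) (auto intro: loclip_at_mult)

lemma loclip_at_vec_nth: "loclip_at f z \<Longrightarrow> loclip_at (\<lambda>x. f x $ i) z"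
  by (rule loclip_at_linear_compose[OF bounded_linear_vec_nth])

lemma loclip_at_vecI:
  fixes f :: "'a::real_normed_vector \<Rightarrow> real^'n::finite"
  assumes "\<And>i. loclip_at (\<lambda>x. f x $ i) z"
  shows "loclip_at f z"
proof -
  have "loclip_at (\<lambda>x. \<Sum>i\<in>UNIV. (f x $ i) *\<^sub>R axis i (1::real)) z"
    by (intro loclip_at_sum loclip_at_scaleR assms loclip_at_const)
  also have "(\<lambda>x. \<Sum>i\<in>UNIV. (f x $ i) *\<^sub>R axis i (1::real)) = f"
  proof
    fix x
    show "(\<Sum>i\<in>UNIV. (f x $ i) *\<^sub>R axis i (1::real)) = f x"
      by (simp add: vec_eq_iff axis_def if_distrib cong: if_cong)
  qed
  finally show ?thesis .
qed

lemma loclip_at_Pair: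
  assumes "loclip_at f z" "loclip_at g z"
  shows "loclip_at (\<lambda>x. (f x, g x)) z"
proof -
  have "loclip_at (\<lambda>x. (f x, 0) + (0, g x)) z"
    by (intro loclip_at_add loclip_at_linear_compose[OF _ assms(1)] loclip_at_linear_compose[OF _ assms(2)]
        bounded_linear_intros)
  then show ?thesis by simp
qed

lemma loclip_at_fst: "loclip_at fst z" and loclip_at_snd: "loclip_at snd z"
  by (rule loclip_at_bounded_linear[OF bounded_linear_fst], rule loclip_at_bounded_linear[OF bounded_linear_snd])

text \<open>Mean value inequality on a ball, which is convex. Bounds are required on basis vectors
  only, since \<open>Ck_on\<close> speaks of the derivative in one fixed direction at a time; summed
  over the basis they bound the operator norm.\<close>

lemma loclip_at_C1:
  fixes f :: "'a::euclidean_space \<Rightarrow> 'b::real_normed_vector"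
  assumes D: "\<forall>\<^sub>F x in nhds z. (f has_derivative f' x) (at x)"
    and B: "\<And>b. b \<in> Basis \<Longrightarrow> \<forall>\<^sub>F x in nhds z. norm (f' x b) \<le> B b"
  shows "loclip_at f z"
proof -
  have "\<forall>\<^sub>F x in nhds z. (f has_derivative f' x) (at x) \<and> (\<forall>b\<in>Basis. norm (f' x b) \<le> B b)"
    using D B by (intro eventually_conj eventually_ball_finite) auto
  then obtain d where d: "d > 0"
    "\<And>x. dist x z < d \<Longrightarrow> (f has_derivative f' x) (at x)"
    "\<And>x b. dist x z < d \<Longrightarrow> b \<in> Basis \<Longrightarrow> norm (f' x b) \<le> B b"
    unfolding eventually_nhds_metric by blast
  define L where "L = (\<Sum>b\<in>(Basis::'a set). B b)"
  have on: "onorm (f' x) \<le> L" if x: "x \<in> ball z d" for x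
  proof (rule onorm_le)
    fix h :: 'a
    interpret f': bounded_linear "f' x"
      using d(2)[of x] x by (auto simp: dist_commute has_derivative_def)
    have "f' x h = f' x (\<Sum>b\<in>Basis. (h \<bullet> b) *\<^sub>R b)" by (simp add: euclidean_representation)
    also have "\<dots> = (\<Sum>b\<in>Basis. (h \<bullet> b) *\<^sub>R f' x b)" by (simp add: f'.sum f'.scaleR)
    also have "norm \<dots> \<le> (\<Sum>b\<in>Basis. \<bar>h \<bullet> b\<bar> * norm (f' x b))"
      by (rule order_trans[OF norm_sum]) simp
    also have "\<dots> \<le> (\<Sum>b\<in>(Basis::'a set). norm h * B b)"
      using d(3)[of x] x by (intro sum_mono mult_mono) (auto simp: Basis_le_norm dist_commute)
    finally show "norm (f' x h) \<le> L * norm h" by (simp add: L_def sum_distrib_left mult.commute)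
  qed
  have "norm (f x - f y) \<le> L * norm (x - y)" if "x \<in> ball z d" "y \<in> ball z d" for x y
    by (rule differentiable_bound[OF convex_ball _ on that])
      (use d(2) in \<open>auto simp: dist_commute intro: has_derivative_at_withinI\<close>)
  moreover have "\<forall>\<^sub>F x in nhds z. x \<in> ball z d"
    using d(1) by (intro eventually_nhds_in_open) auto
  then have "\<forall>\<^sub>F p in nhds (z, z). fst p \<in> ball z d" "\<forall>\<^sub>F p in nhds (z, z). snd p \<in> ball z d"
    using eventually_compose_filterlim[OF _ tendsto_fst_nhds]
      eventually_compose_filterlim[OF _ tendsto_snd_nhds] by blast+
  then have "\<forall>\<^sub>F p in nhds (z, z). fst p \<in> ball z d \<and> snd p \<in> ball z d" by eventually_elim auto
  ultimately have "\<forall>\<^sub>F p in nhds (z, z). norm (f (fst p) - f (snd p)) \<le> L * norm (fst p - snd p)"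
    by (auto elim: eventually_mono)
  then show ?thesis using loclip_at_def by blast
qed

lemma loclip_at_real_C1:
  fixes f :: "real \<Rightarrow> real"
  assumes "\<forall>\<^sub>F x in nhds z. (f has_real_derivative f' x) (at x)" "isCont f' z"
  shows "loclip_at f z"
  by (rule loclip_at_C1[where f' = "\<lambda>x. (*) (f' x)" and B = "\<lambda>_. norm (f' z) + 1"])
    (use assms(1) isCont_norm_bounded[OF assms(2)] in \<open>auto simp: has_field_derivative_def\<close>)

lemma loclip_at_inverse:
  fixes f :: "'a::real_normed_vector \<Rightarrow> real"
  assumes "loclip_at f z" "f z \<noteq> 0"
  shows "loclip_at (\<lambda>x. inverse (f x)) z"
proof (rule loclip_at_compose[OF _ assms(1)])
  have "\<forall>\<^sub>F x in nhds (f z). x \<in> - {0}"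
    using assms by (intro eventually_nhds_in_open) auto
  then show "loclip_at inverse (f z)"
    using assms by (intro loclip_at_real_C1[where f' = "\<lambda>x. - (inverse x * inverse x)"])
      (auto elim!: eventually_mono intro!: derivative_eq_intros continuous_intros)
qed

lemma loclip_at_divide:
  fixes f g :: "'a::real_normed_vector \<Rightarrow> real"
  assumes "loclip_at f z" "loclip_at g z" "g z \<noteq> 0"
  shows "loclip_at (\<lambda>x. f x / g x) z"
  using loclip_at_mult[OF assms(1) loclip_at_inverse[OF assms(2,3)]] by (simp add: divide_inverse)

lemma loclip_at_sqrt:
  fixes f :: "'a::real_normed_vector \<Rightarrow> real"
  assumes "loclip_at f z" "f z > 0"
  shows "loclip_at (\<lambda>x. sqrt (f x)) z"
proof (rule loclip_at_compose[OF _ assms(1)])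
  have "\<forall>\<^sub>F x in nhds (f z). x \<in> {0<..}"
    using assms by (intro eventually_nhds_in_open) auto
  then show "loclip_at sqrt (f z)"
    using assms by (intro loclip_at_real_C1[where f' = "\<lambda>x. inverse (sqrt x) / 2"])
      (auto elim!: eventually_mono intro!: derivative_eq_intros continuous_intros)
qed

section \<open>Smooth maps, and uniform Lipschitz bounds near compact sets\<close>

lemma Ck_on_has_derivative:
  assumes "Ck_on (Suc k) S f" "x \<in> S"
  shows "(f has_derivative frechet_derivative f (at x)) (at x)"
  using assms frechet_derivative_works by auto

lemma Ck_on_1_loclip_at:
  fixes f :: "'a::euclidean_space \<Rightarrow> 'b::real_normed_vector"
  assumes "Ck_on (Suc 0) S f" "open S" "z \<in> S"
  shows "loclip_at f z"
proof (rule loclip_at_C1[where f' = "\<lambda>x. frechet_derivative f (at x)"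
        and B = "\<lambda>b. norm (frechet_derivative f (at z) b) + 1"])
  have "\<forall>\<^sub>F x in nhds z. x \<in> S" using assms by (intro eventually_nhds_in_open)
  then show "\<forall>\<^sub>F x in nhds z. (f has_derivative frechet_derivative f (at x)) (at x)"
    using Ck_on_has_derivative[OF assms(1)] by (auto elim: eventually_mono)
  fix b :: 'a
  have "isCont (\<lambda>x. frechet_derivative f (at x) b) z"
    using assms by (auto simp: continuous_on_eq_continuous_at)
  from isCont_norm_bounded[OF this]
  show "\<forall>\<^sub>F x in nhds z. norm (frechet_derivative f (at x) b) \<le> norm (frechet_derivative f (at z) b) + 1" .
qed

lemma smooth_on_loclip_at:
  fixes f :: "'a::euclidean_space \<Rightarrow> 'b::real_normed_vector"
  assumes "smooth_on S f" "open S" "z \<in> S"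
  shows "loclip_at f z"
  using assms Ck_on_1_loclip_at unfolding smooth_on_def by blast

lemma smooth_on_has_derivative:
  assumes "smooth_on S f" "z \<in> S"
  shows "(f has_derivative frechet_derivative f (at z)) (at z)"
  using assms Ck_on_has_derivative unfolding smooth_on_def by blast

lemma smooth_on_frechet_derivative:
  assumes "smooth_on S f"
  shows "smooth_on S (\<lambda>x. frechet_derivative f (at x) v)"
  using assms unfolding smooth_on_def by (metis Ck_on.simps(2))

text \<open>A Lebesgue number argument. Only \<open>z\<close> has to lie in \<open>K\<close>: below,
  \<open>K\<close> is the orbit of one solution and \<open>y\<close> a point of a neighbouring
  one.\<close>

lemma loclip_at_compact:
  fixes G :: "'a::real_normed_vector \<Rightarrow> 'b::real_normed_vector"
  assumes K: "compact K" "\<And>z. z \<in> K \<Longrightarrow> loclip_at G z"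
  obtains \<rho> L where "\<rho> > 0" "L \<ge> 0"
    "\<And>z y. z \<in> K \<Longrightarrow> norm (y - z) \<le> \<rho> \<Longrightarrow> norm (G y - G z) \<le> L * norm (y - z)"
proof (cases "K = {}")
  case True
  then show ?thesis using that[of 1 0] by simp
next
  case False
  have "\<exists>d L. d > 0 \<and> L \<ge> 0 \<and> (\<forall>x y. dist x z < d \<longrightarrow> dist y z < d \<longrightarrow> norm (G x - G y) \<le> L * norm (x - y))"
    if "z \<in> K" for z
  proof -
    obtain L where L: "L \<ge> 0"
      "\<forall>\<^sub>F p in nhds (z, z). norm (G (fst p) - G (snd p)) \<le> L * norm (fst p - snd p)"
      by (rule loclip_atE[OF K(2)[OF \<open>z \<in> K\<close>]])
    then obtain Q where "eventually Q (nhds z)"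
      "\<And>x y. Q x \<Longrightarrow> Q y \<Longrightarrow> norm (G x - G y) \<le> L * norm (x - y)"
      unfolding nhds_prod eventually_prod_same by auto
    then show ?thesis using L(1) unfolding eventually_nhds_metric by metis
  qed
  then obtain d L where dL: "\<And>z. z \<in> K \<Longrightarrow> d z > 0" "\<And>z. z \<in> K \<Longrightarrow> L z \<ge> 0"
    "\<And>z x y. z \<in> K \<Longrightarrow> dist x z < d z \<Longrightarrow> dist y z < d z \<Longrightarrow> norm (G x - G y) \<le> L z * norm (x - y)"
    by metis
  obtain C where C: "C \<subseteq> K" "finite C" "K \<subseteq> (\<Union>z\<in>C. ball z (d z / 2))"
    by (rule compactE_image[OF K(1), of K "\<lambda>z. ball z (d z / 2)"]) (use dL(1) in \<open>auto intro!: bexI\<close>)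
  have "C \<noteq> {}" using C(3) False by auto
  \<comment> \<open>The second halving makes \<open>\<rho>\<close> strictly smaller than every
    \<open>d z / 2\<close>, so a point within \<open>\<rho>\<close> of \<open>z\<close> stays in the
    ball of radius \<open>d c\<close> around the centre \<open>c\<close> that covers
    \<open>z\<close>.\<close>
  define \<rho> where "\<rho> = Min ((\<lambda>z. d z / 2) ` C) / 2"
  define M where "M = Max (L ` C)"
  have \<rho>: "\<rho> > 0" "\<And>z. z \<in> C \<Longrightarrow> \<rho> < d z / 2"
  proof -
    show "\<rho> > 0" unfolding \<rho>_def using C dL(1) \<open>C \<noteq> {}\<close> by (auto simp: Min_gr_iff)
    fix z assume "z \<in> C"
    then have "Min ((\<lambda>z. d z / 2) ` C) \<le> d z / 2" using C by (intro Min_le) auto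
    then have "2 * \<rho> \<le> d z / 2" unfolding \<rho>_def by linarith
    then show "\<rho> < d z / 2" using \<open>\<rho> > 0\<close> by linarith
  qed
  have M: "\<And>z. z \<in> C \<Longrightarrow> L z \<le> M" unfolding M_def using C by auto
  show ?thesis
  proof (rule that[of \<rho> M])
    show "\<rho> > 0" by fact
    show "M \<ge> 0" using M dL(2) C(1) \<open>C \<noteq> {}\<close> by (meson equals0I order_trans subsetD)
    fix z y assume z: "z \<in> K" and y: "norm (y - z) \<le> \<rho>"
    obtain c where c: "c \<in> C" "dist z c < d c / 2" using C(3) z by (auto simp: dist_commute)
    have "dist y c \<le> dist y z + dist z c" by (rule dist_triangle)
    also have "\<dots> < d c" using y c \<rho>(2)[OF c(1)] by (simp add: dist_norm)
    finally have "norm (G y - G z) \<le> L c * norm (y - z)"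
      using c C(1) dL(1)[of c] by (intro dL(3)) auto
    also have "\<dots> \<le> M * norm (y - z)" by (rule mult_right_mono[OF M[OF c(1)]]) simp
    finally show "norm (G y - G z) \<le> M * norm (y - z)" .
  qed
qed

section \<open>Dependence on initial data\<close>

lemma has_vector_derivative_eventually:
  assumes "(f has_vector_derivative D) (at x)" "\<forall>\<^sub>F s in nhds x. f s = g s"
  shows "(g has_vector_derivative D) (at x)"
proof -
  obtain U where "open U" "x \<in> U" "\<And>s. s \<in> U \<Longrightarrow> f s = g s"
    using assms(2) unfolding eventually_nhds by blast
  from has_vector_derivative_transform_within_open[OF assms(1) this] show ?thesis .
qed

lemma has_vector_derivative_lim:
  "(y has_vector_derivative y') (at t) \<Longrightarrow> (y \<longlongrightarrow> y t) (nhds t)"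
  using has_vector_derivative_continuous[of y y' t UNIV] by (metis continuous_at tendsto_at_iff_tendsto_nhds)

text \<open>The weighted square \<open>|u|^2 exp(-2L(\<tau> - a))\<close> is nonincreasing. The
  square is used since the norm need not be differentiable where \<open>u\<close> vanishes.\<close>

lemma gronwall_norm:
  fixes u :: "real \<Rightarrow> 'b::real_inner"
  assumes "a \<le> t" and cont: "continuous_on {a..t} u"
    and D: "\<And>\<tau>. a < \<tau> \<Longrightarrow> \<tau> < t \<Longrightarrow> (u has_vector_derivative u' \<tau>) (at \<tau>)"
    and B: "\<And>\<tau>. a < \<tau> \<Longrightarrow> \<tau> < t \<Longrightarrow> norm (u' \<tau>) \<le> L * norm (u \<tau>)"
  shows "norm (u t) \<le> norm (u a) * exp (L * (t - a))"
proof (cases "a = t")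
  case False
  define q where "q \<tau> = (u \<tau> \<bullet> u \<tau>) * exp (- 2 * L * (\<tau> - a))" for \<tau>
  have "q t \<le> q a"
  proof (rule DERIV_nonpos_imp_decreasing_open[where f = q and a = a and b = t])
    show "a \<le> t" by fact
    show "continuous_on {a..t} q" unfolding q_def by (intro continuous_intros cont)
    fix \<tau> assume \<tau>: "a < \<tau>" "\<tau> < t"
    have "((\<lambda>\<tau>. u \<tau> \<bullet> u \<tau>) has_real_derivative u \<tau> \<bullet> u' \<tau> + u' \<tau> \<bullet> u \<tau>) (at \<tau>)"
      unfolding has_real_derivative_iff_has_vector_derivative
      by (rule bounded_bilinear.has_vector_derivative[OF bounded_bilinear_inner D[OF \<tau>] D[OF \<tau>]])
    moreover have "((\<lambda>\<tau>. exp (- 2 * L * (\<tau> - a))) has_real_derivative exp (- 2 * L * (\<tau> - a)) * (- 2 * L)) (at \<tau>)"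
      by (rule derivative_eq_intros refl | simp)+
    ultimately have "(q has_real_derivative (u \<tau> \<bullet> u' \<tau> + u' \<tau> \<bullet> u \<tau>) * exp (- 2 * L * (\<tau> - a))
        + exp (- 2 * L * (\<tau> - a)) * (- 2 * L) * (u \<tau> \<bullet> u \<tau>)) (at \<tau>)"
      unfolding q_def by (rule DERIV_mult)
    then have "(q has_real_derivative (u \<tau> \<bullet> u' \<tau> + u' \<tau> \<bullet> u \<tau> - 2 * L * (u \<tau> \<bullet> u \<tau>)) * exp (- 2 * L * (\<tau> - a))) (at \<tau>)"
      by (simp add: algebra_simps)
    moreover have "u \<tau> \<bullet> u' \<tau> \<le> L * (u \<tau> \<bullet> u \<tau>)"
    proof -
      have "u \<tau> \<bullet> u' \<tau> \<le> norm (u \<tau>) * norm (u' \<tau>)" by (rule norm_cauchy_schwarz)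
      also have "\<dots> \<le> norm (u \<tau>) * (L * norm (u \<tau>))" by (rule mult_left_mono[OF B[OF \<tau>]]) simp
      finally show ?thesis by (simp add: dot_square_norm power2_eq_square algebra_simps)
    qed
    ultimately show "\<exists>y. DERIV q \<tau> :> y \<and> y \<le> 0"
      by (intro exI[of _ "(u \<tau> \<bullet> u' \<tau> + u' \<tau> \<bullet> u \<tau> - 2 * L * (u \<tau> \<bullet> u \<tau>)) * exp (- 2 * L * (\<tau> - a))"])
        (auto simp: inner_commute mult_nonpos_nonneg)
  qed
  moreover have "exp (- 2 * L * (t - a)) = inverse ((exp (L * (t - a)))\<^sup>2)"
    by (simp add: exp_minus[symmetric] exp_double[symmetric] power_inverse mult_ac)
  moreover define E where "E = exp (L * (t - a))"
  ultimately have "(norm (u t))\<^sup>2 * inverse (E\<^sup>2) \<le> (norm (u a))\<^sup>2"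
    by (simp add: q_def dot_square_norm)
  then have "(norm (u t))\<^sup>2 \<le> (norm (u a) * exp (L * (t - a)))\<^sup>2"
    unfolding E_def[symmetric] by (simp add: E_def power_mult_distrib divide_inverse[symmetric] pos_divide_le_eq)
  then show ?thesis by (rule power2_le_imp_le) simp
qed simp

text \<open>The form in which derivatives are obtained as limits of difference quotients, and in
  which a curve may be translated in its parameter.\<close>

lemma has_vector_derivative_iff_quotient:
  "(f has_vector_derivative D) (at x) \<longleftrightarrow> ((\<lambda>h. (f (x + h) - f x) /\<^sub>R h) \<longlongrightarrow> D) (at 0)"
proof -
  have "norm (f (x + h) - f x - h *\<^sub>R D) / norm h = norm ((f (x + h) - f x) /\<^sub>R h - D)" if "h \<noteq> 0" for h
  proof -
    have "(f (x + h) - f x) /\<^sub>R h - D = (f (x + h) - f x - h *\<^sub>R D) /\<^sub>R h"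
      using that by (simp add: scaleR_diff_right)
    then show ?thesis by (simp add: divide_inverse_commute)
  qed
  then have "((\<lambda>h. norm (f (x + h) - f x - h *\<^sub>R D) / norm h) \<longlongrightarrow> 0) (at 0)
     \<longleftrightarrow> ((\<lambda>h. norm ((f (x + h) - f x) /\<^sub>R h - D)) \<longlongrightarrow> 0) (at 0)"
    by (intro filterlim_cong) (auto simp: eventually_at_filter)
  then show ?thesis
    unfolding has_vector_derivative_def has_derivative_at
    by (simp add: tendsto_norm_zero_iff LIM_zero_iff bounded_linear_scaleR_left)
qed

text \<open>Times before \<open>t0\<close> are reached by applying the estimate to
  \<open>u (- \<tau>)\<close>, whose derivative obeys the same bound.\<close>

lemma gronwall_zero:
  fixes u :: "real \<Rightarrow> 'b::real_inner"
  assumes D: "\<And>\<tau>. \<tau> \<in> ball a \<delta> \<Longrightarrow> (u has_vector_derivative u' \<tau>) (at \<tau>)"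
    and B: "\<And>\<tau>. \<tau> \<in> ball a \<delta> \<Longrightarrow> norm (u' \<tau>) \<le> L * norm (u \<tau>)"
    and t: "t0 \<in> ball a \<delta>" "t \<in> ball a \<delta>" "u t0 = 0"
  shows "u t = 0"
proof -
  have c: "isCont u \<tau>" if "\<tau> \<in> ball a \<delta>" for \<tau>
    using has_vector_derivative_continuous[OF D[OF that]] .
  show ?thesis
  proof (cases "t0 \<le> t")
    case True
    have sub: "\<tau> \<in> ball a \<delta>" if "t0 \<le> \<tau>" "\<tau> \<le> t" for \<tau>
      using that t by (auto simp: dist_real_def)
    have "norm (u t) \<le> norm (u t0) * exp (L * (t - t0))"
      by (rule gronwall_norm[where u' = u'])
        (use True sub c D B in \<open>auto intro!: continuous_at_imp_continuous_on\<close>)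
    then show ?thesis using t by simp
  next
    case False
    have sub: "- \<tau> \<in> ball a \<delta>" if "- t0 \<le> \<tau>" "\<tau> \<le> - t" for \<tau>
      using that t by (auto simp: dist_real_def)
    have "norm (u (- (- t))) \<le> norm (u (- (- t0))) * exp (L * (- t - - t0))"
    proof (rule gronwall_norm[where u = "\<lambda>\<tau>. u (- \<tau>)" and u' = "\<lambda>\<tau>. - u' (- \<tau>)"])
      show "continuous_on {- t0..- t} (\<lambda>\<tau>. u (- \<tau>))"
        by (intro continuous_at_imp_continuous_on ballI)
          (use sub c isCont_o2[OF continuous_minus[OF continuous_ident]] in auto)
      fix \<tau> assume "- t0 < \<tau>" "\<tau> < - t"
      then have \<tau>: "- \<tau> \<in> ball a \<delta>" using sub by auto
      have "(uminus has_vector_derivative (-1::real)) (at \<tau>)"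
        by (rule derivative_eq_intros refl | simp)+
      from vector_diff_chain_at[OF this D[OF \<tau>]]
      show "((\<lambda>\<tau>. u (- \<tau>)) has_vector_derivative - u' (- \<tau>)) (at \<tau>)" by (simp add: o_def)
      show "norm (- u' (- \<tau>)) \<le> L * norm (u (- \<tau>))" using B[OF \<tau>] by simp
    qed (use False in auto)
    then show ?thesis using t by simp
  qed
qed

text \<open>Where the curves agree at \<open>a\<close>, both stay for a while in a region with one
  Lipschitz constant for \<open>h\<close>, so their difference vanishes near \<open>a\<close> once
  it vanishes at a single time near \<open>a\<close>. Where they differ at \<open>a\<close>, they
  differ nearby by continuity. Connectedness of \<open>I\<close> does the rest.\<close>

lemma ode_unique:
  fixes y z :: "real \<Rightarrow> 'b::euclidean_space"
  assumes I: "open I" "connected I" and h: "\<And>w. w \<in> H \<Longrightarrow> loclip_at h w"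
    and y: "\<And>t. t \<in> I \<Longrightarrow> (y has_vector_derivative h (y t)) (at t)" "\<And>t. t \<in> I \<Longrightarrow> y t \<in> H"
    and z: "\<And>t. t \<in> I \<Longrightarrow> (z has_vector_derivative h (z t)) (at t)"
    and t: "t0 \<in> I" "t \<in> I" "y t0 = z t0"
  shows "y t = z t"
proof (rule connected_induction_simple[where P = "\<lambda>t. y t = z t", OF I(2) t])
  fix a assume a: "a \<in> I"
  have lim: "(y \<longlongrightarrow> y a) (nhds a)" "(z \<longlongrightarrow> z a) (nhds a)"
    using has_vector_derivative_continuous[OF y(1)[OF a]] has_vector_derivative_continuous[OF z[OF a]]
    by (simp_all add: continuous_at tendsto_at_iff_tendsto_nhds)
  have inI: "\<forall>\<^sub>F t in nhds a. t \<in> I" using I a by (intro eventually_nhds_in_open)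
  have "\<exists>\<delta>>0. ball a \<delta> \<subseteq> I \<and> (\<forall>t\<in>ball a \<delta>. \<forall>t'\<in>ball a \<delta>. y t = z t \<longrightarrow> y t' = z t')"
  proof (cases "y a = z a")
    case True
    obtain L where L: "L \<ge> 0"
      "\<forall>\<^sub>F p in nhds (y a, y a). norm (h (fst p) - h (snd p)) \<le> L * norm (fst p - snd p)"
      by (rule loclip_atE[OF h[OF y(2)[OF a]]])
    have "\<forall>\<^sub>F t in nhds a. norm (h (y t) - h (z t)) \<le> L * norm (y t - z t)"
      using eventually_compose_filterlim[OF L(2), of "\<lambda>t. (y t, z t)" "nhds a"] tendsto_Pair[OF lim] True by simp
    with inI have "\<forall>\<^sub>F t in nhds a. t \<in> I \<and> norm (h (y t) - h (z t)) \<le> L * norm (y t - z t)"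
      by eventually_elim auto
    then obtain \<delta> where \<delta>: "\<delta> > 0" "\<And>t. t \<in> ball a \<delta> \<Longrightarrow> t \<in> I"
      "\<And>t. t \<in> ball a \<delta> \<Longrightarrow> norm (h (y t) - h (z t)) \<le> L * norm (y t - z t)"
      unfolding eventually_nhds_metric by (auto simp: dist_commute)
    have "y t' - z t' = 0" if "t \<in> ball a \<delta>" "t' \<in> ball a \<delta>" "y t - z t = 0" for t t'
    proof (rule gronwall_zero[where u = "\<lambda>t. y t - z t" and u' = "\<lambda>t. h (y t) - h (z t)" and L = L, OF _ _ that])
      fix \<tau> assume \<tau>: "\<tau> \<in> ball a \<delta>"
      show "((\<lambda>t. y t - z t) has_vector_derivative h (y \<tau>) - h (z \<tau>)) (at \<tau>)"
        by (rule has_vector_derivative_diff[OF y(1)[OF \<delta>(2)[OF \<tau>]] z[OF \<delta>(2)[OF \<tau>]]])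
      show "norm (h (y \<tau>) - h (z \<tau>)) \<le> L * norm (y \<tau> - z \<tau>)" by (rule \<delta>(3)[OF \<tau>])
    qed
    then have "\<forall>t\<in>ball a \<delta>. \<forall>t'\<in>ball a \<delta>. y t = z t \<longrightarrow> y t' = z t'" by (metis eq_iff_diff_eq_0)
    then show ?thesis using \<delta>(1,2) by blast
  next
    case False
    have "((\<lambda>t. y t - z t) \<longlongrightarrow> y a - z a) (nhds a)" by (intro tendsto_diff lim)
    from tendsto_imp_eventually_ne[OF this, of 0] False inI
    have "\<forall>\<^sub>F t in nhds a. t \<in> I \<and> y t \<noteq> z t" by (auto elim: eventually_elim2)
    then obtain \<delta> where "\<delta> > 0" "\<And>t. t \<in> ball a \<delta> \<Longrightarrow> t \<in> I \<and> y t \<noteq> z t"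
      unfolding eventually_nhds_metric by (auto simp: dist_commute)
    then show ?thesis by blast
  qed
  then obtain \<delta> where \<delta>: "\<delta> > 0" "ball a \<delta> \<subseteq> I" "\<forall>t\<in>ball a \<delta>. \<forall>t'\<in>ball a \<delta>. y t = z t \<longrightarrow> y t' = z t'"
    by blast
  show "\<exists>T. openin (top_of_set I) T \<and> a \<in> T \<and> (\<forall>x\<in>T. \<forall>t\<in>T. y x = z x \<longrightarrow> y t = z t)"
    using \<delta> by (intro exI[of _ "ball a \<delta>"]) (auto intro!: open_openin_trans I)
qed

text \<open>Supplies the linear bound on the phases at the initial time, from which all later bounds
  are propagated.\<close>

lemma has_vector_derivative_lipschitz:
  fixes f :: "real \<Rightarrow> 'b::real_normed_vector"
  assumes "(f has_vector_derivative f') (at a)"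
  obtains C where "\<forall>\<^sub>F s in nhds 0. norm (f (a + s) - f a) \<le> C * \<bar>s\<bar>"
proof -
  have "((\<lambda>s. norm ((f (a + s) - f a) /\<^sub>R s)) \<longlongrightarrow> norm f') (at 0)"
    using assms unfolding has_vector_derivative_iff_quotient by (rule tendsto_norm)
  from order_tendstoD(2)[OF this, of "norm f' + 1"]
  have "\<forall>\<^sub>F s in at 0. norm ((f (a + s) - f a) /\<^sub>R s) < norm f' + 1" by simp
  then have "\<forall>\<^sub>F s in nhds 0. s \<noteq> 0 \<longrightarrow> norm ((f (a + s) - f a) /\<^sub>R s) < norm f' + 1"
    by (simp add: eventually_at_filter)
  then have "\<forall>\<^sub>F s in nhds 0. norm (f (a + s) - f a) \<le> (norm f' + 1) * \<bar>s\<bar>"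
  proof eventually_elim
    case (elim s)
    then show ?case
      by (cases "s = 0") (auto simp: divide_inverse_commute[symmetric] pos_divide_less_eq intro: less_imp_le)
  qed
  then show ?thesis by (rule that)
qed

text \<open>\<open>D\<close> is the set of times at which \<open>z1\<close> is meaningful: below, the times at which a
  trajectory lies in the domain of a chart.\<close>

lemma continuous_dependence:
  fixes z0 :: "real \<Rightarrow> 'b::euclidean_space" and G :: "'b \<Rightarrow> 'b"
  assumes T: "T \<ge> 0" and \<sigma>: "\<sigma> > 0"
    and z0: "\<And>t. 0 \<le> t \<Longrightarrow> t \<le> T \<Longrightarrow> (z0 has_vector_derivative G (z0 t)) (at t)"
    and G: "\<And>t. 0 \<le> t \<Longrightarrow> t \<le> T \<Longrightarrow> loclip_at G (z0 t)"
  obtains \<rho> M where "\<rho> > 0" "M \<ge> 0"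
    "\<And>D z1 t. norm (z1 0 - z0 0) \<le> \<rho> \<Longrightarrow> 0 \<in> D \<Longrightarrow>
       (\<And>t. 0 \<le> t \<Longrightarrow> t \<le> T \<Longrightarrow> t \<in> D \<Longrightarrow> (z1 has_vector_derivative G (z1 t)) (at t)) \<Longrightarrow>
       (\<And>t. 0 \<le> t \<Longrightarrow> t \<le> T \<Longrightarrow> t \<in> D \<Longrightarrow> \<forall>\<^sub>F t' in nhds t. t' \<in> D) \<Longrightarrow>
       (\<And>t. 0 < t \<Longrightarrow> t \<le> T \<Longrightarrow>
          (\<And>t'. 0 \<le> t' \<Longrightarrow> t' < t \<Longrightarrow> t' \<in> D \<and> norm (z1 t' - z0 t') \<le> \<sigma>) \<Longrightarrow> t \<in> D) \<Longrightarrow>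
       0 \<le> t \<Longrightarrow> t \<le> T \<Longrightarrow>
       t \<in> D \<and> norm (z1 t - z0 t) \<le> M * norm (z1 0 - z0 0)
       \<and> norm (G (z1 t) - G (z0 t)) \<le> M * norm (z1 0 - z0 0)"
proof -
  have cz0: "continuous_on {0..T} z0"
    by (rule continuous_at_imp_continuous_on)
      (use z0 in \<open>auto intro!: has_vector_derivative_continuous\<close>)
  obtain \<rho>0 L where L: "\<rho>0 > 0" "L \<ge> 0"
    "\<And>z y. z \<in> z0 ` {0..T} \<Longrightarrow> norm (y - z) \<le> \<rho>0 \<Longrightarrow> norm (G y - G z) \<le> L * norm (y - z)"
    by (rule loclip_at_compact[of "z0 ` {0..T}" G]) (use G cz0 in \<open>auto intro: compact_continuous_image\<close>)
  \<comment> \<open>Within distance \<open>r\<close> the Lipschitz estimate for \<open>G\<close>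
    holds and the closedness condition on \<open>D\<close> applies.\<close>
  define r where "r = min \<rho>0 \<sigma>"
  \<comment> \<open>Gronwall's factor turns an initial distance of at most \<open>\<rho>\<close>
    into at most \<open>r / 2\<close>; the strict gap to \<open>r\<close> is what allows the
    estimate to be continued past any given time.\<close>
  define \<rho> where "\<rho> = r / 2 / exp (L * T)"
  \<comment> \<open>One constant for both conclusions: \<open>exp (L * T)\<close> serves the
    distance, \<open>L * exp (L * T)\<close> the difference of the fields.\<close>
  define M where "M = (1 + L) * exp (L * T)"
  have r: "r > 0" "r \<le> \<rho>0" "r \<le> \<sigma>" unfolding r_def using L \<sigma> by auto
  show ?thesis
  proof (rule that[of \<rho> M])
    show "\<rho> > 0" "M \<ge> 0" unfolding \<rho>_def M_def using L r by auto
    fix D and z1 :: "real \<Rightarrow> 'b" and t :: real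
    assume init: "norm (z1 0 - z0 0) \<le> \<rho>" and D0: "0 \<in> D"
      and z1: "\<And>t. 0 \<le> t \<Longrightarrow> t \<le> T \<Longrightarrow> t \<in> D \<Longrightarrow> (z1 has_vector_derivative G (z1 t)) (at t)"
      and Dopen: "\<And>t. 0 \<le> t \<Longrightarrow> t \<le> T \<Longrightarrow> t \<in> D \<Longrightarrow> \<forall>\<^sub>F t' in nhds t. t' \<in> D"
      and Dclosed: "\<And>t. 0 < t \<Longrightarrow> t \<le> T \<Longrightarrow>
          (\<And>t'. 0 \<le> t' \<Longrightarrow> t' < t \<Longrightarrow> t' \<in> D \<and> norm (z1 t' - z0 t') \<le> \<sigma>) \<Longrightarrow> t \<in> D"
    define u where "u t = z1 t - z0 t" for t
    define d where "d = norm (u 0)"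
    have d: "d \<ge> 0" "d * exp (L * T) \<le> r / 2"
      using init unfolding d_def u_def \<rho>_def by (auto simp: field_simps)
    have de: "d * exp (L * t) \<le> d * exp (L * T)" if "t \<le> T" for t
      using d(1) L(2) that by (intro mult_left_mono) (auto intro: mult_left_mono)
    have isu: "isCont u t" if "0 \<le> t" "t \<le> T" "t \<in> D" for t
      unfolding u_def using z1[OF that] z0[OF that(1,2)] by (intro continuous_intros has_vector_derivative_continuous)
    have gron: "norm (u t) \<le> d * exp (L * t)"
      if "0 \<le> t" "t \<le> T" "\<And>t'. 0 \<le> t' \<Longrightarrow> t' \<le> t \<Longrightarrow> t' \<in> D"
        "\<And>t'. 0 \<le> t' \<Longrightarrow> t' < t \<Longrightarrow> norm (u t') \<le> r" for t
    proof -
      have "norm (u t) \<le> norm (u 0) * exp (L * (t - 0))"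
      proof (rule gronwall_norm[where u' = "\<lambda>\<tau>. G (z1 \<tau>) - G (z0 \<tau>)"])
        show "continuous_on {0..t} u"
          by (rule continuous_at_imp_continuous_on) (use isu that in auto)
        fix \<tau> assume \<tau>: "0 < \<tau>" "\<tau> < t"
        show "(u has_vector_derivative G (z1 \<tau>) - G (z0 \<tau>)) (at \<tau>)"
          unfolding u_def using \<tau> that by (intro has_vector_derivative_diff z1 z0) auto
        show "norm (G (z1 \<tau>) - G (z0 \<tau>)) \<le> L * norm (u \<tau>)"
          unfolding u_def using \<tau> that(2) that(4)[of \<tau>] r by (intro L(3)) (auto simp: u_def)
      qed (use that in auto)
      then show ?thesis by (simp add: d_def)
    qed
    \<comment> \<open>Continuation argument at the infimum \<open>m\<close> of the times where the
      estimate fails: the conditions on \<open>D\<close> let the estimate reach \<open>m\<close>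
      itself, and continuity together with the gap between \<open>r / 2\<close> and \<open>r\<close>
      carries it beyond \<open>m\<close>.\<close>
    define bad where "bad = {t. 0 \<le> t \<and> t \<le> T \<and> \<not> (t \<in> D \<and> norm (u t) \<le> d * exp (L * t))}"
    have good: "t \<in> D \<and> norm (u t) \<le> d * exp (L * t)" if "0 \<le> t" "t \<le> T" for t
    proof (rule ccontr)
      assume "\<not> ?thesis"
      then have ne: "bad \<noteq> {}" using that bad_def by blast
      have bb: "bdd_below bad" unfolding bad_def by (rule bdd_belowI[of _ 0]) auto
      define m where "m = Inf bad"
      have m: "0 \<le> m" "m \<le> T"
        using cInf_greatest[OF ne, of 0] cInf_lower[OF _ bb] ne unfolding m_def bad_def by fastforce+
      have below: "t' \<in> D \<and> norm (u t') \<le> d * exp (L * t')" if "0 \<le> t'" "t' < m" for t'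
        using cInf_lower[OF _ bb, of t'] that m unfolding m_def bad_def by fastforce
      have below': "norm (u t') \<le> r / 2" if "0 \<le> t'" "t' < m" for t'
        using below[OF that] de[of t'] d that m by linarith
      have mD: "m \<in> D"
      proof (cases "m = 0")
        case False
        then show ?thesis
          using m below below' r by (intro Dclosed) (auto simp: u_def order_trans[OF below'[unfolded u_def]])
      qed (use D0 in simp)
      have mu: "norm (u m) \<le> d * exp (L * m)"
      proof (rule gron)
        fix t' assume "0 \<le> t'" "t' < m"
        then show "norm (u t') \<le> r" using below'[of t'] r by linarith
      qed (use m mD below le_less in auto)
      then have mr: "norm (u m) < r" using de[OF m(2)] d r by linarith
      have "((\<lambda>t. norm (u t)) \<longlongrightarrow> norm (u m)) (nhds m)"
        using isu[OF m mD] by (metis continuous_at tendsto_at_iff_tendsto_nhds tendsto_norm)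
      from order_tendstoD(2)[OF this mr] Dopen[OF m mD]
      have "\<forall>\<^sub>F t' in nhds m. norm (u t') < r \<and> t' \<in> D" by eventually_elim auto
      then obtain e where e: "e > 0" "\<And>t'. dist t' m < e \<Longrightarrow> norm (u t') < r \<and> t' \<in> D"
        unfolding eventually_nhds_metric by blast
      have "m + e \<le> t'" if t': "t' \<in> bad" for t'
      proof (rule ccontr)
        assume "\<not> m + e \<le> t'"
        moreover have "m \<le> t'" using cInf_lower[OF t' bb] by (simp add: m_def)
        ultimately have t'': "m \<le> t'" "t' < m + e" by auto
        have "t'' \<in> D \<and> norm (u t'') \<le> r" if "0 \<le> t''" "t'' \<le> t'" for t''
        proof (cases "t'' < m")
          case True
          then show ?thesis using below[of t''] below'[of t''] that r by auto
        next
          case False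
          then show ?thesis using e(2)[of t''] that t'' by (auto simp: dist_real_def)
        qed
        then show False using gron[of t'] t' unfolding bad_def by force
      qed
      then have "m + e \<le> Inf bad" by (intro cInf_greatest[OF ne])
      then show False using e(1) by (simp add: m_def)
    qed
    assume t: "0 \<le> t" "t \<le> T"
    have ut: "norm (u t) \<le> exp (L * T) * d" using good[OF t] de[OF t(2)] by (simp add: mult.commute)
    have "norm (G (z1 t) - G (z0 t)) \<le> L * norm (u t)"
      unfolding u_def using ut d r t by (intro L(3)) (auto simp: u_def mult.commute)
    also have "\<dots> \<le> L * (exp (L * T) * d)" by (rule mult_left_mono[OF ut L(2)])
    also have "\<dots> \<le> M * d" unfolding M_def using d L by (simp add: algebra_simps)
    finally have "norm (G (z1 t) - G (z0 t)) \<le> M * d" .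
    moreover have "exp (L * T) * d \<le> M * d" unfolding M_def using d L by (simp add: algebra_simps)
    ultimately show "t \<in> D \<and> norm (z1 t - z0 t) \<le> M * norm (z1 0 - z0 0)
       \<and> norm (G (z1 t) - G (z0 t)) \<le> M * norm (z1 0 - z0 0)"
      using good[OF t] ut by (auto simp: d_def u_def)
  qed
qed

text \<open>Interpolation: a bound on the second time derivative of the difference quotients lets their
  pointwise convergence pass to the first time derivative.\<close>

lemma difference_quotient_derivative:
  fixes x v a :: "real \<Rightarrow> real \<Rightarrow> 'b::euclidean_space"
  assumes D: "\<forall>\<^sub>F s in nhds 0. \<forall>t\<in>ball t0 \<delta>. (x s has_vector_derivative v s t) (at t)
      \<and> (v s has_vector_derivative a s t) (at t) \<and> norm (a s t - a 0 t) \<le> C * \<bar>s\<bar>"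
    and \<delta>: "\<delta> > 0"
    and \<zeta>: "\<And>t. t \<in> ball t0 \<delta> \<Longrightarrow> ((\<lambda>s. x s t) has_vector_derivative \<zeta> t) (at 0)"
  obtains \<eta> where "(\<zeta> has_vector_derivative \<eta>) (at t0)" "((\<lambda>s. v s t0) has_vector_derivative \<eta>) (at 0)"
proof -
  define Q where "Q s = (v s t0 - v 0 t0) /\<^sub>R s" for s
  define q where "q h = (\<zeta> (t0 + h) - \<zeta> t0) /\<^sub>R h" for h
  \<comment> \<open>\<open>\<bar>C\<bar>\<close> bounds the Taylor remainder, and the additional
    \<open>1\<close> absorbs the error of replacing the difference quotients of the positions by
    \<zeta>.\<close>
  define K where "K = \<bar>C\<bar> + 1"
  have K: "K > 0" by (simp add: K_def)
  have D0: "\<And>t. t \<in> ball t0 \<delta> \<Longrightarrow> (x 0 has_vector_derivative v 0 t) (at t)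
      \<and> (v 0 has_vector_derivative a 0 t) (at t)"
    using eventually_nhds_x_imp_x[OF D] by blast
  \<comment> \<open>Taylor expansion in time of \<open>(x s - x 0) / s\<close> with step
    \<open>h\<close>: it compares the time quotient of \<zeta> with the parameter quotient of
    \<open>v\<close>. The two limits are decoupled, as \<open>h\<close> is fixed while
    \<open>s\<close> tends to zero.\<close>
  have key: "\<forall>\<^sub>F s in at 0. norm (q h - Q s) \<le> K * \<bar>h\<bar>" if h: "h \<noteq> 0" "\<bar>h\<bar> < \<delta>" for h
  proof -
    define w where "w s t = x s t - x 0 t" for s t
    define V where "V s t = v s t - v 0 t" for s t
    define I where "I = closed_segment t0 (t0 + h)"
    have I: "I \<subseteq> ball t0 \<delta>" "convex I" "t0 \<in> I" "t0 + h \<in> I" unfolding I_def using h \<delta>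
      by (auto simp: dist_real_def closed_segment_eq_real_ivl split: if_splits)
    have Ih: "\<bar>t - t0\<bar> \<le> \<bar>h\<bar>" if "t \<in> I" for t
      using that unfolding I_def closed_segment_eq_real_ivl by (auto split: if_splits)
    have "((\<lambda>s. w s t /\<^sub>R s) \<longlongrightarrow> \<zeta> t) (at 0)" if "t \<in> I" for t
      using \<zeta>[of t] that I unfolding has_vector_derivative_iff_quotient w_def by auto
    then have "((\<lambda>s. w s (t0 + h) /\<^sub>R s - w s t0 /\<^sub>R s) \<longlongrightarrow> \<zeta> (t0 + h) - \<zeta> t0) (at 0)"
      using I by (intro tendsto_diff) auto
    \<comment> \<open>A tolerance of \<open>h\<^sup>2\<close> becomes \<open>\<bar>h\<bar>\<close>
      after division by the step, the same order as the remainder.\<close>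
    then have "\<forall>\<^sub>F s in at 0. norm (w s (t0 + h) /\<^sub>R s - w s t0 /\<^sub>R s - (\<zeta> (t0 + h) - \<zeta> t0)) < h\<^sup>2"
      using h tendstoD[of _ _ _ "h\<^sup>2"] by (fastforce simp: dist_norm)
    moreover have "\<forall>\<^sub>F s in at 0. s \<noteq> (0::real)" by (simp add: eventually_at_filter)
    moreover have "\<forall>\<^sub>F s in at 0. \<forall>t\<in>ball t0 \<delta>. (x s has_vector_derivative v s t) (at t)
      \<and> (v s has_vector_derivative a s t) (at t) \<and> norm (a s t - a 0 t) \<le> C * \<bar>s\<bar>"
      using D by (simp add: eventually_at_filter eventually_mono)
    ultimately show ?thesis
    proof eventually_elim
      case (elim s)
      have V_eq: "V s = (\<lambda>t. v s t - v 0 t)" and w_eq: "w s = (\<lambda>t. x s t - x 0 t)"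
        by (simp_all add: V_def w_def fun_eq_iff)
      have Ds: "(x s has_vector_derivative v s t) (at t) \<and> (v s has_vector_derivative a s t) (at t)
          \<and> (x 0 has_vector_derivative v 0 t) (at t) \<and> (v 0 has_vector_derivative a 0 t) (at t)"
        if "t \<in> I" for t
        using that I(1) elim(3) D0 by blast
      have a: "norm (a s t - a 0 t) \<le> \<bar>C\<bar> * \<bar>s\<bar>" if "t \<in> I" for t
      proof -
        have "norm (a s t - a 0 t) \<le> C * \<bar>s\<bar>" using elim that I by auto
        also have "\<dots> \<le> \<bar>C\<bar> * \<bar>s\<bar>" by (rule mult_right_mono) auto
        finally show ?thesis .
      qed
      have V: "norm (V s t - V s t0) \<le> \<bar>C\<bar> * \<bar>s\<bar> * \<bar>h\<bar>" if t: "t \<in> I" for t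
      proof -
        have "norm (V s t - V s t0) \<le> (\<bar>C\<bar> * \<bar>s\<bar>) * norm (t - t0)"
        proof (rule differentiable_bound[OF I(2) _ _ t I(3)])
          fix t assume t: "t \<in> I"
          show "(V s has_derivative (\<lambda>k. k *\<^sub>R (a s t - a 0 t))) (at t within I)"
            unfolding V_eq has_vector_derivative_def[symmetric]
            using Ds[OF t] by (intro has_vector_derivative_at_within[OF has_vector_derivative_diff]) blast+
          show "onorm (\<lambda>k. k *\<^sub>R (a s t - a 0 t)) \<le> \<bar>C\<bar> * \<bar>s\<bar>"
          proof (rule onorm_le)
            fix k :: real
            show "norm (k *\<^sub>R (a s t - a 0 t)) \<le> \<bar>C\<bar> * \<bar>s\<bar> * norm k"
              using mult_right_mono[OF a[OF t], of "\<bar>k\<bar>"] by (simp add: mult.commute)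
          qed
        qed
        also have "\<dots> \<le> \<bar>C\<bar> * \<bar>s\<bar> * \<bar>h\<bar>" using Ih[OF t] by (intro mult_left_mono) auto
        finally show ?thesis .
      qed
      have "norm (w s (t0 + h) - w s t0 - (t0 + h - t0) *\<^sub>R V s t0) \<le> norm (t0 + h - t0) * (\<bar>C\<bar> * \<bar>s\<bar> * \<bar>h\<bar>)"
      proof (rule vector_differentiable_bound_linearization[where S = I and f' = "V s"])
        fix t assume t: "t \<in> I"
        show "(w s has_vector_derivative V s t) (at t within I)"
          unfolding w_eq V_def
          using Ds[OF t] by (intro has_vector_derivative_at_within[OF has_vector_derivative_diff]) blast+
      qed (use V I(3) in \<open>simp_all add: I_def\<close>)
      then have w: "norm (w s (t0 + h) - w s t0 - h *\<^sub>R V s t0) \<le> \<bar>C\<bar> * h\<^sup>2 * \<bar>s\<bar>"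
        by (simp add: power2_eq_square mult_ac abs_mult_self_eq[of h, symmetric] del: abs_mult_self_eq)
      have "norm (w s (t0 + h) /\<^sub>R s - w s t0 /\<^sub>R s - h *\<^sub>R Q s)
          = norm ((w s (t0 + h) - w s t0 - h *\<^sub>R V s t0) /\<^sub>R s)"
        by (simp add: Q_def V_def scaleR_diff_right mult.commute)
      also have "\<dots> = norm (w s (t0 + h) - w s t0 - h *\<^sub>R V s t0) / \<bar>s\<bar>" by (simp add: divide_inverse_commute)
      also have "\<dots> \<le> \<bar>C\<bar> * h\<^sup>2" using w elim by (simp add: divide_le_eq)
      finally have *: "norm (w s (t0 + h) /\<^sub>R s - w s t0 /\<^sub>R s - h *\<^sub>R Q s) \<le> \<bar>C\<bar> * h\<^sup>2" .
      have "norm ((\<zeta> (t0 + h) - \<zeta> t0) - h *\<^sub>R Q s) \<le> K * h\<^sup>2"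
        using * elim(1) norm_triangle_ineq4[of "w s (t0 + h) /\<^sub>R s - w s t0 /\<^sub>R s - h *\<^sub>R Q s"
            "w s (t0 + h) /\<^sub>R s - w s t0 /\<^sub>R s - (\<zeta> (t0 + h) - \<zeta> t0)"]
        by (simp add: K_def algebra_simps)
      moreover have "(\<zeta> (t0 + h) - \<zeta> t0) - h *\<^sub>R Q s = h *\<^sub>R (q h - Q s)"
        using h by (simp add: q_def scaleR_diff_right)
      ultimately have "\<bar>h\<bar> * norm (q h - Q s) \<le> \<bar>h\<bar> * (K * \<bar>h\<bar>)"
        by (simp add: power2_eq_square mult_ac)
      then show ?case using h by simp
    qed
  qed
  \<comment> \<open>\<open>Q s\<close> is only an intermediary and drops out; one sufficiently small
    \<open>s\<close> is enough.\<close>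
  have qq: "norm (q h - q k) \<le> K * \<bar>h\<bar> + K * \<bar>k\<bar>"
    if "h \<noteq> 0" "\<bar>h\<bar> < \<delta>" "k \<noteq> 0" "\<bar>k\<bar> < \<delta>" for h k
  proof -
    have "\<forall>\<^sub>F s in at (0::real). norm (q h - q k) \<le> K * \<bar>h\<bar> + K * \<bar>k\<bar>"
      using key[OF that(1,2)] key[OF that(3,4)]
    proof eventually_elim
      case (elim s)
      then show ?case using norm_triangle_ineq4[of "q h - Q s" "q k - Q s"] by simp
    qed
    then show ?thesis by simp
  qed
  \<comment> \<open>Adding \<open>2\<close> keeps \<open>\<bar>hn n\<bar> < \<delta>\<close> already
    for \<open>n = 0\<close>. No candidate for the derivative is known yet, so it is produced by
    completeness as a limit along this sequence.\<close>
  define hn where "hn n = \<delta> / (real n + 2)" for n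
  have hn: "hn n \<noteq> 0" "\<bar>hn n\<bar> < \<delta>" for n
    using \<delta> by (auto simp: hn_def field_simps add_pos_nonneg)
  have hn0: "hn \<longlonglongrightarrow> 0" unfolding hn_def
    by (rule tendsto_divide_0[OF tendsto_const])
      (intro filterlim_at_top_imp_at_infinity filterlim_tendsto_add_at_top[OF tendsto_const, of _ _ 2, simplified add.commute] filterlim_real_sequentially)
  have "Cauchy (\<lambda>n. q (hn n))"
  proof (rule metric_CauchyI)
    fix e :: real assume e: "e > 0"
    have "(\<lambda>n. K * \<bar>hn n\<bar>) \<longlonglongrightarrow> K * \<bar>0\<bar>" by (intro tendsto_intros hn0)
    then have "\<forall>\<^sub>F n in sequentially. K * \<bar>hn n\<bar> < e / 2"
      using order_tendstoD(2)[of _ "K * \<bar>0\<bar>" _ "e/2"] e by simp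
    then obtain N where N: "\<And>n. n \<ge> N \<Longrightarrow> K * \<bar>hn n\<bar> < e / 2" unfolding eventually_sequentially by blast
    show "\<exists>M. \<forall>m\<ge>M. \<forall>n\<ge>M. dist (q (hn m)) (q (hn n)) < e"
    proof (intro exI[of _ N] allI impI)
      fix m n assume "m \<ge> N" "n \<ge> N"
      then show "dist (q (hn m)) (q (hn n)) < e"
        using N[of m] N[of n] qq[OF hn hn, of m n] by (simp add: dist_norm)
    qed
  qed
  then obtain \<eta> where \<eta>: "(\<lambda>n. q (hn n)) \<longlonglongrightarrow> \<eta>" using Cauchy_convergent convergentD by blast
  have q\<eta>: "norm (q h - \<eta>) \<le> K * \<bar>h\<bar>" if "h \<noteq> 0" "\<bar>h\<bar> < \<delta>" for h
  proof (rule tendsto_le[OF sequentially_bot])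
    show "(\<lambda>n. norm (q h - q (hn n))) \<longlonglongrightarrow> norm (q h - \<eta>)" by (intro tendsto_intros \<eta>)
    show "(\<lambda>n. K * \<bar>h\<bar> + K * \<bar>hn n\<bar>) \<longlonglongrightarrow> K * \<bar>h\<bar>"
      using tendsto_add[OF tendsto_const tendsto_mult[OF tendsto_const tendsto_rabs[OF hn0]], of "K * \<bar>h\<bar>" K] by simp
    show "\<forall>\<^sub>F n in sequentially. norm (q h - q (hn n)) \<le> K * \<bar>h\<bar> + K * \<bar>hn n\<bar>"
      using qq[OF that hn] by simp
  qed
  show ?thesis
  proof
    have "(q \<longlongrightarrow> \<eta>) (at 0)"
    proof (rule LIM_zero_cancel, rule Lim_null_comparison)
      show "\<forall>\<^sub>F h in at 0. norm (q h - \<eta>) \<le> K * \<bar>h\<bar>"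
        unfolding eventually_at using \<delta> q\<eta> by (intro exI[of _ \<delta>]) (auto simp: dist_real_def)
      show "((\<lambda>h. K * \<bar>h\<bar>) \<longlongrightarrow> 0) (at 0)" by (rule tendsto_eq_intros refl | simp)+
    qed
    then show "(\<zeta> has_vector_derivative \<eta>) (at t0)"
      unfolding has_vector_derivative_iff_quotient q_def .
    have "(Q \<longlongrightarrow> \<eta>) (at 0)"
    proof (rule tendstoI)
      fix e :: real assume e: "e > 0"
      \<comment> \<open>The two errors of size at most \<open>K * \<bar>h\<bar>\<close> then add up
        to at most \<open>e / 2\<close>.\<close>
      define h where "h = min (\<delta> / 2) (e / (4 * K))"
      have h: "h \<noteq> 0" "\<bar>h\<bar> < \<delta>" "K * \<bar>h\<bar> \<le> e / 4"
        using \<delta> e K unfolding h_def by (auto simp: min_def field_simps)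
      show "\<forall>\<^sub>F s in at 0. dist (Q s) \<eta> < e"
        using key[OF h(1,2)]
      proof eventually_elim
        case (elim s)
        have "norm (Q s - \<eta>) \<le> norm (q h - \<eta>) + norm (q h - Q s)"
          using norm_triangle_ineq4[of "q h - \<eta>" "q h - Q s"] by simp
        also have "\<dots> < e" using elim q\<eta>[OF h(1,2)] h(3) e by linarith
        finally show ?case by (simp add: dist_norm)
      qed
    qed
    then show "((\<lambda>s. v s t0) has_vector_derivative \<eta>) (at 0)"
      unfolding has_vector_derivative_iff_quotient Q_def by simp
  qed
qed

section \<open>The force field in coordinates\<close>

lemma bounded_bilinear_matrix_vector:
  "bounded_bilinear ((*v) :: real^'n^'m \<Rightarrow> real^'n \<Rightarrow> real^'m)"
  by (subst bilinear_conv_bounded_bilinear[symmetric])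
    (auto simp: bilinear_def linear_iff matrix_vector_right_distrib matrix_vector_mult_add_rdistrib
      scaleR_matrix_vector_assoc matrix_vector_mult_scaleR)

lemma loclip_at_det:
  fixes f :: "'a::real_normed_vector \<Rightarrow> real^'n^'n"
  assumes "\<And>i j. loclip_at (\<lambda>x. f x $ i $ j) z"
  shows "loclip_at (\<lambda>x. det (f x)) z"
  unfolding det_def by (intro loclip_at_sum loclip_at_mult loclip_at_const loclip_at_prod assms)

lemma inner_matrix_vector_expand:
  fixes A :: "real^'n^'m"
  shows "u \<bullet> (A *v w) = (\<Sum>i\<in>UNIV. \<Sum>j\<in>UNIV. A $ i $ j * u $ i * w $ j)"
  by (simp add: inner_vec_def matrix_vector_mult_def sum_distrib_left mult_ac)

lemma linear_axis_expansion:
  fixes f :: "real^'n \<Rightarrow> 'b::real_vector"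
  assumes "linear f" shows "f w = (\<Sum>i\<in>UNIV. (w $ i) *\<^sub>R f (axis i 1))"
proof -
  have "f w = f (\<Sum>i\<in>UNIV. (w $ i) *\<^sub>R axis i 1)"
    by (rule arg_cong[where f = f]) (simp add: vec_eq_iff axis_def if_distrib cong: if_cong)
  also have "\<dots> = (\<Sum>i\<in>UNIV. (w $ i) *\<^sub>R f (axis i 1))"
    using assms by (simp add: linear_sum linear_scale)
  finally show ?thesis .
qed

text \<open>One chart seen in its coordinates: \<open>\<Omega>\<close> stands for its image,
  \<open>gx\<close> for the matrix of the metric and \<open>Wc\<close> for the function
  \<open>W\<close>, while \<open>H\<close> contains all values of \<open>Wc\<close>. The
  differential identities are proved here, where every object is a function on a subset of a
  Euclidean space.\<close>

locale coordinate_field =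
  fixes \<Omega> :: "(real^'n::finite) set" and gx :: "real^'n \<Rightarrow> real^'n^'n"
    and Wc :: "(real^'n) \<times> real \<Rightarrow> real" and h :: "real \<Rightarrow> real" and H :: "real set"
  assumes open_\<Omega>: "open \<Omega>" and gx_smooth: "smooth_on \<Omega> gx"
    and gx_sym: "\<And>x. x \<in> \<Omega> \<Longrightarrow> transpose (gx x) = gx x"
    and gx_pos: "\<And>x v. x \<in> \<Omega> \<Longrightarrow> v \<noteq> 0 \<Longrightarrow> v \<bullet> (gx x *v v) > 0"
    and Wc_smooth: "smooth_on (\<Omega> \<times> {0<..}) Wc"
    and Wc_v: "\<And>x E. x \<in> \<Omega> \<Longrightarrow> E > 0 \<Longrightarrow> frechet_derivative Wc (at (x, E)) (0, 1) \<noteq> 0"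
    and H_open: "open H" and h_smooth: "smooth_on H h"
    and Wc_H: "\<And>x E. x \<in> \<Omega> \<Longrightarrow> E > 0 \<Longrightarrow> Wc (x, E) \<in> H"
begin

definition dg :: "real^'n \<Rightarrow> real^'n \<Rightarrow> real^'n^'n" where
  "dg x u = frechet_derivative gx (at x) u"

definition nrm :: "real^'n \<Rightarrow> real^'n \<Rightarrow> real" where
  "nrm x v = sqrt (v \<bullet> (gx x *v v))"

definition Wx :: "(real^'n) \<times> real \<Rightarrow> real^'n" where
  "Wx p = (\<chi> i. frechet_derivative Wc (at p) (axis i 1, 0))"

definition Wv :: "(real^'n) \<times> real \<Rightarrow> real" where
  "Wv p = frechet_derivative Wc (at p) (0, 1)"

text \<open>The covariant force \<open>F_k\<close>, with \<open>N = v / E\<close> multiplied out so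
  that only \<open>gx x *v v\<close>, \<open>Wx\<close> and powers of the speed \<open>E\<close>
  remain.\<close>

definition force :: "(real^'n) \<times> (real^'n) \<Rightarrow> real^'n" where
  "force z = (let x = fst z; v = snd z; E = nrm x v; p = (x, E) in
     (h (Wc p) / (Wv p * E)) *\<^sub>R (gx x *v v)
     - (E / Wv p) *\<^sub>R ((2 * (Wx p \<bullet> v) / (E * E)) *\<^sub>R (gx x *v v) - Wx p))"

text \<open>The Christoffel terms \<open>\<Gamma>(v, v)\<close> with the upper index lowered.\<close>

definition gam :: "(real^'n) \<times> (real^'n) \<Rightarrow> real^'n" where
  "gam z = (\<chi> l. \<Sum>i\<in>UNIV. \<Sum>j\<in>UNIV. 1/2 * (dg (fst z) (axis i 1) $ l $ j
      + dg (fst z) (axis j 1) $ i $ l - dg (fst z) (axis l 1) $ i $ j) * snd z $ i * snd z $ j)"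

text \<open>Solving \<open>g a = force - gam\<close> by Cramer's rule keeps the local Lipschitz property within reach
  of the closure rules for sums and products.\<close>

definition acc :: "(real^'n) \<times> (real^'n) \<Rightarrow> real^'n" where
  "acc z = (\<chi> k. det (\<chi> i j. if j = k then (force z - gam z) $ i else gx (fst z) $ i $ j)
     / det (gx (fst z)))"

definition phase_field :: "(real^'n) \<times> (real^'n) \<Rightarrow> (real^'n) \<times> (real^'n)" where
  "phase_field z = (snd z, acc z)"

text \<open>The coefficient of the lowered velocity \<open>gx x *v v\<close> in
  \<open>force\<close>, and hence the growth rate of the deviation \<psi> when the inhomogeneous
  term is absent.\<close>

definition \<kappa> :: "(real^'n) \<times> (real^'n) \<Rightarrow> real" where
  "\<kappa> z = (let x = fst z; v = snd z; E = nrm x v; p = (x, E) in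
     h (Wc p) / (Wv p * E) - 2 * (Wx p \<bullet> v) / (Wv p * E))"

lemma gx_deriv: "x \<in> \<Omega> \<Longrightarrow> (gx has_derivative dg x) (at x)"
  using smooth_on_has_derivative[OF gx_smooth] unfolding dg_def[abs_def] by simp

lemma dg_linear: "x \<in> \<Omega> \<Longrightarrow> linear (dg x)"
  using gx_deriv has_derivative_linear by blast

lemma Wc_deriv: "x \<in> \<Omega> \<Longrightarrow> E > 0 \<Longrightarrow>
    (Wc has_derivative (\<lambda>q. Wx (x, E) \<bullet> fst q + Wv (x, E) * snd q)) (at (x, E))"
proof -
  assume a: "x \<in> \<Omega>" "E > 0"
  let ?D = "frechet_derivative Wc (at (x, E))"
  have D: "(Wc has_derivative ?D) (at (x, E))"
    using smooth_on_has_derivative[OF Wc_smooth] a by simp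
  interpret D: linear ?D using D has_derivative_linear by blast
  have "?D q = Wx (x, E) \<bullet> fst q + Wv (x, E) * snd q" for q
  proof -
    have "q = (\<Sum>i\<in>UNIV. (fst q $ i) *\<^sub>R (axis i 1, 0)) + snd q *\<^sub>R (0, 1)"
      by (rule prod_eqI)
        (simp_all add: fst_sum snd_sum vec_eq_iff axis_def if_distrib cong: if_cong)
    then have "?D q = ?D ((\<Sum>i\<in>UNIV. (fst q $ i) *\<^sub>R (axis i 1, 0)) + snd q *\<^sub>R (0, 1))" by simp
    also have "\<dots> = (\<Sum>i\<in>UNIV. fst q $ i * ?D (axis i 1, 0)) + snd q * ?D (0, 1)"
      unfolding D.add D.sum D.scaleR by simp
    finally show ?thesis by (simp add: Wx_def Wv_def inner_vec_def mult.commute)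
  qed
  then have "?D = (\<lambda>q. Wx (x, E) \<bullet> fst q + Wv (x, E) * snd q)" by (rule ext)
  with D show ?thesis by simp
qed

text \<open>The identity \<open>gx y $ i $ j = gx y $ j $ i\<close> holds on an open set and may be
  differentiated.\<close>

lemma dg_sym: assumes "x \<in> \<Omega>" shows "dg x u $ i $ j = dg x u $ j $ i"
proof -
  have "((\<lambda>y. gx y $ i) has_derivative (\<lambda>u. dg x u $ i)) (at x)" for i
    by (rule bounded_linear.has_derivative[OF bounded_linear_vec_nth gx_deriv[OF assms]])
  from bounded_linear.has_derivative[OF bounded_linear_vec_nth this]
  have 1: "((\<lambda>y. gx y $ i $ j) has_derivative (\<lambda>u. dg x u $ i $ j)) (at x)" for i j .
  have "((\<lambda>y. gx y $ j $ i) has_derivative (\<lambda>u. dg x u $ i $ j)) (at x)"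
  proof (rule has_derivative_transform_within_open[OF 1 open_\<Omega> assms])
    fix y assume "y \<in> \<Omega>"
    then show "gx y $ i $ j = gx y $ j $ i" using arg_cong[OF gx_sym[of y], of "\<lambda>B. B $ i $ j"] by (simp add: transpose_def)
  qed
  from has_derivative_unique[OF this 1] show ?thesis by metis
qed

lemma gx_inner_sym: "x \<in> \<Omega> \<Longrightarrow> u \<bullet> (gx x *v w) = w \<bullet> (gx x *v u)"
  by (metis gx_sym dot_lmul_matrix inner_commute vector_transpose_matrix)

lemma nrm_pos: "x \<in> \<Omega> \<Longrightarrow> v \<noteq> 0 \<Longrightarrow> nrm x v > 0"
  using gx_pos by (simp add: nrm_def)

lemma nrm_square: "x \<in> \<Omega> \<Longrightarrow> v \<noteq> 0 \<Longrightarrow> v \<bullet> (gx x *v v) = nrm x v * nrm x v"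
  using gx_pos[of x v] by (simp add: nrm_def)

lemma Wv_nonzero: "x \<in> \<Omega> \<Longrightarrow> E > 0 \<Longrightarrow> Wv (x, E) \<noteq> 0"
  using Wc_v by (simp add: Wv_def)

lemma det_gx: assumes "x \<in> \<Omega>" shows "det (gx x) \<noteq> 0"
proof -
  have "v = 0" if "gx x *v v = 0" for v
  proof (rule ccontr)
    assume "v \<noteq> 0"
    from gx_pos[OF assms this] that show False by simp
  qed
  then have "invertible (gx x)"
    unfolding invertible_left_inverse by (subst matrix_left_invertible_ker) blast
  then show ?thesis by (simp add: invertible_det_nz)
qed

text \<open>Positivity makes \<open>gx x\<close> invertible, so Cramer's formula is the only
  solution and the equation of motion can be read in either direction.\<close>

lemma acc_iff: "x \<in> \<Omega> \<Longrightarrow> gx x *v a = force (x, v) - gam (x, v) \<longleftrightarrow> a = acc (x, v)"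
  unfolding acc_def by (subst cramer) (simp_all only: det_gx fst_conv not_False_eq_True)

section \<open>Local Lipschitz property of the equation of motion, and the Christoffel terms\<close>

context
  fixes x v :: "real^'n"
  assumes x: "x \<in> \<Omega>" and v: "v \<noteq> 0"
begin

lemma loclip_gx: "loclip_at (\<lambda>z. gx (fst z)) (x, v)"
  by (rule loclip_at_compose[OF _ loclip_at_fst])
    (use smooth_on_loclip_at[OF gx_smooth open_\<Omega>] x in simp)

lemma loclip_dg: "loclip_at (\<lambda>z. dg (fst z) u) (x, v)"
  unfolding dg_def
  by (rule loclip_at_compose[OF _ loclip_at_fst])
    (use smooth_on_loclip_at[OF smooth_on_frechet_derivative[OF gx_smooth] open_\<Omega>] x in simp)

lemma loclip_gv: "loclip_at (\<lambda>z. gx (fst z) *v snd z) (x, v)"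
  by (intro loclip_at_bilinear[OF bounded_bilinear_matrix_vector] loclip_gx loclip_at_snd)

lemma loclip_nrm: "loclip_at (\<lambda>z. nrm (fst z) (snd z)) (x, v)"
  unfolding nrm_def using gx_pos[OF x v]
  by (intro loclip_at_sqrt loclip_at_inner loclip_at_snd loclip_gv) simp_all

lemma loclip_pt: "loclip_at (\<lambda>z. (fst z, nrm (fst z) (snd z))) (x, v)"
  by (intro loclip_at_Pair loclip_at_fst loclip_nrm)

lemma dom_pt: "(x, nrm x v) \<in> \<Omega> \<times> {0<..}" "open (\<Omega> \<times> {0::real<..})"
  using x nrm_pos[OF x v] open_\<Omega> by (auto intro!: open_Times open_greaterThan)

lemma loclip_W: "loclip_at (\<lambda>z. Wc (fst z, nrm (fst z) (snd z))) (x, v)"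
  by (rule loclip_at_compose[OF _ loclip_pt]) (use smooth_on_loclip_at[OF Wc_smooth dom_pt(2,1)] in simp)

lemma loclip_hW: "loclip_at (\<lambda>z. h (Wc (fst z, nrm (fst z) (snd z)))) (x, v)"
  by (rule loclip_at_compose[OF _ loclip_W])
    (use smooth_on_loclip_at[OF h_smooth H_open] Wc_H[OF x nrm_pos[OF x v]] in simp)

lemma loclip_Wx: "loclip_at (\<lambda>z. Wx (fst z, nrm (fst z) (snd z))) (x, v)"
proof (rule loclip_at_vecI)
  fix i
  show "loclip_at (\<lambda>z. Wx (fst z, nrm (fst z) (snd z)) $ i) (x, v)"
    unfolding Wx_def vec_lambda_beta
    by (rule loclip_at_compose[OF _ loclip_pt])
      (use smooth_on_loclip_at[OF smooth_on_frechet_derivative[OF Wc_smooth] dom_pt(2,1)] in simp)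
qed

lemma loclip_Wv: "loclip_at (\<lambda>z. Wv (fst z, nrm (fst z) (snd z))) (x, v)"
  unfolding Wv_def
  by (rule loclip_at_compose[OF _ loclip_pt])
    (use smooth_on_loclip_at[OF smooth_on_frechet_derivative[OF Wc_smooth] dom_pt(2,1)] in simp)

lemmas loclip_data = loclip_gx loclip_dg loclip_gv loclip_nrm loclip_W loclip_hW loclip_Wx loclip_Wv
  loclip_at_fst loclip_at_snd

lemma nonzero_data: "Wv (x, nrm x v) \<noteq> 0" "nrm x v \<noteq> 0"
  using nrm_pos[OF x v] Wv_nonzero[OF x] by auto

lemma loclip_force: "loclip_at force (x, v)"
  unfolding force_def[abs_def] Let_def using nonzero_data
  by (intro loclip_at_diff loclip_at_scaleR loclip_at_divide loclip_at_mult loclip_at_inner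
      loclip_at_const loclip_data) simp_all

lemma loclip_\<kappa>: "loclip_at \<kappa> (x, v)"
  unfolding \<kappa>_def[abs_def] Let_def using nonzero_data
  by (intro loclip_at_diff loclip_at_scaleR loclip_at_divide loclip_at_mult loclip_at_inner
      loclip_at_const loclip_data) simp_all

lemma loclip_gam: "loclip_at gam (x, v)"
  unfolding gam_def[abs_def]
  by (rule loclip_at_vecI, unfold vec_lambda_beta)
    (intro loclip_at_sum loclip_at_mult loclip_at_diff loclip_at_add loclip_at_const
      loclip_at_vec_nth loclip_data)

lemma loclip_acc: "loclip_at acc (x, v)"
proof (rule loclip_at_vecI, unfold acc_def vec_lambda_beta, rule loclip_at_divide)
  show "loclip_at (\<lambda>z. det (gx (fst z))) (x, v)"
    by (intro loclip_at_det loclip_at_vec_nth loclip_data)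
  show "det (gx (fst (x, v))) \<noteq> 0" using det_gx x by simp
  fix k
  show "loclip_at (\<lambda>z. det (\<chi> i j. if j = k then (force z - gam z) $ i else gx (fst z) $ i $ j)) (x, v)"
  proof (rule loclip_at_det, unfold vec_lambda_beta)
    fix i j
    show "loclip_at (\<lambda>z. if j = k then (force z - gam z) $ i else gx (fst z) $ i $ j) (x, v)"
      by (cases "j = k") (simp_all only: simp_thms if_True if_False loclip_at_vec_nth loclip_data
          loclip_at_diff loclip_force loclip_gam)
  qed
qed

lemma loclip_phase_field: "loclip_at phase_field (x, v)"
  unfolding phase_field_def[abs_def] by (intro loclip_at_Pair loclip_at_snd loclip_acc)

text \<open>The two positive terms of the Christoffel symbols of the first kind coincide once
  contracted twice with \<open>v\<close>, since \<open>i\<close> and \<open>j\<close> may be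
  exchanged; together they give \<open>dg x v\<close>, the derivative of the metric along
  \<open>v\<close>.\<close>

lemma inner_gam:
  "u \<bullet> gam (x, v) = u \<bullet> (dg x v *v v) - 1/2 * (v \<bullet> (dg x u *v v))"
proof -
  note ex = linear_axis_expansion[OF dg_linear[OF x]]
  have ex': "dg x w $ a $ b = (\<Sum>i\<in>UNIV. w $ i * dg x (axis i 1) $ a $ b)" for w a b
    by (subst ex) simp
  define P where "P l i j = dg x (axis l 1) $ i $ j" for l i j
  have P: "P l i j = P l j i" for l i j unfolding P_def by (rule dg_sym[OF x])
  have A: "u \<bullet> (dg x v *v v) = (\<Sum>l\<in>UNIV. \<Sum>i\<in>UNIV. \<Sum>j\<in>UNIV. P i l j * u $ l * v $ i * v $ j)"
  proof -
    have "u \<bullet> (dg x v *v v) = (\<Sum>l\<in>UNIV. \<Sum>j\<in>UNIV. \<Sum>i\<in>UNIV. P i l j * u $ l * v $ i * v $ j)"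
      unfolding inner_matrix_vector_expand ex'[of v] P_def by (simp add: sum_distrib_left sum_distrib_right mult_ac)
    also have "\<dots> = (\<Sum>l\<in>UNIV. \<Sum>i\<in>UNIV. \<Sum>j\<in>UNIV. P i l j * u $ l * v $ i * v $ j)"
      by (intro sum.cong refl sum.swap)
    finally show ?thesis .
  qed
  have A': "(\<Sum>l\<in>UNIV. \<Sum>i\<in>UNIV. \<Sum>j\<in>UNIV. P j i l * u $ l * v $ i * v $ j) = u \<bullet> (dg x v *v v)"
    unfolding A
  proof (rule sum.cong[OF refl])
    fix l
    show "(\<Sum>i\<in>UNIV. \<Sum>j\<in>UNIV. P j i l * u $ l * v $ i * v $ j)
        = (\<Sum>i\<in>UNIV. \<Sum>j\<in>UNIV. P i l j * u $ l * v $ i * v $ j)"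
      by (subst sum.swap, intro sum.cong refl) (simp add: P mult_ac)
  qed
  have B: "v \<bullet> (dg x u *v v) = (\<Sum>l\<in>UNIV. \<Sum>i\<in>UNIV. \<Sum>j\<in>UNIV. P l i j * u $ l * v $ i * v $ j)"
  proof -
    have "v \<bullet> (dg x u *v v) = (\<Sum>i\<in>UNIV. \<Sum>j\<in>UNIV. \<Sum>l\<in>UNIV. P l i j * u $ l * v $ i * v $ j)"
      unfolding inner_matrix_vector_expand ex'[of u] P_def by (simp add: sum_distrib_left sum_distrib_right mult_ac)
    also have "\<dots> = (\<Sum>i\<in>UNIV. \<Sum>l\<in>UNIV. \<Sum>j\<in>UNIV. P l i j * u $ l * v $ i * v $ j)"
      by (intro sum.cong refl sum.swap)
    also have "\<dots> = (\<Sum>l\<in>UNIV. \<Sum>i\<in>UNIV. \<Sum>j\<in>UNIV. P l i j * u $ l * v $ i * v $ j)"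
      by (rule sum.swap)
    finally show ?thesis .
  qed
  have "u \<bullet> gam (x, v) = (\<Sum>l\<in>UNIV. \<Sum>i\<in>UNIV. \<Sum>j\<in>UNIV.
      1/2 * (P i l j * u $ l * v $ i * v $ j) + 1/2 * (P j i l * u $ l * v $ i * v $ j)
      - 1/2 * (P l i j * u $ l * v $ i * v $ j))"
    by (simp add: gam_def P_def inner_vec_def sum_distrib_left algebra_simps)
  also have "\<dots> = 1/2 * (u \<bullet> (dg x v *v v)) + 1/2 * (u \<bullet> (dg x v *v v)) - 1/2 * (v \<bullet> (dg x u *v v))"
    by (simp only: sum.distrib sum_subtractf sum_distrib_left[symmetric] A[symmetric] A' B[symmetric])
  finally show ?thesis by simp
qed

lemma inner_g_acc:
  "u \<bullet> (gx x *v acc (x, v)) = u \<bullet> force (x, v) - u \<bullet> (dg x v *v v) + 1/2 * (v \<bullet> (dg x u *v v))"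
proof -
  have "gx x *v acc (x, v) = force (x, v) - gam (x, v)" using acc_iff[OF x] by blast
  then show ?thesis by (simp add: inner_diff_right inner_gam)
qed

end

section \<open>Derivatives along trajectories and across families of them\<close>

lemma has_derivative_g_form:
  assumes "(x has_vector_derivative x') (at t)" "(u has_vector_derivative u') (at t)"
    "(w has_vector_derivative w') (at t)" "x t \<in> \<Omega>"
  shows "((\<lambda>s. u s \<bullet> (gx (x s) *v w s)) has_vector_derivative
     u t \<bullet> (gx (x t) *v w' + dg (x t) x' *v w t) + u' \<bullet> (gx (x t) *v w t)) (at t)"
proof -
  have "((\<lambda>s. gx (x s)) has_vector_derivative dg (x t) x') (at t)"
    using vector_derivative_diff_chain_within[OF assms(1) has_derivative_at_withinI[OF gx_deriv[OF assms(4)]]]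
    by (simp add: o_def)
  from bounded_bilinear.has_vector_derivative[OF bounded_bilinear_matrix_vector this assms(3)]
  show ?thesis by (rule bounded_bilinear.has_vector_derivative[OF bounded_bilinear_inner assms(2)])
qed

lemma has_derivative_nrm:
  assumes "(x has_vector_derivative x') (at t)" "(w has_vector_derivative w') (at t)"
    "x t \<in> \<Omega>" "w t \<noteq> 0"
  shows "((\<lambda>s. nrm (x s) (w s)) has_vector_derivative
     (2 * (w' \<bullet> (gx (x t) *v w t)) + w t \<bullet> (dg (x t) x' *v w t)) / (2 * nrm (x t) (w t))) (at t)"
proof -
  have 1: "((\<lambda>s. w s \<bullet> (gx (x s) *v w s)) has_real_derivative
      2 * (w' \<bullet> (gx (x t) *v w t)) + w t \<bullet> (dg (x t) x' *v w t)) (at t)"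
    using has_derivative_g_form[OF assms(1,2,2,3)] gx_inner_sym[OF assms(3), of "w t" w']
    by (simp add: has_real_derivative_iff_has_vector_derivative inner_add_right add.commute)
  have "w t \<bullet> (gx (x t) *v w t) > 0" using gx_pos assms by blast
  from DERIV_chain2[OF DERIV_real_sqrt[OF this] 1] show ?thesis
    unfolding nrm_def by (simp add: has_real_derivative_iff_has_vector_derivative field_simps)
qed

lemma has_derivative_W:
  assumes x: "(x has_vector_derivative x') (at t)" and E: "(E has_vector_derivative E') (at t)"
    and "x t \<in> \<Omega>" "E t > 0"
  shows "((\<lambda>s. Wc (x s, E s)) has_vector_derivative Wx (x t, E t) \<bullet> x' + Wv (x t, E t) * E') (at t)"
proof -
  have "((\<lambda>s. (x s, E s)) has_vector_derivative (x', E')) (at t)"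
    using has_vector_derivative_Pair[OF x E] by simp
  from vector_derivative_diff_chain_within[OF this has_derivative_at_withinI[OF Wc_deriv[OF assms(3,4)]]]
  show ?thesis by (simp add: o_def)
qed

text \<open>The structural property of this force: apart from a multiple of the lowered velocity it
  is a multiple of the spatial gradient of \<open>W\<close>. With \<open>u = v\<close> this gives
  the equation for \<open>W\<close> along the motion, with \<open>u = \<zeta>\<close> the equation
  for the deviation.\<close>

lemma inner_force:
  assumes x: "x \<in> \<Omega>" and v: "v \<noteq> 0"
  shows "u \<bullet> force (x, v) = \<kappa> (x, v) * (u \<bullet> (gx x *v v)) + nrm x v / Wv (x, nrm x v) * (Wx (x, nrm x v) \<bullet> u)"
  using nonzero_data[OF x v]
  unfolding force_def \<kappa>_def Let_def fst_conv snd_conv inner_diff_right inner_scaleR_right inner_commute[of u "Wx _"]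
  by (simp add: field_simps)

text \<open>The Christoffel terms cancel the derivative of the metric, so the speed changes at the
  rate \<open>v \<bullet> force / |v|\<close>. When the force is inserted, all terms with
  \<open>Wx\<close> cancel and \<open>h (W)\<close> remains.\<close>

lemma W_along_solution:
  assumes x: "(x has_vector_derivative v t) (at t)" and v: "(v has_vector_derivative acc (x t, v t)) (at t)"
    and t: "x t \<in> \<Omega>" "v t \<noteq> 0"
  shows "((\<lambda>s. Wc (x s, nrm (x s) (v s))) has_vector_derivative h (Wc (x t, nrm (x t) (v t)))) (at t)"
proof -
  let ?E = "nrm (x t) (v t)"
  let ?p = "(x t, ?E)"
  have E: "?E > 0" by (rule nrm_pos[OF t])
  have Wv: "Wv ?p \<noteq> 0" by (rule Wv_nonzero[OF t(1) E])
  have "2 * (acc (x t, v t) \<bullet> (gx (x t) *v v t)) + v t \<bullet> (dg (x t) (v t) *v v t)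
      = 2 * (v t \<bullet> force (x t, v t))"
    by (subst gx_inner_sym[OF t(1)]) (simp add: inner_g_acc[OF t])
  then have N: "((\<lambda>s. nrm (x s) (v s)) has_vector_derivative (v t \<bullet> force (x t, v t)) / ?E) (at t)"
    using has_derivative_nrm[OF x v t] by simp
  have "Wx ?p \<bullet> v t + Wv ?p * ((v t \<bullet> force (x t, v t)) / ?E) = h (Wc ?p)"
    unfolding inner_force[OF t] nrm_square[OF t] \<kappa>_def Let_def
    using E Wv by (simp add: field_simps)
  with has_derivative_W[OF x N t(1) E] show ?thesis by simp
qed

lemma W_variation:
  assumes x: "(x has_vector_derivative \<zeta>) (at s)" and v: "(v has_vector_derivative \<eta>) (at s)"
    and s: "x s \<in> \<Omega>" "v s \<noteq> 0"
  shows "((\<lambda>s. Wc (x s, nrm (x s) (v s))) has_vector_derivative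
     Wx (x s, nrm (x s) (v s)) \<bullet> \<zeta> + Wv (x s, nrm (x s) (v s)) *
       ((2 * (\<eta> \<bullet> (gx (x s) *v v s)) + v s \<bullet> (dg (x s) \<zeta> *v v s)) / (2 * nrm (x s) (v s)))) (at s)"
  by (rule has_derivative_W[OF x has_derivative_nrm[OF x v s] s(1) nrm_pos[OF s]])

text \<open>Here \<open>x\<close> and \<open>v\<close> run in time along one trajectory,
  \<open>X\<close> and \<open>V\<close> across the family at the fixed time \<open>t\<close>. The
  same \<open>\<eta>\<close> is the time derivative of \<zeta> and the parameter derivative of the
  velocity: this is where the exchange of derivatives enters.\<close>

lemma deviation_derivative:
  assumes x: "(x has_vector_derivative v t) (at t)" and v: "(v has_vector_derivative acc (x t, v t)) (at t)"
    and \<zeta>: "(\<zeta> has_vector_derivative \<eta>) (at t)"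
    and t: "x t \<in> \<Omega>" "v t \<noteq> 0"
    and xs: "(X has_vector_derivative \<zeta> t) (at s)" "(V has_vector_derivative \<eta>) (at s)"
      "X s = x t" "V s = v t"
    and \<omega>: "((\<lambda>s. Wc (X s, nrm (X s) (V s))) has_vector_derivative \<omega>) (at s)"
  shows "((\<lambda>t. \<zeta> t \<bullet> (gx (x t) *v v t)) has_vector_derivative
     nrm (x t) (v t) / Wv (x t, nrm (x t) (v t)) * \<omega> + \<kappa> (x t, v t) * (\<zeta> t \<bullet> (gx (x t) *v v t))) (at t)"
proof -
  let ?E = "nrm (x t) (v t)"
  let ?p = "(x t, ?E)"
  let ?A = "\<eta> \<bullet> (gx (x t) *v v t)" and ?B = "v t \<bullet> (dg (x t) (\<zeta> t) *v v t)"
  have E: "?E > 0" by (rule nrm_pos[OF t])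
  have Wv: "Wv ?p \<noteq> 0" by (rule Wv_nonzero[OF t(1) E])
  have "\<omega> = Wx ?p \<bullet> \<zeta> t + Wv ?p * ((2 * ?A + ?B) / (2 * ?E))"
    using vector_derivative_unique_at[OF \<omega> W_variation[OF xs(1,2)]] t xs by simp
  \<comment> \<open>\<open>?A + ?B / 2\<close> is the speed times the derivative of the speed across
    the family, and precisely what the metric terms leave over in the derivative of the
    deviation.\<close>
  then have eq: "?E / Wv ?p * \<omega> = ?E / Wv ?p * (Wx ?p \<bullet> \<zeta> t) + (?A + ?B / 2)"
    using E Wv by (simp add: field_simps)
  have "\<zeta> t \<bullet> (gx (x t) *v acc (x t, v t) + dg (x t) (v t) *v v t) + ?A
      = ?E / Wv ?p * \<omega> + \<kappa> (x t, v t) * (\<zeta> t \<bullet> (gx (x t) *v v t))"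
    unfolding eq inner_add_right inner_g_acc[OF t] inner_force[OF t] by simp
  with has_derivative_g_form[OF x \<zeta> v t(1)] show ?thesis by simp
qed

end

section \<open>Trajectories on the manifold\<close>

lemma metric_eq_inner: "metric g c p v w = v \<bullet> (g c p *v w)"
  by (simp add: metric_def inner_matrix_vector_expand)

lemma lower_eq: "lower g c p v = g c p *v v"
  by (simp add: lower_def matrix_vector_mult_def)

locale manifold_field =
  fixes A :: "('a::{t2_space,second_countable_topology}, 'n::finite) chart set"
    and g :: "('a, 'n) metric_tensor"
    and W :: "'a \<Rightarrow> real \<Rightarrow> real"
    and h :: "real \<Rightarrow> real" and H :: "real set"
    and F :: "('a, 'n) chart \<Rightarrow> 'a \<Rightarrow> real^'n \<Rightarrow> real^'n"
  assumes atlas: "smooth_atlas A" and riem: "riemannian_metric A g"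
    and W_smooth: "\<And>c. c \<in> A \<Longrightarrow>
          smooth_on (coord c ` cdom c \<times> {0<..}) (\<lambda>(x, v). W (point_at c x) v)"
    and W_v: "\<And>p v. p \<in> points A \<Longrightarrow> v > 0 \<Longrightarrow> deriv (W p) v \<noteq> 0"
    and H_open: "open H" and h_smooth: "smooth_on H h"
    and h_dom: "\<And>p v. p \<in> points A \<Longrightarrow> v > 0 \<Longrightarrow> W p v \<in> H"
    and force: "\<And>c p w k. c \<in> A \<Longrightarrow> p \<in> cdom c \<Longrightarrow> w \<noteq> 0 \<Longrightarrow>
          lower g c p (F c p w) $ k =
            (let v = gnorm g c p w;
                 Nu = w /\<^sub>R v;
                 Nl = lower g c p Nu;
                 W\<^sub>v = deriv (W p) v
             in h (W p v) * Nl $ k / W\<^sub>v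
                - v * (\<Sum>i\<in>UNIV. partial c i (\<lambda>q. W q v) p / W\<^sub>v
                         * (2 * Nu $ i * Nl $ k - (if i = k then 1 else 0))))"
begin

abbreviation dom :: "('a, 'n) chart \<Rightarrow> (real^'n) set" where "dom c \<equiv> coord c ` cdom c"
abbreviation gc :: "('a, 'n) chart \<Rightarrow> real^'n \<Rightarrow> real^'n^'n" where "gc c \<equiv> (\<lambda>x. g c (point_at c x))"
abbreviation Wcc :: "('a, 'n) chart \<Rightarrow> (real^'n) \<times> real \<Rightarrow> real" where
  "Wcc c \<equiv> (\<lambda>(x, v). W (point_at c x) v)"

context
  fixes c :: "('a, 'n) chart" assumes c: "c \<in> A"
begin

lemma chart_open: "open (cdom c)" "open (dom c)"
  and chart_homeo: "homeomorphism (cdom c) (dom c) (coord c) (point_at c)"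
  using atlas c by (auto simp: smooth_atlas_def)

lemma point_at_coord [simp]: "p \<in> cdom c \<Longrightarrow> point_at c (coord c p) = p"
  using chart_homeo by (rule homeomorphism_apply1)

lemma in_points: "p \<in> cdom c \<Longrightarrow> p \<in> points A"
  using c by (auto simp: points_def)

lemma isCont_coord: "p \<in> cdom c \<Longrightarrow> isCont (coord c) p"
  using homeomorphism_cont1[OF chart_homeo] chart_open by (simp add: continuous_on_eq_continuous_at)

lemma isCont_point_at: "x \<in> dom c \<Longrightarrow> isCont (point_at c) x"
  using homeomorphism_cont2[OF chart_homeo] chart_open by (auto simp: continuous_on_eq_continuous_at)

lemma open_coord_image:
  assumes "open U" shows "open (coord c ` (cdom c \<inter> U))"
proof -
  have "openin (top_of_set (dom c)) (coord c ` (cdom c \<inter> U))"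
    by (rule homeomorphism_imp_open_map[OF chart_homeo]) (use assms in \<open>simp add: openin_open_Int\<close>)
  then show ?thesis using chart_open(2) openin_open_trans by blast
qed

lemma W_deriv_v:
  assumes p: "p \<in> cdom c" and "v > 0"
  shows "(W p has_real_derivative frechet_derivative (Wcc c) (at (coord c p, v)) (0, 1)) (at v)"
proof -
  have "(Wcc c has_derivative frechet_derivative (Wcc c) (at (coord c p, v))) (at (coord c p, v))"
    using smooth_on_has_derivative[OF W_smooth[OF c]] assms by auto
  moreover have "((\<lambda>e. (coord c p, e)) has_vector_derivative (0, 1)) (at v)"
    by (intro has_vector_derivative_Pair has_vector_derivative_const has_vector_derivative_id)
  ultimately have "((Wcc c \<circ> (\<lambda>e. (coord c p, e))) has_vector_derivative
      frechet_derivative (Wcc c) (at (coord c p, v)) (0, 1)) (at v)"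
    by (rule vector_derivative_diff_chain_within[OF _ has_derivative_at_withinI, rotated])
  then show ?thesis using p by (simp add: o_def has_real_derivative_iff_has_vector_derivative)
qed

lemma coordinate_field: "coordinate_field (dom c) (gc c) (Wcc c) h H"
proof
  show "open (dom c)" by (rule chart_open)
  show "smooth_on (dom c) (gc c)" using riem c unfolding riemannian_metric_def by blast
  show "smooth_on (dom c \<times> {0<..}) (Wcc c)" by (rule W_smooth[OF c])
  fix x assume "x \<in> dom c"
  then obtain p where p: "p \<in> cdom c" "x = coord c p" by auto
  have rm: "transpose (g c p) = g c p \<and> (\<forall>v. v \<noteq> 0 \<longrightarrow> metric g c p v v > 0)"
    using riem c p(1) unfolding riemannian_metric_def by blast
  show "transpose (gc c x) = gc c x" using rm p by simp
  show "v \<bullet> (gc c x *v v) > 0" if "v \<noteq> 0" for v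
    using rm p that by (simp add: metric_eq_inner)
  fix E :: real assume E: "E > 0"
  show "Wcc c (x, E) \<in> H" using h_dom[OF in_points[OF p(1)] E] p by simp
  show "frechet_derivative (Wcc c) (at (x, E)) (0, 1) \<noteq> 0"
    using DERIV_imp_deriv[OF W_deriv_v[OF p(1) E]] W_v[OF in_points[OF p(1)] E] p by simp
qed (fact H_open h_smooth)+

interpretation C: coordinate_field "dom c" "gc c" "Wcc c" h H by (rule coordinate_field)

lemma gnorm_eq: "p \<in> cdom c \<Longrightarrow> gnorm g c p v = C.nrm (coord c p) v"
  by (simp add: gnorm_def metric_eq_inner C.nrm_def)

lemma deriv_W: "p \<in> cdom c \<Longrightarrow> v > 0 \<Longrightarrow> deriv (W p) v = C.Wv (coord c p, v)"
  using DERIV_imp_deriv[OF W_deriv_v] by (simp add: C.Wv_def)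

lemma partial_W:
  assumes "p \<in> cdom c" "v > 0"
  shows "partial c i (\<lambda>q. W q v) p = C.Wx (coord c p, v) $ i"
proof -
  have "((Wcc c \<circ> (\<lambda>x. (x, v))) has_derivative
      (\<lambda>q. C.Wx (coord c p, v) \<bullet> fst q + C.Wv (coord c p, v) * snd q) \<circ> (\<lambda>u. (u, 0))) (at (coord c p))"
    by (intro diff_chain_at C.Wc_deriv has_derivative_Pair has_derivative_ident has_derivative_const)
      (use assms in auto)
  then have "((\<lambda>x. W (point_at c x) v) has_derivative (\<lambda>u. C.Wx (coord c p, v) \<bullet> u)) (at (coord c p))"
    by (simp add: o_def)
  from frechet_derivative_at[OF this, symmetric] show ?thesis
    by (simp add: partial_def inner_axis)
qed

lemma lower_force:
  assumes p: "p \<in> cdom c" and w: "w \<noteq> 0"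
  shows "g c p *v F c p w = C.force (coord c p, w)"
proof -
  define v where "v = gnorm g c p w"
  have v: "v = C.nrm (coord c p) w" "v > 0"
    using p w C.nrm_pos[of "coord c p" w] by (simp_all add: v_def gnorm_eq)
  have Wv: "C.Wv (coord c p, v) \<noteq> 0" using C.Wv_nonzero p v by blast
  have "(g c p *v F c p w) $ k = C.force (coord c p, w) $ k" for k
  proof -
    let ?gw = "(g c p *v w) $ k" and ?Wx = "C.Wx (coord c p, v)" and ?Wv = "C.Wv (coord c p, v)"
    \<comment> \<open>The Kronecker delta is split off: it selects the single term
      \<open>i = k\<close>, while the rest sums up to the contraction
      \<open>?Wx \<bullet> w\<close>.\<close>
    have "(\<Sum>i\<in>UNIV. partial c i (\<lambda>q. W q v) p / ?Wv
             * (2 * (w /\<^sub>R v) $ i * (g c p *v (w /\<^sub>R v)) $ k - (if i = k then 1 else 0)))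
        = (\<Sum>i\<in>UNIV. (2 * ?gw / (v * v * ?Wv)) * (?Wx $ i * w $ i) - (if i = k then ?Wx $ i / ?Wv else 0))"
      by (intro sum.cong refl)
        (simp add: partial_W[OF p v(2)] matrix_vector_mult_scaleR divide_inverse algebra_simps)
    also have "\<dots> = (2 * ?gw / (v * v * ?Wv)) * (?Wx \<bullet> w) - ?Wx $ k / ?Wv"
      unfolding sum_subtractf sum_distrib_left[symmetric] by (simp add: inner_vec_def)
    finally have S: "(\<Sum>i\<in>UNIV. partial c i (\<lambda>q. W q v) p / ?Wv
             * (2 * (w /\<^sub>R v) $ i * (g c p *v (w /\<^sub>R v)) $ k - (if i = k then 1 else 0)))
        = (2 * ?gw / (v * v * ?Wv)) * (?Wx \<bullet> w) - ?Wx $ k / ?Wv" .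
    have "(g c p *v F c p w) $ k = h (W p v) * (g c p *v (w /\<^sub>R v)) $ k / ?Wv
        - v * ((2 * ?gw / (v * v * ?Wv)) * (?Wx \<bullet> w) - ?Wx $ k / ?Wv)"
      using force[OF c p w, of k]
      unfolding lower_eq Let_def v_def[symmetric] deriv_W[OF p v(2)] S .
    also have "\<dots> = C.force (coord c p, w) $ k"
      using p v(2) Wv by (simp add: C.force_def Let_def v(1)[symmetric] matrix_vector_mult_scaleR field_simps)
    finally show ?thesis .
  qed
  then show ?thesis by (simp add: vec_eq_iff)
qed

text \<open>Lowering the upper index cancels the inverse metric in \<open>christoffel\<close>, so
  only first derivatives of the metric remain.\<close>

lemma lower_christoffel:
  assumes p: "p \<in> cdom c"
  shows "(g c p *v (\<chi> k. \<Sum>i\<in>UNIV. \<Sum>j\<in>UNIV. christoffel g c p k i j * w $ i * w $ j)) = C.gam (coord c p, w)"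
proof -
  have inv: "g c p ** matrix_inv (g c p) = mat 1"
    using C.det_gx[of "coord c p"] p someI_ex[of "\<lambda>B. g c p ** B = mat 1 \<and> B ** g c p = mat 1"]
    by (simp add: invertible_det_nz[symmetric] invertible_def matrix_inv_def)
  have part: "partial c i (\<lambda>q. g c q $ a $ b) p = C.dg (coord c p) (axis i 1) $ a $ b" for i a b
  proof -
    have "(gc c has_derivative C.dg (coord c p)) (at (coord c p))" using p by (intro C.gx_deriv) simp
    from bounded_linear.has_derivative[OF bounded_linear_vec_nth this]
    have "((\<lambda>x. gc c x $ a) has_derivative (\<lambda>u. C.dg (coord c p) u $ a)) (at (coord c p))" .
    from bounded_linear.has_derivative[OF bounded_linear_vec_nth this]
    have "((\<lambda>x. gc c x $ a $ b) has_derivative (\<lambda>u. C.dg (coord c p) u $ a $ b)) (at (coord c p))" .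
    from frechet_derivative_at[OF this, symmetric] show ?thesis by (simp add: partial_def)
  qed
  define T where "T s i j = C.dg (coord c p) (axis i 1) $ s $ j + C.dg (coord c p) (axis j 1) $ i $ s
      - C.dg (coord c p) (axis s 1) $ i $ j" for s i j
  have ch: "christoffel g c p k i j = 1/2 * (matrix_inv (g c p) *v (\<chi> s. T s i j)) $ k" for k i j
    by (simp add: christoffel_def part T_def matrix_vector_mult_def)
  have "(\<chi> k. \<Sum>i\<in>UNIV. \<Sum>j\<in>UNIV. christoffel g c p k i j * w $ i * w $ j)
      = (\<Sum>i\<in>UNIV. \<Sum>j\<in>UNIV. (1/2 * w $ i * w $ j) *\<^sub>R (matrix_inv (g c p) *v (\<chi> s. T s i j)))"
    by (simp add: vec_eq_iff ch mult_ac)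
  also have "g c p *v \<dots> = (\<Sum>i\<in>UNIV. \<Sum>j\<in>UNIV. (1/2 * w $ i * w $ j) *\<^sub>R (\<chi> s. T s i j))"
    by (simp add: linear_sum[OF matrix_vector_mul_linear] matrix_vector_mult_scaleR
        matrix_vector_mul_assoc inv)
  also have "\<dots> = C.gam (coord c p, w)"
    by (simp add: C.gam_def vec_eq_iff T_def mult_ac)
  finally show ?thesis .
qed

text \<open>The equation is given with raised indices. Lowered, it compares \<open>force\<close> and
  \<open>gam\<close>, and solving it for the acceleration again yields the explicit right-hand side
  \<open>acc\<close>, whose Lipschitz property is known.\<close>

lemma trajectory_chart:
  assumes r: "newtonian_trajectory A g F I r" and t: "t \<in> I" "r t \<in> cdom c"
  shows "((\<lambda>s. coord c (r s)) has_vector_derivative velocity c r t) (at t)"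
    "(velocity c r has_vector_derivative C.acc (coord c (r t), velocity c r t)) (at t)"
    "velocity c r t \<noteq> 0"
proof -
  let ?v = "velocity c r t"
  obtain a where a: "(velocity c r has_vector_derivative a) (at t)"
    "\<And>k. a $ k + (\<Sum>i\<in>UNIV. \<Sum>j\<in>UNIV. christoffel g c (r t) k i j * ?v $ i * ?v $ j) = F c (r t) ?v $ k"
    using r t c unfolding newtonian_trajectory_def by blast
  show "((\<lambda>s. coord c (r s)) has_vector_derivative ?v) (at t)" and v: "?v \<noteq> 0"
    using r t c unfolding newtonian_trajectory_def by blast+
  have "F c (r t) ?v = a + (\<chi> k. \<Sum>i\<in>UNIV. \<Sum>j\<in>UNIV. christoffel g c (r t) k i j * ?v $ i * ?v $ j)"
    by (simp add: vec_eq_iff a(2))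
  then have "C.force (coord c (r t), ?v) = g c (r t) *v a + C.gam (coord c (r t), ?v)"
    using lower_force[OF t(2) v] lower_christoffel[OF t(2), of ?v] by (simp add: matrix_vector_right_distrib)
  then have "a = C.acc (coord c (r t), ?v)"
    using C.acc_iff[of "coord c (r t)" a ?v] t by simp
  with a(1) show "(velocity c r has_vector_derivative C.acc (coord c (r t), ?v)) (at t)" by simp
qed

definition phase :: "(real \<Rightarrow> 'a) \<Rightarrow> real \<Rightarrow> (real^'n) \<times> (real^'n)" where
  "phase r t = (coord c (r t), velocity c r t)"

lemma phase_deriv:
  assumes "newtonian_trajectory A g F I r" "t \<in> I" "r t \<in> cdom c"
  shows "(phase r has_vector_derivative C.phase_field (phase r t)) (at t)"
  unfolding phase_def[abs_def] C.phase_field_def snd_conv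
  by (intro has_vector_derivative_Pair trajectory_chart[OF assms])

end

lemma trajectory_isCont:
  "newtonian_trajectory A g F I r \<Longrightarrow> open I \<Longrightarrow> t \<in> I \<Longrightarrow> isCont r t"
  unfolding newtonian_trajectory_def by (simp add: continuous_on_eq_continuous_at)

lemma trajectory_in_chart:
  assumes "newtonian_trajectory A g F I r" "open I" "t \<in> I" "open U" "r t \<in> U"
  shows "\<forall>\<^sub>F s in nhds t. s \<in> I \<and> r s \<in> U"
proof -
  have "filterlim r (nhds (r t)) (nhds t)"
    using trajectory_isCont[OF assms(1-3)] by (metis continuous_at tendsto_at_iff_tendsto_nhds)
  from eventually_compose_filterlim[OF eventually_nhds_in_open[OF assms(4,5)] this]
    eventually_nhds_in_open[OF assms(2,3)]
  show ?thesis by eventually_elim simp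
qed

text \<open>The sign \<open>\<sigma>\<close> covers the motion forwards and backwards in time.\<close>

lemma trajectory_dependence:
  assumes c: "c \<in> A" and I: "open I" and r0: "newtonian_trajectory A g F I r0"
    and \<sigma>: "\<sigma> = 1 \<or> \<sigma> = - 1" and T: "T \<ge> 0"
    and dom: "\<And>\<tau>. 0 \<le> \<tau> \<Longrightarrow> \<tau> \<le> T \<Longrightarrow> t0 + \<sigma> * \<tau> \<in> I \<and> r0 (t0 + \<sigma> * \<tau>) \<in> cdom c"
  obtains \<rho> M where "\<rho> > 0" "M \<ge> 0"
    "\<And>r \<tau>. newtonian_trajectory A g F I r \<Longrightarrow> r t0 \<in> cdom c \<Longrightarrow>
      norm (phase c r t0 - phase c r0 t0) \<le> \<rho> \<Longrightarrow> 0 \<le> \<tau> \<Longrightarrow> \<tau> \<le> T \<Longrightarrow>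
      r (t0 + \<sigma> * \<tau>) \<in> cdom c \<and>
      norm (phase c r (t0 + \<sigma> * \<tau>) - phase c r0 (t0 + \<sigma> * \<tau>)) \<le> M * norm (phase c r t0 - phase c r0 t0) \<and>
      norm (coordinate_field.phase_field (gc c) (Wcc c) h (phase c r (t0 + \<sigma> * \<tau>))
          - coordinate_field.phase_field (gc c) (Wcc c) h (phase c r0 (t0 + \<sigma> * \<tau>)))
        \<le> M * norm (phase c r t0 - phase c r0 t0)"
proof -
  interpret C: coordinate_field "dom c" "gc c" "Wcc c" h H by (rule coordinate_field[OF c])
  have aff: "((\<lambda>\<tau>. t0 + \<sigma> * \<tau>) has_vector_derivative \<sigma>) (at \<tau>)" for \<tau>
    by (rule derivative_eq_intros refl | simp)+
  have rev: "((\<lambda>\<tau>. phase c r (t0 + \<sigma> * \<tau>)) has_vector_derivative \<sigma> *\<^sub>R C.phase_field (phase c r (t0 + \<sigma> * \<tau>))) (at \<tau>)"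
    if "newtonian_trajectory A g F I r" "t0 + \<sigma> * \<tau> \<in> I" "r (t0 + \<sigma> * \<tau>) \<in> cdom c" for r \<tau>
    using vector_diff_chain_at[OF aff phase_deriv[OF c that]] by (simp add: o_def)
  define X where "X = (\<lambda>\<tau>. coord c (r0 (t0 + \<sigma> * \<tau>))) ` {0..T}"
  have cont: "isCont (\<lambda>\<tau>. r (t0 + \<sigma> * \<tau>)) \<tau>"
    if "newtonian_trajectory A g F I r" "t0 + \<sigma> * \<tau> \<in> I" for r \<tau>
    by (rule isCont_o2[where g = r and f = "\<lambda>\<tau>. t0 + \<sigma> * \<tau>", OF _ trajectory_isCont[OF that(1) I that(2)]]) (intro continuous_intros)
  have "compact X" unfolding X_def
    by (intro compact_continuous_image compact_Icc continuous_at_imp_continuous_on ballI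
        isCont_o2[OF cont[OF r0] isCont_coord[OF c]]) (use dom in auto)
  moreover have "X \<subseteq> dom c" "X \<noteq> {}" using dom T by (auto simp: X_def)
  ultimately obtain \<epsilon>0 where e0: "\<epsilon>0 > 0" "{x. infdist x X \<le> \<epsilon>0} \<subseteq> dom c"
    using compact_in_open_separated[of X "dom c"] chart_open[OF c] by metis
  \<comment> \<open>A closed tube around the reference orbit, still inside the chart. As a compact
    set in a Hausdorff space it is closed in the manifold, so a trajectory that lies in
    \<open>K\<close> at all earlier times cannot have left the chart at the limit time.\<close>
  define K where "K = point_at c ` {x. infdist x X \<le> \<epsilon>0}"
  have "compact K" unfolding K_def
    using compact_infdist_le[OF \<open>X \<noteq> {}\<close> \<open>compact X\<close> e0(1)] e0(2) isCont_point_at[OF c]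
    by (intro compact_continuous_image continuous_at_imp_continuous_on) auto
  then have K: "closed K" "K \<subseteq> cdom c"
    using e0(2) chart_homeo[OF c] by (auto simp: compact_imp_closed K_def homeomorphism_def)
  have l\<sigma>: "loclip_at (\<lambda>z. \<sigma> *\<^sub>R C.phase_field z) (phase c r0 (t0 + \<sigma> * \<tau>))" if "0 \<le> \<tau>" "\<tau> \<le> T" for \<tau>
    unfolding phase_def[OF c] using dom[OF that] trajectory_chart(3)[OF c r0]
    by (intro loclip_at_scaleR loclip_at_const C.loclip_phase_field) auto
  show ?thesis
  proof (rule continuous_dependence[of T \<epsilon>0 "\<lambda>\<tau>. phase c r0 (t0 + \<sigma> * \<tau>)" "\<lambda>z. \<sigma> *\<^sub>R C.phase_field z"])
    fix \<rho> M :: real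
    assume \<rho>: "\<rho> > 0" "M \<ge> 0"
    assume dep: "\<And>D z1 t. norm (z1 0 - phase c r0 (t0 + \<sigma> * 0)) \<le> \<rho> \<Longrightarrow> 0 \<in> D \<Longrightarrow>
       (\<And>t. 0 \<le> t \<Longrightarrow> t \<le> T \<Longrightarrow> t \<in> D \<Longrightarrow> (z1 has_vector_derivative \<sigma> *\<^sub>R C.phase_field (z1 t)) (at t)) \<Longrightarrow>
       (\<And>t. 0 \<le> t \<Longrightarrow> t \<le> T \<Longrightarrow> t \<in> D \<Longrightarrow> \<forall>\<^sub>F t' in nhds t. t' \<in> D) \<Longrightarrow>
       (\<And>t. 0 < t \<Longrightarrow> t \<le> T \<Longrightarrow>
          (\<And>t'. 0 \<le> t' \<Longrightarrow> t' < t \<Longrightarrow> t' \<in> D \<and> norm (z1 t' - phase c r0 (t0 + \<sigma> * t')) \<le> \<epsilon>0) \<Longrightarrow> t \<in> D) \<Longrightarrow>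
       0 \<le> t \<Longrightarrow> t \<le> T \<Longrightarrow>
       t \<in> D \<and> norm (z1 t - phase c r0 (t0 + \<sigma> * t)) \<le> M * norm (z1 0 - phase c r0 (t0 + \<sigma> * 0))
       \<and> norm (\<sigma> *\<^sub>R C.phase_field (z1 t) - \<sigma> *\<^sub>R C.phase_field (phase c r0 (t0 + \<sigma> * t)))
          \<le> M * norm (z1 0 - phase c r0 (t0 + \<sigma> * 0))"
    show ?thesis
    proof (rule that[OF \<rho>])
      fix r \<tau>
      assume r: "newtonian_trajectory A g F I r" "r t0 \<in> cdom c"
        "norm (phase c r t0 - phase c r0 t0) \<le> \<rho>" and \<tau>: "0 \<le> \<tau>" "\<tau> \<le> T"
      define D where "D = {\<tau>. t0 + \<sigma> * \<tau> \<in> I \<and> r (t0 + \<sigma> * \<tau>) \<in> cdom c}"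
      have "\<tau> \<in> D \<and> norm (phase c r (t0 + \<sigma> * \<tau>) - phase c r0 (t0 + \<sigma> * \<tau>)) \<le> M * norm (phase c r (t0 + \<sigma> * 0) - phase c r0 (t0 + \<sigma> * 0))
       \<and> norm (\<sigma> *\<^sub>R C.phase_field (phase c r (t0 + \<sigma> * \<tau>)) - \<sigma> *\<^sub>R C.phase_field (phase c r0 (t0 + \<sigma> * \<tau>)))
          \<le> M * norm (phase c r (t0 + \<sigma> * 0) - phase c r0 (t0 + \<sigma> * 0))"
      proof (rule dep[OF _ _ _ _ _ \<tau>])
        show "norm (phase c r (t0 + \<sigma> * 0) - phase c r0 (t0 + \<sigma> * 0)) \<le> \<rho>" using r by simp
        show "0 \<in> D" using dom[of 0] T r by (simp add: D_def)
        fix t assume t: "t \<in> D"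
        then show "((\<lambda>\<tau>. phase c r (t0 + \<sigma> * \<tau>)) has_vector_derivative \<sigma> *\<^sub>R C.phase_field (phase c r (t0 + \<sigma> * t))) (at t)"
          unfolding D_def using rev[OF r(1)] by simp
        have "filterlim (\<lambda>\<tau>. t0 + \<sigma> * \<tau>) (nhds (t0 + \<sigma> * t)) (nhds t)"
          by (intro tendsto_intros filterlim_ident)
        from eventually_compose_filterlim[OF trajectory_in_chart[OF r(1) I _ chart_open(1)[OF c]] this] t
        show "\<forall>\<^sub>F t' in nhds t. t' \<in> D" by (simp add: D_def)
      next
        fix t assume t: "0 < t" "t \<le> T"
          and before: "\<And>t'. 0 \<le> t' \<Longrightarrow> t' < t \<Longrightarrow>
            t' \<in> D \<and> norm (phase c r (t0 + \<sigma> * t') - phase c r0 (t0 + \<sigma> * t')) \<le> \<epsilon>0"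
        have "r (t0 + \<sigma> * t') \<in> K" if t': "0 \<le> t'" "t' < t" for t'
        proof -
          have *: "r (t0 + \<sigma> * t') \<in> cdom c" using before[OF t'] by (simp add: D_def)
          have "infdist (coord c (r (t0 + \<sigma> * t'))) X \<le> dist (coord c (r (t0 + \<sigma> * t'))) (coord c (r0 (t0 + \<sigma> * t')))"
            by (rule infdist_le) (use t' t in \<open>auto simp: X_def\<close>)
          also have "\<dots> \<le> norm (phase c r (t0 + \<sigma> * t') - phase c r0 (t0 + \<sigma> * t'))"
            unfolding phase_def[OF c] dist_norm diff_Pair by (rule norm_fst_le)
          also have "\<dots> \<le> \<epsilon>0" using before[OF t'] by simp
          finally show ?thesis unfolding K_def
            using * by (intro image_eqI[of _ _ "coord c (r (t0 + \<sigma> * t'))"]) (simp_all add: c)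
        qed
        then have "\<forall>\<^sub>F t' in at_left t. r (t0 + \<sigma> * t') \<in> K"
          using t(1) by (auto simp: eventually_at_left_field intro!: exI[of _ 0])
        moreover have "((\<lambda>\<tau>. r (t0 + \<sigma> * \<tau>)) \<longlongrightarrow> r (t0 + \<sigma> * t)) (at_left t)"
        proof -
          have "isCont (\<lambda>\<tau>. r (t0 + \<sigma> * \<tau>)) t" using cont[OF r(1)] dom[of t] t by simp
          from continuous_at_imp_continuous_within[OF this, of "{..<t}"] show ?thesis
            by (simp add: continuous_within)
        qed
        ultimately have "r (t0 + \<sigma> * t) \<in> K"
          by (intro Lim_in_closed_set[OF K(1)]) auto
        then show "t \<in> D" using K dom[of t] t by (auto simp: D_def)
      qed
      \<comment> \<open>Reversing time changes only the sign of the field, so the bounds carry over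
        to \<open>phase_field\<close> itself.\<close>
      moreover have "norm (\<sigma> *\<^sub>R a - \<sigma> *\<^sub>R b) = norm (a - b)" for a b :: "(real^'n) \<times> (real^'n)"
        using \<sigma> by (auto simp: norm_minus_commute)
      ultimately show "r (t0 + \<sigma> * \<tau>) \<in> cdom c \<and>
        norm (phase c r (t0 + \<sigma> * \<tau>) - phase c r0 (t0 + \<sigma> * \<tau>)) \<le> M * norm (phase c r t0 - phase c r0 t0) \<and>
        norm (C.phase_field (phase c r (t0 + \<sigma> * \<tau>)) - C.phase_field (phase c r0 (t0 + \<sigma> * \<tau>)))
        \<le> M * norm (phase c r t0 - phase c r0 t0)"
        by (simp add: D_def)
    qed
  qed (use T e0 dom rev[OF r0] l\<sigma> in auto)
qed

section \<open>Change of charts\<close>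

definition transition_deriv :: "('a, 'n) chart \<Rightarrow> ('a, 'n) chart \<Rightarrow> 'a \<Rightarrow> real^'n \<Rightarrow> real^'n" where
  "transition_deriv c c' p = frechet_derivative (coord c' \<circ> point_at c) (at (coord c p))"

context
  fixes c c' :: "('a, 'n) chart" assumes c: "c \<in> A" and c': "c' \<in> A"
begin

lemma transition_smooth: "smooth_on (coord c ` (cdom c \<inter> cdom c')) (coord c' \<circ> point_at c)"
  using atlas c c' unfolding smooth_atlas_def by blast

lemma transition_has_derivative:
  assumes "p \<in> cdom c \<inter> cdom c'"
  shows "((coord c' \<circ> point_at c) has_derivative transition_deriv c c' p) (at (coord c p))"
  unfolding transition_deriv_def using assms
  by (intro smooth_on_has_derivative[OF transition_smooth]) auto

lemma transition_curve:
  assumes v: "((\<lambda>s. coord c (r s)) has_vector_derivative v) (at t)"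
    and r: "\<forall>\<^sub>F s in nhds t. r s \<in> cdom c \<inter> cdom c'"
  shows "((\<lambda>s. coord c' (r s)) has_vector_derivative transition_deriv c c' (r t) v) (at t)"
proof -
  have rt: "r t \<in> cdom c \<inter> cdom c'" using eventually_nhds_x_imp_x[OF r] .
  have *: "(((coord c' \<circ> point_at c) \<circ> (\<lambda>s. coord c (r s))) has_vector_derivative transition_deriv c c' (r t) v) (at t)"
    by (rule vector_derivative_diff_chain_within[OF v has_derivative_at_withinI[OF transition_has_derivative[OF rt]]])
  show ?thesis
    by (rule has_vector_derivative_eventually[OF *])
      (rule eventually_mono[OF r], use c in simp)
qed

lemma transition_velocity:
  assumes r: "newtonian_trajectory A g F I r" and I: "open I" "t \<in> I" and rt: "r t \<in> cdom c \<inter> cdom c'"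
  shows "velocity c' r t = transition_deriv c c' (r t) (velocity c r t)"
proof -
  have "\<forall>\<^sub>F s in nhds t. r s \<in> cdom c \<inter> cdom c'"
    using trajectory_in_chart[OF r I open_Int[OF chart_open(1)[OF c] chart_open(1)[OF c']] rt]
    by eventually_elim blast
  from transition_curve[OF _ this, of "velocity c r t"] trajectory_chart(1)[OF c r I(2)] rt
  show ?thesis unfolding velocity_def[of c'] by (simp add: vector_derivative_at)
qed

text \<open>The transformation law of the metric makes the derivative of a coordinate change an
  isometry. Speed, \<open>W\<close> along a trajectory and \<psi> therefore do not depend on the
  chart.\<close>

lemma transition_metric:
  assumes "p \<in> cdom c \<inter> cdom c'"
  shows "transition_deriv c c' p u \<bullet> (g c' p *v transition_deriv c c' p w) = u \<bullet> (g c p *v w)"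
proof -
  have lin: "linear (transition_deriv c c' p)"
    using transition_has_derivative[OF assms] has_derivative_linear by blast
  have J: "jacobian c c' p *v x = transition_deriv c c' p x" for x
    unfolding jacobian_def transition_deriv_def[symmetric] using lin by (metis matrix_vector_mul(2))
  have "g c p = transpose (jacobian c c' p) ** g c' p ** jacobian c c' p"
    using riem c c' assms unfolding riemannian_metric_def by blast
  then have "u \<bullet> (g c p *v w) = u \<bullet> (transpose (jacobian c c' p) *v (g c' p *v (jacobian c c' p *v w)))"
    by (simp add: matrix_vector_mul_assoc matrix_mul_assoc)
  also have "\<dots> = (jacobian c c' p *v u) \<bullet> (g c' p *v (jacobian c c' p *v w))"
    by (metis dot_lmul_matrix vector_transpose_matrix)
  finally show ?thesis by (simp add: J)
qed

lemma transition_gnorm: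
  assumes "p \<in> cdom c \<inter> cdom c'"
  shows "gnorm g c' p (transition_deriv c c' p u) = gnorm g c p u"
  by (simp add: gnorm_def metric_eq_inner transition_metric[OF assms])

text \<open>This map takes the phase of a trajectory in \<open>c\<close> to its phase in
  \<open>c'\<close>. Smoothness of the transition map controls its derivative in fixed directions
  only, so the derivative is expanded in the vectors \<open>axis i 1\<close> before the closure
  rules for sums and products apply.\<close>

lemma transition_phase_loclip:
  assumes "p \<in> cdom c \<inter> cdom c'"
  shows "loclip_at (\<lambda>z. ((coord c' \<circ> point_at c) (fst z),
     frechet_derivative (coord c' \<circ> point_at c) (at (fst z)) (snd z))) (coord c p, v)"
proof (rule loclip_at_Pair)
  let ?\<phi> = "coord c' \<circ> point_at c" and ?U = "coord c ` (cdom c \<inter> cdom c')"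
  have U: "open ?U" "coord c p \<in> ?U"
    using open_coord_image[OF c chart_open(1)[OF c']] assms by auto
  show "loclip_at (\<lambda>z. ?\<phi> (fst z)) (coord c p, v)"
    by (rule loclip_at_compose[OF _ loclip_at_fst]) (use smooth_on_loclip_at[OF transition_smooth U] in \<open>simp only: fst_conv\<close>)
  have *: "loclip_at (\<lambda>z. \<Sum>i\<in>UNIV. (snd z $ i) *\<^sub>R frechet_derivative ?\<phi> (at (fst z)) (axis i 1)) (coord c p, v)"
  proof (intro loclip_at_sum loclip_at_scaleR loclip_at_vec_nth loclip_at_snd)
    fix i
    show "loclip_at (\<lambda>z. frechet_derivative ?\<phi> (at (fst z)) (axis i 1)) (coord c p, v)"
      by (rule loclip_at_compose[OF _ loclip_at_fst])
        (use smooth_on_loclip_at[OF smooth_on_frechet_derivative[OF transition_smooth] U] in \<open>simp only: fst_conv\<close>)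
  qed
  have "filterlim fst (nhds (coord c p)) (nhds (coord c p, v))"
    using tendsto_fst[OF filterlim_ident[of "nhds (coord c p, v)"]] by simp
  from eventually_compose_filterlim[OF eventually_nhds_in_open[OF U] this]
  have "\<forall>\<^sub>F z in nhds (coord c p, v). (\<Sum>i\<in>UNIV. (snd z $ i) *\<^sub>R frechet_derivative ?\<phi> (at (fst z)) (axis i 1))
     = frechet_derivative ?\<phi> (at (fst z)) (snd z)"
  proof eventually_elim
    case (elim z)
    show ?case
      by (rule linear_axis_expansion[symmetric, OF has_derivative_linear[OF smooth_on_has_derivative[OF transition_smooth elim]]])
  qed
  then show "loclip_at (\<lambda>z. frechet_derivative ?\<phi> (at (fst z)) (snd z)) (coord c p, v)"
    by (rule loclip_at_cong[OF _ *])
qed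

end

section \<open>The function \<open>W\<close> along a trajectory\<close>

definition W_along :: "(real \<Rightarrow> 'a) \<Rightarrow> real \<Rightarrow> real" where
  "W_along r t = (let c = (SOME c. c \<in> A \<and> r t \<in> cdom c) in W (r t) (gnorm g c (r t) (velocity c r t)))"

text \<open>The arbitrary choice of a chart makes \<open>W_along\<close> a function on the whole
  time interval; since the speed is the same in all charts, any chart may take the place of the
  chosen one.\<close>

lemma W_along_eq:
  assumes r: "newtonian_trajectory A g F I r" and I: "open I" "t \<in> I" and c: "c \<in> A" "r t \<in> cdom c"
  shows "W_along r t = W (r t) (gnorm g c (r t) (velocity c r t))"
proof -
  define c' where "c' = (SOME c. c \<in> A \<and> r t \<in> cdom c)"
  have "c' \<in> A \<and> r t \<in> cdom c'" unfolding c'_def by (rule someI[of _ c]) (use c in simp)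
  then have c': "c' \<in> A" "r t \<in> cdom c \<inter> cdom c'" using c by auto
  have "gnorm g c' (r t) (velocity c' r t) = gnorm g c (r t) (velocity c r t)"
    unfolding transition_velocity[OF c(1) c'(1) r I c'(2)] by (rule transition_gnorm[OF c(1) c'])
  then show ?thesis by (simp add: W_along_def Let_def c'_def[symmetric])
qed

lemma chart_at:
  assumes "newtonian_trajectory A g F I r" "t \<in> I"
  obtains c where "c \<in> A" "r t \<in> cdom c"
  using assms unfolding newtonian_trajectory_def points_def by blast

lemma W_along_H:
  assumes r: "newtonian_trajectory A g F I r" and I: "open I" "t \<in> I"
  shows "W_along r t \<in> H"
proof -
  obtain c where c: "c \<in> A" "r t \<in> cdom c" by (rule chart_at[OF r I(2)])
  interpret C: coordinate_field "dom c" "gc c" "Wcc c" h H by (rule coordinate_field[OF c(1)])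
  have "gnorm g c (r t) (velocity c r t) > 0"
    using C.nrm_pos trajectory_chart(3)[OF c(1) r I(2) c(2)] c by (simp add: gnorm_eq)
  then show ?thesis
    unfolding W_along_eq[OF r I c] using in_points[OF c] by (intro h_dom)
qed

lemma W_along_deriv:
  assumes r: "newtonian_trajectory A g F I r" and I: "open I" "t \<in> I"
  shows "(W_along r has_vector_derivative h (W_along r t)) (at t)"
proof -
  obtain c where c: "c \<in> A" "r t \<in> cdom c" by (rule chart_at[OF r I(2)])
  interpret C: coordinate_field "dom c" "gc c" "Wcc c" h H by (rule coordinate_field[OF c(1)])
  have eq: "Wcc c (coord c (r s), C.nrm (coord c (r s)) (velocity c r s)) = W_along r s"
    if "s \<in> I" "r s \<in> cdom c" for s
    using W_along_eq[OF r I(1) that(1) c(1) that(2)] that c by (simp add: gnorm_eq)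
  have *: "((\<lambda>s. Wcc c (coord c (r s), C.nrm (coord c (r s)) (velocity c r s))) has_vector_derivative
     h (Wcc c (coord c (r t), C.nrm (coord c (r t)) (velocity c r t)))) (at t)"
    using trajectory_chart[OF c(1) r I(2) c(2)] c by (intro C.W_along_solution) auto
  have "(W_along r has_vector_derivative h (Wcc c (coord c (r t), C.nrm (coord c (r t)) (velocity c r t)))) (at t)"
    by (rule has_vector_derivative_eventually[OF *])
      (rule eventually_mono[OF trajectory_in_chart[OF r I chart_open(1)[OF c(1)] c(2)]], use eq in blast)
  then show ?thesis using eq[OF I(2) c(2)] by simp
qed

text \<open>The equation for \<open>W\<close> is autonomous and does not involve the position, so
  one value determines \<open>W\<close> along the motion, even for two different
  trajectories.\<close>

lemma W_along_unique:
  assumes r: "newtonian_trajectory A g F I r" "newtonian_trajectory A g F I r'"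
    and I: "open I" "connected I" and t: "t0 \<in> I" "t \<in> I" "W_along r t0 = W_along r' t0"
  shows "W_along r t = W_along r' t"
  by (rule ode_unique[where y = "W_along r" and z = "W_along r'" and h = h and H = H, OF I
      smooth_on_loclip_at[OF h_smooth H_open] W_along_deriv[OF r(1) I(1)] W_along_H[OF r(1) I(1)]
      W_along_deriv[OF r(2) I(1)] t])

end

section \<open>One-parameter families of trajectories\<close>

text \<open>Abstracts from the hypersurface to a curve of trajectories with parameter
  \<open>s\<close>. Differentiability of the positions is demanded at \<open>s = 0\<close> and for
  each time separately, in accordance with the smoothness of the individual maps
  \<open>f t\<close>.\<close>

locale shift_family = manifold_field A g W h H F
  for A :: "('a::{t2_space,second_countable_topology}, 'n::finite) chart set"
    and g W h H F +
  fixes I :: "real set" and r :: "real \<Rightarrow> real \<Rightarrow> 'a"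
  assumes I: "open I" "connected I" "0 \<in> I"
    and traj: "\<forall>\<^sub>F s in nhds 0. newtonian_trajectory A g F I (r s)"
    and position_diff: "\<And>t c. t \<in> I \<Longrightarrow> c \<in> A \<Longrightarrow> r 0 t \<in> cdom c \<Longrightarrow>
      (\<lambda>s. coord c (r s t)) differentiable (at 0)"
begin

definition \<zeta> :: "('a, 'n) chart \<Rightarrow> real \<Rightarrow> real^'n" where
  "\<zeta> c t = vector_derivative (\<lambda>s. coord c (r s t)) (at 0)"

definition \<psi> :: "('a, 'n) chart \<Rightarrow> real \<Rightarrow> real" where
  "\<psi> c t = \<zeta> c t \<bullet> (g c (r 0 t) *v velocity c (r 0) t)"

text \<open>Lipschitz dependence at a single time, with a constant that may depend on the chart and
  the time. It propagates in time and survives a change of charts before any derivative of the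
  velocities in \<open>s\<close> is known.\<close>

definition near :: "('a, 'n) chart \<Rightarrow> real \<Rightarrow> bool" where
  "near c t \<longleftrightarrow> (\<exists>C. \<forall>\<^sub>F s in nhds 0. r s t \<in> cdom c \<and> norm (phase c (r s) t - phase c (r 0) t) \<le> C * \<bar>s\<bar>)"

lemma traj0: "newtonian_trajectory A g F I (r 0)"
  using eventually_nhds_x_imp_x[OF traj] .

lemma \<zeta>_deriv:
  "t \<in> I \<Longrightarrow> c \<in> A \<Longrightarrow> r 0 t \<in> cdom c \<Longrightarrow> ((\<lambda>s. coord c (r s t)) has_vector_derivative \<zeta> c t) (at 0)"
  unfolding \<zeta>_def by (rule vector_derivative_works[THEN iffD1, OF position_diff])

lemma near_phase_lim:
  assumes "near c t" shows "((\<lambda>s. phase c (r s) t) \<longlongrightarrow> phase c (r 0) t) (nhds 0)"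
proof -
  obtain C where "\<forall>\<^sub>F s in nhds 0. r s t \<in> cdom c \<and> norm (phase c (r s) t - phase c (r 0) t) \<le> C * \<bar>s\<bar>"
    using assms near_def by blast
  then have C: "\<forall>\<^sub>F s in nhds 0. norm (phase c (r s) t - phase c (r 0) t) \<le> C * \<bar>s\<bar>" by eventually_elim simp
  have "((\<lambda>s. C * \<bar>s\<bar>) \<longlongrightarrow> C * \<bar>0\<bar>) (nhds 0)" by (intro tendsto_intros filterlim_ident)
  then have "((\<lambda>s. C * \<bar>s\<bar>) \<longlongrightarrow> 0) (nhds 0)" by simp
  from Lim_null_comparison[OF C this]
  have "((\<lambda>s. phase c (r s) t - phase c (r 0) t) \<longlongrightarrow> 0) (nhds 0)" .
  then show ?thesis by (simp add: LIM_zero_iff)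
qed

text \<open>In the coordinates of \<open>c\<close> the neighbouring points converge to
  \<open>r 0 t\<close>, which lies in the overlap. The image of the overlap is open and
  \<open>coord c\<close> is injective on its domain, so these points are eventually in the overlap
  themselves.\<close>

lemma near_both:
  assumes c: "c \<in> A" "c' \<in> A" and t: "r 0 t \<in> cdom c'" "near c t"
  shows "\<forall>\<^sub>F s in nhds 0. r s t \<in> cdom c \<inter> cdom c'"
proof -
  have n: "\<forall>\<^sub>F s in nhds 0. r s t \<in> cdom c" using t(2) unfolding near_def by (auto elim: eventually_mono)
  then have r0: "r 0 t \<in> cdom c" using eventually_nhds_x_imp_x by blast
  have "((\<lambda>s. coord c (r s t)) \<longlongrightarrow> coord c (r 0 t)) (nhds 0)"
    using tendsto_fst[OF near_phase_lim[OF t(2)]] by (simp add: phase_def[OF c(1)])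
  from eventually_compose_filterlim[OF eventually_nhds_in_open[OF open_coord_image[OF c(1) chart_open(1)[OF c(2)]]] this]
  have "\<forall>\<^sub>F s in nhds 0. coord c (r s t) \<in> coord c ` (cdom c \<inter> cdom c')" using r0 t by simp
  with n show ?thesis
  proof eventually_elim
    case (elim s)
    then obtain q where "q \<in> cdom c \<inter> cdom c'" "coord c (r s t) = coord c q" by blast
    then have "r s t = q" using point_at_coord[OF c(1), of q] point_at_coord[OF c(1) elim(1)] by simp
    with \<open>q \<in> cdom c \<inter> cdom c'\<close> show ?case by simp
  qed
qed

text \<open>Phases in the two charts correspond under a locally Lipschitz map, which costs only a
  factor \<open>L\<close>.\<close>

lemma near_transfer:
  assumes c: "c \<in> A" "c' \<in> A" and t: "t \<in> I" "r 0 t \<in> cdom c'" "near c t"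
  shows "near c' t"
proof -
  define \<Phi> where "\<Phi> z = ((coord c' \<circ> point_at c) (fst z),
     frechet_derivative (coord c' \<circ> point_at c) (at (fst z)) (snd z))" for z :: "(real^'n) \<times> (real^'n)"
  note both = near_both[OF c t(2,3)]
  have r0: "r 0 t \<in> cdom c \<inter> cdom c'" using eventually_nhds_x_imp_x[OF both] .
  obtain C where C: "\<forall>\<^sub>F s in nhds 0. r s t \<in> cdom c \<and> norm (phase c (r s) t - phase c (r 0) t) \<le> C * \<bar>s\<bar>"
    using t(3) near_def by blast
  have "loclip_at \<Phi> (phase c (r 0) t)"
    unfolding \<Phi>_def[abs_def] phase_def[OF c(1)] by (rule transition_phase_loclip[OF c r0])
  then obtain L where L: "L \<ge> 0" "\<forall>\<^sub>F z in nhds (phase c (r 0) t). norm (\<Phi> z - \<Phi> (phase c (r 0) t)) \<le> L * norm (z - phase c (r 0) t)"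
    by (rule loclip_atE_snd)
  have \<Phi>: "\<Phi> (phase c r' t) = phase c' r' t"
    if "newtonian_trajectory A g F I r'" "r' t \<in> cdom c \<inter> cdom c'" for r'
    using transition_velocity[OF c that(1) I(1) t(1) that(2)] that
    by (simp add: \<Phi>_def phase_def[OF c(1)] phase_def[OF c(2)] c transition_deriv_def)
  have "\<forall>\<^sub>F s in nhds 0. r s t \<in> cdom c' \<and> norm (phase c' (r s) t - phase c' (r 0) t) \<le> (L * C) * \<bar>s\<bar>"
    using both C traj eventually_compose_filterlim[OF L(2) near_phase_lim[OF t(3)]]
  proof eventually_elim
    case (elim s)
    then have "norm (phase c' (r s) t - phase c' (r 0) t) \<le> L * norm (phase c (r s) t - phase c (r 0) t)"
      using \<Phi>[OF elim(3)] \<Phi>[OF traj0 r0] by simp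
    also have "\<dots> \<le> L * (C * \<bar>s\<bar>)" using elim L(1) by (intro mult_left_mono) auto
    finally show ?case using elim by (simp add: mult.assoc)
  qed
  then show ?thesis unfolding near_def by blast
qed

text \<open>Both factors of the inner product transform by the same isometry.\<close>

lemma \<psi>_transfer:
  assumes c: "c \<in> A" "c' \<in> A" and t: "t \<in> I" "r 0 t \<in> cdom c'" "near c t"
  shows "\<psi> c' t = \<psi> c t"
proof -
  note both = near_both[OF c t(2,3)]
  have r0: "r 0 t \<in> cdom c \<inter> cdom c'" using eventually_nhds_x_imp_x[OF both] .
  have "\<zeta> c' t = transition_deriv c c' (r 0 t) (\<zeta> c t)"
    unfolding \<zeta>_def[of c'] using transition_curve[OF c \<zeta>_deriv[OF t(1) c(1)] both] r0
    by (simp add: vector_derivative_at)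
  then show ?thesis
    unfolding \<psi>_def transition_velocity[OF c traj0 I(1) t(1) r0] by (simp add: transition_metric[OF c r0])
qed

text \<open>Closeness at the one time \<open>t0\<close> becomes closeness on the whole interval with
  a single constant, by continuous dependence in both directions of time. The bound on
  \<open>phase_field\<close> contains the bound on the accelerations that the interpolation argument
  requires.\<close>

lemma near_uniform:
  assumes c: "c \<in> A" and a: "cball a \<delta> \<subseteq> I" "\<And>t. t \<in> cball a \<delta> \<Longrightarrow> r 0 t \<in> cdom c"
    and t0: "t0 \<in> cball a \<delta>" "near c t0"
  obtains C where "\<forall>\<^sub>F s in nhds 0. \<forall>t\<in>cball a \<delta>. r s t \<in> cdom c \<and>
     norm (phase c (r s) t - phase c (r 0) t) \<le> C * \<bar>s\<bar> \<and>
     norm (coordinate_field.phase_field (gc c) (Wcc c) h (phase c (r s) t)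
          - coordinate_field.phase_field (gc c) (Wcc c) h (phase c (r 0) t)) \<le> C * \<bar>s\<bar>"
proof -
  interpret C: coordinate_field "dom c" "gc c" "Wcc c" h H by (rule coordinate_field[OF c])
  have one: "\<exists>C. \<forall>\<^sub>F s in nhds 0. \<forall>\<tau>. 0 \<le> \<tau> \<longrightarrow> \<tau> \<le> T \<longrightarrow> (r s (t0 + \<sigma> * \<tau>) \<in> cdom c \<and>
     norm (phase c (r s) (t0 + \<sigma> * \<tau>) - phase c (r 0) (t0 + \<sigma> * \<tau>)) \<le> C * \<bar>s\<bar> \<and>
     norm (C.phase_field (phase c (r s) (t0 + \<sigma> * \<tau>)) - C.phase_field (phase c (r 0) (t0 + \<sigma> * \<tau>))) \<le> C * \<bar>s\<bar>)"
    if \<sigma>: "\<sigma> = 1 \<or> \<sigma> = -1" "T \<ge> 0" "\<And>\<tau>. 0 \<le> \<tau> \<Longrightarrow> \<tau> \<le> T \<Longrightarrow> t0 + \<sigma> * \<tau> \<in> cball a \<delta>" for \<sigma> T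
  proof -
    have pre: "t0 + \<sigma> * \<tau> \<in> I \<and> r 0 (t0 + \<sigma> * \<tau>) \<in> cdom c" if "0 \<le> \<tau>" "\<tau> \<le> T" for \<tau>
      using \<sigma>(3)[OF that] a by blast
    obtain \<rho> M where \<rho>: "\<rho> > 0" "M \<ge> 0" and
      dep: "\<And>r1 \<tau>. newtonian_trajectory A g F I r1 \<Longrightarrow> r1 t0 \<in> cdom c \<Longrightarrow>
      norm (phase c r1 t0 - phase c (r 0) t0) \<le> \<rho> \<Longrightarrow> 0 \<le> \<tau> \<Longrightarrow> \<tau> \<le> T \<Longrightarrow>
      r1 (t0 + \<sigma> * \<tau>) \<in> cdom c \<and>
      norm (phase c r1 (t0 + \<sigma> * \<tau>) - phase c (r 0) (t0 + \<sigma> * \<tau>)) \<le> M * norm (phase c r1 t0 - phase c (r 0) t0) \<and>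
      norm (C.phase_field (phase c r1 (t0 + \<sigma> * \<tau>)) - C.phase_field (phase c (r 0) (t0 + \<sigma> * \<tau>)))
        \<le> M * norm (phase c r1 t0 - phase c (r 0) t0)"
      by (rule trajectory_dependence[OF c I(1) traj0 \<sigma>(1,2) pre], assumption, assumption, rule that, assumption, assumption, blast)
    obtain C0 where C0: "\<forall>\<^sub>F s in nhds 0. r s t0 \<in> cdom c \<and> norm (phase c (r s) t0 - phase c (r 0) t0) \<le> C0 * \<bar>s\<bar>"
      using t0(2) near_def by blast
    have "((\<lambda>s. phase c (r s) t0 - phase c (r 0) t0) \<longlongrightarrow> phase c (r 0) t0 - phase c (r 0) t0) (nhds 0)"
      by (intro tendsto_diff near_phase_lim[OF t0(2)] tendsto_const)
    from tendsto_norm[OF this]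
    have "((\<lambda>s. norm (phase c (r s) t0 - phase c (r 0) t0)) \<longlongrightarrow> 0) (nhds 0)" by simp
    from order_tendstoD(2)[OF this \<rho>(1)] C0 traj
    have "\<forall>\<^sub>F s in nhds 0. \<forall>\<tau>. 0 \<le> \<tau> \<longrightarrow> \<tau> \<le> T \<longrightarrow> (r s (t0 + \<sigma> * \<tau>) \<in> cdom c \<and>
     norm (phase c (r s) (t0 + \<sigma> * \<tau>) - phase c (r 0) (t0 + \<sigma> * \<tau>)) \<le> (M * C0) * \<bar>s\<bar> \<and>
     norm (C.phase_field (phase c (r s) (t0 + \<sigma> * \<tau>)) - C.phase_field (phase c (r 0) (t0 + \<sigma> * \<tau>))) \<le> (M * C0) * \<bar>s\<bar>)"
    proof eventually_elim
      case (elim s)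
      have M: "M * norm (phase c (r s) t0 - phase c (r 0) t0) \<le> M * C0 * \<bar>s\<bar>"
        using mult_left_mono[OF conjunct2[OF elim(2)] \<rho>(2)] by (simp add: mult.assoc)
      show ?case
      proof (intro allI impI)
        fix \<tau> assume \<tau>: "0 \<le> \<tau>" "\<tau> \<le> T"
        show "r s (t0 + \<sigma> * \<tau>) \<in> cdom c \<and>
     norm (phase c (r s) (t0 + \<sigma> * \<tau>) - phase c (r 0) (t0 + \<sigma> * \<tau>)) \<le> (M * C0) * \<bar>s\<bar> \<and>
     norm (C.phase_field (phase c (r s) (t0 + \<sigma> * \<tau>)) - C.phase_field (phase c (r 0) (t0 + \<sigma> * \<tau>))) \<le> (M * C0) * \<bar>s\<bar>"
          using dep[OF elim(3) _ _ \<tau>] elim M by fastforce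
      qed
    qed
    then show ?thesis by blast
  qed
  \<comment> \<open>\<open>a + \<delta> - t0\<close> is the distance from \<open>t0\<close> to the
    right end of the interval; the left end is reached likewise with reversed time.\<close>
  have "t0 + 1 * \<tau> \<in> cball a \<delta>" if "0 \<le> \<tau>" "\<tau> \<le> a + \<delta> - t0" for \<tau>
    using that t0 by (auto simp: dist_real_def)
  from one[OF disjI1[OF refl] _ this] t0(1) obtain C1 where C1:
    "\<forall>\<^sub>F s in nhds 0. \<forall>\<tau>. 0 \<le> \<tau> \<longrightarrow> \<tau> \<le> a + \<delta> - t0 \<longrightarrow> (r s (t0 + 1 * \<tau>) \<in> cdom c \<and>
     norm (phase c (r s) (t0 + 1 * \<tau>) - phase c (r 0) (t0 + 1 * \<tau>)) \<le> C1 * \<bar>s\<bar> \<and>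
     norm (C.phase_field (phase c (r s) (t0 + 1 * \<tau>)) - C.phase_field (phase c (r 0) (t0 + 1 * \<tau>))) \<le> C1 * \<bar>s\<bar>)"
    by (force simp: dist_real_def)
  have "t0 + (-1) * \<tau> \<in> cball a \<delta>" if "0 \<le> \<tau>" "\<tau> \<le> t0 - (a - \<delta>)" for \<tau>
    using that t0 by (auto simp: dist_real_def)
  from one[OF disjI2[OF refl] _ this] t0(1) obtain C2 where C2:
    "\<forall>\<^sub>F s in nhds 0. \<forall>\<tau>. 0 \<le> \<tau> \<longrightarrow> \<tau> \<le> t0 - (a - \<delta>) \<longrightarrow> (r s (t0 + (-1) * \<tau>) \<in> cdom c \<and>
     norm (phase c (r s) (t0 + (-1) * \<tau>) - phase c (r 0) (t0 + (-1) * \<tau>)) \<le> C2 * \<bar>s\<bar> \<and>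
     norm (C.phase_field (phase c (r s) (t0 + (-1) * \<tau>)) - C.phase_field (phase c (r 0) (t0 + (-1) * \<tau>))) \<le> C2 * \<bar>s\<bar>)"
    by (force simp: dist_real_def)
  have "\<forall>\<^sub>F s in nhds 0. \<forall>t\<in>cball a \<delta>. r s t \<in> cdom c \<and>
     norm (phase c (r s) t - phase c (r 0) t) \<le> max C1 C2 * \<bar>s\<bar> \<and>
     norm (C.phase_field (phase c (r s) t) - C.phase_field (phase c (r 0) t)) \<le> max C1 C2 * \<bar>s\<bar>"
    using C1 C2
  proof eventually_elim
    case (elim s)
    have m: "C1 * \<bar>s\<bar> \<le> max C1 C2 * \<bar>s\<bar>" "C2 * \<bar>s\<bar> \<le> max C1 C2 * \<bar>s\<bar>" by (auto intro: mult_right_mono)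
    show ?case
    proof
      fix t assume t: "t \<in> cball a \<delta>"
      show "r s t \<in> cdom c \<and>
         norm (phase c (r s) t - phase c (r 0) t) \<le> max C1 C2 * \<bar>s\<bar> \<and>
         norm (C.phase_field (phase c (r s) t) - C.phase_field (phase c (r 0) t)) \<le> max C1 C2 * \<bar>s\<bar>"
      proof (cases "t0 \<le> t")
        case True
        then have "r s t \<in> cdom c \<and> norm (phase c (r s) t - phase c (r 0) t) \<le> C1 * \<bar>s\<bar> \<and>
            norm (C.phase_field (phase c (r s) t) - C.phase_field (phase c (r 0) t)) \<le> C1 * \<bar>s\<bar>"
          using elim(1)[rule_format, of "t - t0"] t by (simp add: dist_real_def)
        then show ?thesis using m by linarith
      next
        case False
        then have "r s t \<in> cdom c \<and> norm (phase c (r s) t - phase c (r 0) t) \<le> C2 * \<bar>s\<bar> \<and>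
            norm (C.phase_field (phase c (r s) t) - C.phase_field (phase c (r 0) t)) \<le> C2 * \<bar>s\<bar>"
          using elim(2)[rule_format, of "t0 - t"] t by (simp add: dist_real_def)
        then show ?thesis using m by linarith
      qed
    qed
  qed
  then show ?thesis by (rule that)
qed

text \<open>The accelerations differ by at most a multiple of \<open>\<bar>s\<bar>\<close>, so
  differentiability in \<open>s\<close> passes from the positions to the velocities and yields the
  mixed derivative \<open>\<eta>\<close>. Hence differentiability of \<open>W\<close> across the
  family is part of the conclusion.\<close>

lemma \<psi>_deriv:
  assumes c: "c \<in> A" and a: "cball a \<delta> \<subseteq> I" "\<And>t. t \<in> cball a \<delta> \<Longrightarrow> r 0 t \<in> cdom c"
    and t0: "t0 \<in> cball a \<delta>" "near c t0" and t: "t \<in> ball a \<delta>"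
  obtains \<omega> where "((\<lambda>s. W_along (r s) t) has_vector_derivative \<omega>) (at 0)"
    "(\<psi> c has_vector_derivative
       coordinate_field.nrm (gc c) (coord c (r 0 t)) (velocity c (r 0) t)
        / coordinate_field.Wv (Wcc c) (coord c (r 0 t), coordinate_field.nrm (gc c) (coord c (r 0 t)) (velocity c (r 0) t)) * \<omega>
       + coordinate_field.\<kappa> (gc c) (Wcc c) h (phase c (r 0) t) * \<psi> c t) (at t)"
proof -
  interpret C: coordinate_field "dom c" "gc c" "Wcc c" h H by (rule coordinate_field[OF c])
  obtain K where K: "\<forall>\<^sub>F s in nhds 0. \<forall>t\<in>cball a \<delta>. r s t \<in> cdom c \<and>
     norm (phase c (r s) t - phase c (r 0) t) \<le> K * \<bar>s\<bar> \<and>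
     norm (C.phase_field (phase c (r s) t) - C.phase_field (phase c (r 0) t)) \<le> K * \<bar>s\<bar>"
    by (rule near_uniform[OF c a t0])
  define d where "d = \<delta> - dist a t"
  have d: "d > 0" "ball t d \<subseteq> cball a \<delta>" "ball t d \<subseteq> ball a \<delta>"
  proof -
    show "d > 0" using t by (simp add: d_def)
    show 1: "ball t d \<subseteq> ball a \<delta>"
    proof
      fix y assume "y \<in> ball t d"
      then show "y \<in> ball a \<delta>" using dist_triangle[of a y t] by (simp add: d_def)
    qed
    show "ball t d \<subseteq> cball a \<delta>" using 1 ball_subset_cball by blast
  qed
  have tI: "t \<in> I" "t \<in> cball a \<delta>" using t a by auto
  have r0: "r 0 t \<in> cdom c" using a(2) tI by blast
  define x where "x s t = coord c (r s t)" for s t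
  define v where "v s t = velocity c (r s) t" for s t
  obtain \<eta> where \<eta>: "(\<zeta> c has_vector_derivative \<eta>) (at t)" "((\<lambda>s. v s t) has_vector_derivative \<eta>) (at 0)"
  proof (rule difference_quotient_derivative[of t d x v "\<lambda>s t. C.acc (x s t, v s t)" K "\<zeta> c"])
    show "\<forall>\<^sub>F s in nhds 0. \<forall>t\<in>ball t d. (x s has_vector_derivative v s t) (at t)
      \<and> (v s has_vector_derivative C.acc (x s t, v s t)) (at t)
      \<and> norm (C.acc (x s t, v s t) - C.acc (x 0 t, v 0 t)) \<le> K * \<bar>s\<bar>"
      using K traj
    proof eventually_elim
      case (elim s)
      show ?case
      proof
        fix \<tau> assume "\<tau> \<in> ball t d"
        then have \<tau>: "\<tau> \<in> cball a \<delta>" "\<tau> \<in> I" using d a by auto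
        have *: "r s \<tau> \<in> cdom c"
          "norm (C.phase_field (phase c (r s) \<tau>) - C.phase_field (phase c (r 0) \<tau>)) \<le> K * \<bar>s\<bar>"
          using elim(1) \<tau> by auto
        have "norm (C.acc (x s \<tau>, v s \<tau>) - C.acc (x 0 \<tau>, v 0 \<tau>)) \<le> K * \<bar>s\<bar>"
          by (rule order_trans[OF _ *(2)])
            (simp add: C.phase_field_def phase_def[OF c] x_def v_def norm_snd_le)
        then show "(x s has_vector_derivative v s \<tau>) (at \<tau>)
            \<and> (v s has_vector_derivative C.acc (x s \<tau>, v s \<tau>)) (at \<tau>)
            \<and> norm (C.acc (x s \<tau>, v s \<tau>) - C.acc (x 0 \<tau>, v 0 \<tau>)) \<le> K * \<bar>s\<bar>"
          using trajectory_chart[OF c elim(2) \<tau>(2) *(1)] by (simp add: x_def[abs_def] v_def[abs_def])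
      qed
    qed
    show "((\<lambda>s. x s \<tau>) has_vector_derivative \<zeta> c \<tau>) (at 0)" if "\<tau> \<in> ball t d" for \<tau>
      unfolding x_def using that d a by (intro \<zeta>_deriv c) auto
  qed (use d in auto)
  have xd: "((\<lambda>s. x s t) has_vector_derivative \<zeta> c t) (at 0)"
    unfolding x_def by (rule \<zeta>_deriv[OF tI(1) c r0])
  have nz: "x 0 t \<in> dom c" "v 0 t \<noteq> 0"
    using trajectory_chart(3)[OF c traj0 tI(1) r0] r0 by (auto simp: x_def v_def)
  define \<omega> where "\<omega> = C.Wx (x 0 t, C.nrm (x 0 t) (v 0 t)) \<bullet> \<zeta> c t + C.Wv (x 0 t, C.nrm (x 0 t) (v 0 t)) *
       ((2 * (\<eta> \<bullet> (gc c (x 0 t) *v v 0 t)) + v 0 t \<bullet> (C.dg (x 0 t) (\<zeta> c t) *v v 0 t)) / (2 * C.nrm (x 0 t) (v 0 t)))"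
  have \<omega>: "((\<lambda>s. Wcc c (x s t, C.nrm (x s t) (v s t))) has_vector_derivative \<omega>) (at 0)"
    unfolding \<omega>_def by (rule C.W_variation[OF xd \<eta>(2) nz])
  show ?thesis
  proof (rule that)
    have "\<forall>\<^sub>F s in nhds 0. Wcc c (x s t, C.nrm (x s t) (v s t)) = W_along (r s) t"
      using K traj
    proof eventually_elim
      case (elim s)
      then have "r s t \<in> cdom c" using tI by blast
      then show ?case
        unfolding W_along_eq[OF elim(2) I(1) tI(1) c \<open>r s t \<in> cdom c\<close>]
        using c by (simp add: x_def v_def gnorm_eq)
    qed
    from has_vector_derivative_eventually[OF \<omega> this]
    show "((\<lambda>s. W_along (r s) t) has_vector_derivative \<omega>) (at 0)" .
    have *: "((\<lambda>\<tau>. \<zeta> c \<tau> \<bullet> (gc c (x 0 \<tau>) *v v 0 \<tau>)) has_vector_derivative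
       C.nrm (x 0 t) (v 0 t) / C.Wv (x 0 t, C.nrm (x 0 t) (v 0 t)) * \<omega>
       + C.\<kappa> (x 0 t, v 0 t) * (\<zeta> c t \<bullet> (gc c (x 0 t) *v v 0 t))) (at t)"
      using trajectory_chart[OF c traj0 tI(1) r0]
      by (intro C.deviation_derivative[where x = "x 0" and v = "v 0" and X = "\<lambda>s. x s t" and V = "\<lambda>s. v s t" and s = 0, OF _ _ \<eta>(1) nz xd \<eta>(2) refl refl \<omega>])
        (simp_all add: x_def[abs_def] v_def[abs_def])
    have eq: "\<zeta> c \<tau> \<bullet> (gc c (x 0 \<tau>) *v v 0 \<tau>) = \<psi> c \<tau>" if "\<tau> \<in> ball t d" for \<tau>
    proof -
      have "r 0 \<tau> \<in> cdom c" using that d a by blast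
      then show ?thesis by (simp add: \<psi>_def x_def v_def c)
    qed
    have "t \<in> ball t d" using d(1) by simp
    from has_vector_derivative_transform_within_open[OF * open_ball this eq] eq[OF this]
    show "(\<psi> c has_vector_derivative
       C.nrm (coord c (r 0 t)) (velocity c (r 0) t) / C.Wv (coord c (r 0 t), C.nrm (coord c (r 0 t)) (velocity c (r 0) t)) * \<omega>
       + C.\<kappa> (phase c (r 0) t) * \<psi> c t) (at t)"
      by (simp add: x_def v_def phase_def[OF c])
  qed
qed

text \<open>Without the inhomogeneous term the zero of \<psi> spreads by Gronwall's estimate. It has
  to travel together with \<open>near\<close>, since otherwise \<psi> could not be differentiated in
  the next chart.\<close>

lemma \<psi>_zero:
  assumes W0: "\<forall>\<^sub>F s in nhds 0. W_along (r s) 0 = W_along (r 0) 0"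
    and c0: "c0 \<in> A" "r 0 0 \<in> cdom c0" "near c0 0" "\<psi> c0 0 = 0"
    and t: "t \<in> I" and c: "c \<in> A" "r 0 t \<in> cdom c"
  shows "\<psi> c t = 0"
proof -
  \<comment> \<open>Quantifying over all charts makes \<open>Q\<close> a property of the time alone,
    so the connectedness argument may use a new chart around each time.\<close>
  define Q where "Q t \<longleftrightarrow> (\<forall>c\<in>A. r 0 t \<in> cdom c \<longrightarrow> near c t \<and> \<psi> c t = 0)" for t
  have QI: "Q t" if "t \<in> I" "c \<in> A" "near c t" "\<psi> c t = 0" for t c
    unfolding Q_def using near_transfer[OF that(2) _ that(1) _ that(3)] \<psi>_transfer[OF that(2) _ that(1) _ that(3)] that(4)
    by auto
  have W: "\<forall>\<^sub>F s in nhds 0. W_along (r s) t = W_along (r 0) t" if "t \<in> I" for t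
    using W0 traj
  proof eventually_elim
    case (elim s)
    then show ?case using W_along_unique[OF elim(2) traj0 I(1,2) I(3) that] by simp
  qed
  have "Q t"
  proof (rule connected_induction_simple[where P = Q, OF I(2) I(3) t])
    show "Q 0" using QI[OF I(3) c0(1,3,4)] .
    fix a assume a: "a \<in> I"
    obtain c where c: "c \<in> A" "r 0 a \<in> cdom c" by (rule chart_at[OF traj0 a])
    interpret C: coordinate_field "dom c" "gc c" "Wcc c" h H by (rule coordinate_field[OF c(1)])
    obtain e where e: "e > 0" "\<And>t. dist t a < e \<Longrightarrow> t \<in> I \<and> r 0 t \<in> cdom c"
      using trajectory_in_chart[OF traj0 I(1) a chart_open(1)[OF c(1)] c(2)] unfolding eventually_nhds_metric by blast
    \<comment> \<open>The halved radius lets the closed ball stay within the chart; its compactness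
      gives the bound \<open>L\<close> on \<kappa> that Gronwall's estimate needs.\<close>
    define \<delta> where "\<delta> = e / 2"
    have \<delta>: "\<delta> > 0" "cball a \<delta> \<subseteq> I" "\<And>t. t \<in> cball a \<delta> \<Longrightarrow> r 0 t \<in> cdom c"
      using e by (auto simp: \<delta>_def dist_commute)
    have "continuous_on (cball a \<delta>) (\<lambda>t. C.\<kappa> (phase c (r 0) t))"
    proof (intro continuous_at_imp_continuous_on ballI)
      fix t assume "t \<in> cball a \<delta>"
      then have t: "t \<in> I" "r 0 t \<in> cdom c" using \<delta> by auto
      have "isCont C.\<kappa> (phase c (r 0) t)"
        unfolding phase_def[OF c(1)]
        by (intro loclip_at_isCont C.loclip_\<kappa> imageI t(2) trajectory_chart(3)[OF c(1) traj0 t])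
      from isCont_o2[OF has_vector_derivative_continuous[OF phase_deriv[OF c(1) traj0 t]] this]
      show "isCont (\<lambda>t. C.\<kappa> (phase c (r 0) t)) t" .
    qed
    then have "bounded ((\<lambda>t. C.\<kappa> (phase c (r 0) t)) ` cball a \<delta>)"
      by (intro compact_imp_bounded compact_continuous_image compact_cball)
    then obtain L where L: "\<And>t. t \<in> cball a \<delta> \<Longrightarrow> \<bar>C.\<kappa> (phase c (r 0) t)\<bar> \<le> L"
      unfolding bounded_iff real_norm_def by blast
    have "Q t2" if t1: "t1 \<in> ball a \<delta>" and t2: "t2 \<in> ball a \<delta>" and Q: "Q t1" for t1 t2
    proof -
      have n1: "near c t1" "\<psi> c t1 = 0" and t1c: "t1 \<in> cball a \<delta>" and t2c: "t2 \<in> cball a \<delta>" "t2 \<in> I"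
        using Q \<delta>(2) \<delta>(3)[of t1] t1 t2 c unfolding Q_def by auto
      have D: "(\<psi> c has_vector_derivative C.\<kappa> (phase c (r 0) t) * \<psi> c t) (at t)" if t: "t \<in> ball a \<delta>" for t
      proof (rule \<psi>_deriv[OF c(1) \<delta>(2,3) t1c n1(1) t])
        fix \<omega> :: real assume \<omega>: "((\<lambda>s. W_along (r s) t) has_vector_derivative \<omega>) (at 0)"
          and D: "(\<psi> c has_vector_derivative
             C.nrm (coord c (r 0 t)) (velocity c (r 0) t)
              / C.Wv (coord c (r 0 t), C.nrm (coord c (r 0 t)) (velocity c (r 0) t)) * \<omega>
             + C.\<kappa> (phase c (r 0) t) * \<psi> c t) (at t)"
        have "t \<in> I" using t \<delta>(2) by auto
        have "((\<lambda>s. W_along (r s) t) has_vector_derivative 0) (at 0)"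
          by (rule has_vector_derivative_eventually[OF has_vector_derivative_const])
            (rule eventually_mono[OF W[OF \<open>t \<in> I\<close>]], simp)
        then have "\<omega> = 0" using \<omega> vector_derivative_unique_at by blast
        then show ?thesis using D by simp
      qed
      have "\<psi> c t2 = 0"
        by (rule gronwall_zero[OF D _ t1 t2 n1(2), of L])
          (use L in \<open>auto simp: abs_mult intro!: mult_right_mono\<close>)
      moreover have "near c t2"
      proof (rule near_uniform[OF c(1) \<delta>(2,3) t1c n1(1)])
        fix K assume K: "\<forall>\<^sub>F s in nhds 0. \<forall>t\<in>cball a \<delta>. r s t \<in> cdom c \<and>
           norm (phase c (r s) t - phase c (r 0) t) \<le> K * \<bar>s\<bar> \<and>
           norm (C.phase_field (phase c (r s) t) - C.phase_field (phase c (r 0) t)) \<le> K * \<bar>s\<bar>"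
        show ?thesis unfolding near_def
          by (intro exI[of _ K]) (rule eventually_mono[OF K], use t2c in blast)
      qed
      ultimately show ?thesis by (intro QI[OF t2c(2) c(1)])
    qed
    then show "\<exists>T. openin (top_of_set I) T \<and> a \<in> T \<and> (\<forall>x\<in>T. \<forall>y\<in>T. Q x \<longrightarrow> Q y)"
      using open_subset[of "ball a \<delta>" I] \<delta>(1,2) ball_subset_cball[of a \<delta>] centre_in_ball[of a \<delta>] open_ball
      by (metis subset_trans)
  qed
  then show ?thesis using c unfolding Q_def by blast
qed

end

section \<open>Shifts of hypersurfaces\<close>

lemma parametrizationsD:
  fixes X :: "real^'m::finite \<Rightarrow> 'a::topological_space"
  assumes "(V, X) \<in> parametrizations A S"
  shows "open V" "openin (top_of_set S) (X ` V)" "homeomorphism V (X ` V) X (inv_into V X)"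
    "X ` V \<subseteq> S" "continuous_on V X" "inj_on X V"
    "\<And>c. c \<in> A \<Longrightarrow> smooth_on {u\<in>V. X u \<in> cdom c} (\<lambda>u. coord c (X u))"
proof -
  show 1: "open V" "openin (top_of_set S) (X ` V)" "homeomorphism V (X ` V) X (inv_into V X)"
    "\<And>c. c \<in> A \<Longrightarrow> smooth_on {u\<in>V. X u \<in> cdom c} (\<lambda>u. coord c (X u))"
    using assms unfolding parametrizations_def by blast+
  show "X ` V \<subseteq> S" using 1(2) openin_imp_subset by blast
  show "continuous_on V X" using 1(3) homeomorphism_cont1 by blast
  show "inj_on X V" using 1(3) by (metis homeomorphism_apply1 inj_on_inverseI)
qed

text \<open>A curve in \<open>S\<close> is carried over by \<phi> to the parameters of
  \<open>S'\<close>. The image of a parametrization is only relatively open in \<open>S'\<close>,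
  which suffices because \<phi> maps \<open>S\<close> into \<open>S'\<close>.\<close>

lemma smooth_map_curve:
  fixes X X' :: "real^'m::finite \<Rightarrow> 'a::topological_space" and y :: "real \<Rightarrow> real^'m"
  assumes sm: "smooth_map TYPE('m) A S S' \<phi>"
    and VX: "(V, X) \<in> parametrizations A S" and y: "(y has_vector_derivative y') (at 0)" "y 0 \<in> V"
    and VX': "(V', X') \<in> parametrizations A S'" and hit: "\<phi> (X (y 0)) \<in> X' ` V'"
  obtains z e where "(z has_vector_derivative e) (at 0)" "z 0 \<in> V'" "X' (z 0) = \<phi> (X (y 0))"
    "\<forall>\<^sub>F s in nhds 0. y s \<in> V \<and> z s \<in> V' \<and> X' (z s) = \<phi> (X (y s))"
proof -
  define z where "z s = inv_into V' X' (\<phi> (X (y s)))" for s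
  note P = parametrizationsD[OF VX] and P' = parametrizationsD[OF VX']
  have "smooth_on {u\<in>V. \<phi> (X u) \<in> X' ` V'} (\<lambda>u. inv_into V' X' (\<phi> (X u)))"
    using sm VX VX' unfolding smooth_map_def by blast
  from smooth_on_has_derivative[OF this, of "y 0"] y(2) hit
  have "((\<lambda>u. inv_into V' X' (\<phi> (X u))) has_derivative
      frechet_derivative (\<lambda>u. inv_into V' X' (\<phi> (X u))) (at (y 0))) (at (y 0))" by blast
  from vector_derivative_diff_chain_within[OF y(1) has_derivative_at_withinI[OF this]]
  have z: "(z has_vector_derivative frechet_derivative (\<lambda>u. inv_into V' X' (\<phi> (X u))) (at (y 0)) y') (at 0)"
    unfolding z_def[abs_def] by (simp add: o_def)
  have z': "z s \<in> V' \<and> X' (z s) = \<phi> (X (y s))" if "\<phi> (X (y s)) \<in> X' ` V'" for s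
    using that unfolding z_def by (simp add: inv_into_into f_inv_into_f)
  have inV: "\<forall>\<^sub>F s in nhds 0. y s \<in> V"
    by (rule eventually_compose_filterlim[OF eventually_nhds_in_open[OF P(1) y(2)] has_vector_derivative_lim[OF y(1)]])
  have "continuous_on (X ` V) \<phi>"
    using sm P(4) continuous_on_subset unfolding smooth_map_def by blast
  then have "continuous_on V (\<lambda>u. \<phi> (X u))"
    using continuous_on_compose[OF P(5)] by (simp add: o_def)
  then have "isCont (\<lambda>u. \<phi> (X u)) (y 0)"
    using P(1) y(2) by (simp add: continuous_on_eq_continuous_at)
  then have "((\<lambda>u. \<phi> (X u)) \<longlongrightarrow> \<phi> (X (y 0))) (nhds (y 0))"
    by (simp add: isCont_def tendsto_at_iff_tendsto_nhds[of "\<lambda>u. \<phi> (X u)"])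
  from filterlim_compose[OF this has_vector_derivative_lim[OF y(1)]]
  have lim: "((\<lambda>s. \<phi> (X (y s))) \<longlongrightarrow> \<phi> (X (y 0))) (nhds 0)" .
  obtain U where U: "open U" "X' ` V' = S' \<inter> U" using P'(2) by (auto simp: openin_open)
  have "\<forall>\<^sub>F s in nhds 0. \<phi> (X (y s)) \<in> U"
    by (rule eventually_compose_filterlim[OF eventually_nhds_in_open[OF U(1)] lim]) (use U hit in auto)
  with inV have "\<forall>\<^sub>F s in nhds 0. y s \<in> V \<and> z s \<in> V' \<and> X' (z s) = \<phi> (X (y s))"
  proof eventually_elim
    case (elim s)
    have "\<phi> ` S \<subseteq> S'" using sm unfolding smooth_map_def by blast
    then have "\<phi> (X (y s)) \<in> X' ` V'" using elim P(4) U(2) by blast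
    then show ?case using z' elim by blast
  qed
  with z z'[OF hit] show ?thesis using that by blast
qed

lemma parametrized_curve:
  fixes X :: "real^'m::finite \<Rightarrow> 'a::topological_space" and y :: "real \<Rightarrow> real^'m"
  assumes VX: "(V, X) \<in> parametrizations A S" and y: "(y has_vector_derivative y') (at 0)" "y 0 \<in> V"
    and c: "c \<in> A" "open (cdom c)" "X (y 0) \<in> cdom c"
  shows "((\<lambda>s. coord c (X (y s))) has_vector_derivative frechet_derivative (\<lambda>u. coord c (X u)) (at (y 0)) y') (at 0)"
    "frechet_derivative (\<lambda>u. coord c (X u)) (at (y 0)) y' \<in> tangent_space TYPE('m) A c S (X (y 0))"
    "\<forall>\<^sub>F s in nhds 0. y s \<in> V \<and> X (y s) \<in> cdom c"
proof -
  note P = parametrizationsD[OF VX]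
  have "((\<lambda>u. coord c (X u)) has_derivative frechet_derivative (\<lambda>u. coord c (X u)) (at (y 0))) (at (y 0))"
    using smooth_on_has_derivative[OF P(7)[OF c(1)], of "y 0"] y(2) c(3) by blast
  from vector_derivative_diff_chain_within[OF y(1) has_derivative_at_withinI[OF this]]
  show "((\<lambda>s. coord c (X (y s))) has_vector_derivative frechet_derivative (\<lambda>u. coord c (X u)) (at (y 0)) y') (at 0)"
    by (simp add: o_def)
  show "frechet_derivative (\<lambda>u. coord c (X u)) (at (y 0)) y' \<in> tangent_space TYPE('m) A c S (X (y 0))"
    unfolding tangent_space_def using VX y(2) by blast
  have "isCont X (y 0)" using P(1,5) y(2) by (simp add: continuous_on_eq_continuous_at)
  then have "(X \<longlongrightarrow> X (y 0)) (nhds (y 0))"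
    by (simp add: continuous_at tendsto_at_iff_tendsto_nhds)
  from filterlim_compose[OF this has_vector_derivative_lim[OF y(1)]]
  have "((\<lambda>s. X (y s)) \<longlongrightarrow> X (y 0)) (nhds 0)" .
  from eventually_compose_filterlim[OF eventually_nhds_in_open[OF c(2,3)] this]
    eventually_compose_filterlim[OF eventually_nhds_in_open[OF P(1) y(2)] has_vector_derivative_lim[OF y(1)]]
  show "\<forall>\<^sub>F s in nhds 0. y s \<in> V \<and> X (y s) \<in> cdom c" by eventually_elim blast
qed

locale hypersurface_shift = manifold_field A g W h H F
  for A :: "('a::{t2_space,second_countable_topology}, 'n::finite) chart set"
    and g W h H F +
  fixes M :: "'m::finite itself" and S :: "'a set"
    and N :: "('a, 'n) chart \<Rightarrow> 'a \<Rightarrow> real^'n" and \<nu> :: "'a \<Rightarrow> real"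
    and \<epsilon> :: real and f :: "real \<Rightarrow> 'a \<Rightarrow> 'a"
  assumes S: "hypersurface TYPE('m) A S" and S_connected: "connected S"
    and normal: "unit_normal_field TYPE('m) A g S N"
    and \<nu>_smooth: "smooth_function TYPE('m) A S \<nu>" and \<nu>_pos: "\<And>p. p \<in> S \<Longrightarrow> \<nu> p > 0"
    and \<epsilon>: "\<epsilon> > 0" and shift: "newtonian_shift A g F S N \<nu> \<epsilon> f"
    and diffeo: "\<And>t. \<bar>t\<bar> < \<epsilon> \<Longrightarrow>
          hypersurface TYPE('m) A (f t ` S) \<and> hypersurface_diffeomorphism TYPE('m) A S (f t ` S) (f t)"
begin

abbreviation "I \<equiv> {- \<epsilon><..<\<epsilon>}"

lemma I: "open I" "connected I" "0 \<in> I"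
  using \<epsilon> by auto

lemma shiftD:
  assumes "p \<in> S"
  shows "newtonian_trajectory A g F I (\<lambda>t. f t p)" "f 0 p = p"
    "\<And>c. c \<in> A \<Longrightarrow> p \<in> cdom c \<Longrightarrow> velocity c (\<lambda>t. f t p) 0 = \<nu> p *\<^sub>R N c p"
  using shift assms unfolding newtonian_shift_def by blast+

lemma g_inner_sym:
  assumes "c \<in> A" "p \<in> cdom c" shows "u \<bullet> (g c p *v w) = w \<bullet> (g c p *v u)"
proof -
  interpret C: coordinate_field "dom c" "gc c" "Wcc c" h H by (rule coordinate_field[OF assms(1)])
  show ?thesis using C.gx_inner_sym[of "coord c p" u w] assms by simp
qed

text \<open>The normal has unit length, so the initial speed is exactly \<open>\<nu> p\<close>; this
  ties the condition of the theorem to the scalar equation.\<close>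

lemma W_along_start:
  assumes p: "p \<in> S"
  shows "W_along (\<lambda>t. f t p) 0 = W p (\<nu> p)"
proof -
  obtain c where c: "c \<in> A" "f 0 p \<in> cdom c" by (rule chart_at[OF shiftD(1)[OF p] I(3)])
  then have pc: "p \<in> cdom c" by (simp add: shiftD(2)[OF p])
  have "gnorm g c p (N c p) = 1"
    using normal c(1) p pc unfolding unit_normal_field_def by blast
  then have "N c p \<bullet> (g c p *v N c p) = 1"
    by (simp add: gnorm_def metric_eq_inner)
  then have "gnorm g c p (\<nu> p *\<^sub>R N c p) = \<nu> p"
    using \<nu>_pos[OF p] by (simp add: gnorm_def metric_eq_inner matrix_vector_mult_scaleR real_sqrt_mult)
  then show ?thesis
    unfolding W_along_eq[OF shiftD(1)[OF p] I(1,3) c] by (simp add: shiftD(2)[OF p] shiftD(3)[OF p c(1) pc])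
qed

section \<open>Shifting a single curve of the hypersurface\<close>

context
  fixes V :: "(real^'m) set" and X :: "real^'m \<Rightarrow> 'a" and y :: "real \<Rightarrow> real^'m" and y' :: "real^'m"
  assumes VX: "(V, X) \<in> parametrizations A S" and y: "(y has_vector_derivative y') (at 0)" "y 0 \<in> V"
begin

lemma curve_in_S: "X (y 0) \<in> S" "\<forall>\<^sub>F s in nhds 0. X (y s) \<in> S"
proof -
  note P = parametrizationsD[OF VX]
  show "X (y 0) \<in> S" using P(4) y(2) by blast
  have "\<forall>\<^sub>F s in nhds 0. y s \<in> V"
    by (rule eventually_compose_filterlim[OF eventually_nhds_in_open[OF P(1) y(2)] has_vector_derivative_lim[OF y(1)]])
  then show "\<forall>\<^sub>F s in nhds 0. X (y s) \<in> S" by eventually_elim (use P(4) in blast)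
qed

text \<open>The shifted curve is factored through a parametrization of the shifted hypersurface.
  This gives its differentiability and at the same time the tangency of its derivative.\<close>

lemma shifted_curve:
  assumes t: "t \<in> I" and c: "c \<in> A" "f t (X (y 0)) \<in> cdom c"
  obtains w where "w \<in> tangent_space TYPE('m) A c (f t ` S) (f t (X (y 0)))"
    "((\<lambda>s. coord c (f t (X (y s)))) has_vector_derivative w) (at 0)"
proof -
  have d: "hypersurface TYPE('m) A (f t ` S)" "smooth_map TYPE('m) A S (f t ` S) (f t)"
    using diffeo[of t] t unfolding hypersurface_diffeomorphism_def by auto
  have "f t (X (y 0)) \<in> f t ` S" using curve_in_S by blast
  then obtain V' X' where V': "(V', X' :: real^'m \<Rightarrow> 'a) \<in> parametrizations A (f t ` S)" "f t (X (y 0)) \<in> X' ` V'"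
    using d(1) unfolding hypersurface_def by blast
  obtain z e where z: "(z has_vector_derivative e) (at 0)" "z 0 \<in> V'" "X' (z 0) = f t (X (y 0))"
    "\<forall>\<^sub>F s in nhds 0. y s \<in> V \<and> z s \<in> V' \<and> X' (z s) = f t (X (y s))"
    by (rule smooth_map_curve[OF d(2) VX y V'])
  have z0: "X' (z 0) \<in> cdom c" using z(3) c by simp
  note pc = parametrized_curve[OF V'(1) z(1,2) c(1) chart_open(1)[OF c(1)] z0]
  show ?thesis
  proof (rule that)
    show "frechet_derivative (\<lambda>u. coord c (X' u)) (at (z 0)) e \<in> tangent_space TYPE('m) A c (f t ` S) (f t (X (y 0)))"
      using pc(2) z(3) by simp
    show "((\<lambda>s. coord c (f t (X (y s)))) has_vector_derivative frechet_derivative (\<lambda>u. coord c (X' u)) (at (z 0)) e) (at 0)"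
      by (rule has_vector_derivative_eventually[OF pc(1)]) (use z(4) in \<open>eventually_elim, simp\<close>)
  qed
qed

lemma shift_family: "shift_family A g W h H F I (\<lambda>s t. f t (X (y s)))"
proof
  show "\<forall>\<^sub>F s in nhds 0. newtonian_trajectory A g F I (\<lambda>t. f t (X (y s)))"
    using curve_in_S(2) by eventually_elim (rule shiftD(1))
  fix t c assume a: "t \<in> I" "c \<in> A" "f t (X (y 0)) \<in> cdom c"
  obtain w where "w \<in> tangent_space TYPE('m) A c (f t ` S) (f t (X (y 0)))"
    "((\<lambda>s. coord c (f t (X (y s)))) has_vector_derivative w) (at 0)"
    by (rule shifted_curve[OF a])
  then show "(\<lambda>s. coord c (f t (X (y s)))) differentiable at 0" by (simp add: differentiableI_vector)
qed (rule I)+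

interpretation SF: shift_family A g W h H F I "\<lambda>s t. f t (X (y s))" by (rule shift_family)

lemma W_along_curve: "\<forall>\<^sub>F s in nhds 0. W_along (\<lambda>t. f t (X (y s))) 0 = W (X (y s)) (\<nu> (X (y s)))"
  using curve_in_S(2) by eventually_elim (rule W_along_start)

text \<open>At time 0 the phase is explicit: the position, and \<open>\<nu>\<close> times the
  normal. Both are differentiable along the curve, hence Lipschitz at \<open>s = 0\<close>, and the
  deviation vanishes because the normal is orthogonal to the tangent of the curve.\<close>

lemma start_near:
  assumes c: "c \<in> A" "X (y 0) \<in> cdom c"
  shows "SF.near c 0" and "SF.\<psi> c 0 = 0"
proof -
  let ?p = "X (y 0)"
  note pc = parametrized_curve[OF VX y c(1) chart_open(1)[OF c(1)] c(2)]
  let ?w = "frechet_derivative (\<lambda>u. coord c (X u)) (at (y 0)) y'"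
  have "smooth_on V (\<lambda>u. \<nu> (X u))"
    using \<nu>_smooth VX unfolding smooth_function_def by blast
  from vector_derivative_diff_chain_within[OF y(1) has_derivative_at_withinI[OF smooth_on_has_derivative[OF this y(2)]]]
  obtain a where a: "((\<lambda>s. \<nu> (X (y s))) has_vector_derivative a) (at 0)" by (auto simp: o_def)
  have "smooth_on {u\<in>V. X u \<in> cdom c} (\<lambda>u. N c (X u))"
    using normal VX c(1) unfolding unit_normal_field_def by blast
  from smooth_on_has_derivative[OF this, of "y 0"] y(2) c(2)
  have "((\<lambda>u. N c (X u)) has_derivative frechet_derivative (\<lambda>u. N c (X u)) (at (y 0))) (at (y 0))" by blast
  from vector_derivative_diff_chain_within[OF y(1) has_derivative_at_withinI[OF this]]
  obtain b where b: "((\<lambda>s. N c (X (y s))) has_vector_derivative b) (at 0)" by (auto simp: o_def)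
  define Z where "Z s = (coord c (X (y s)), \<nu> (X (y s)) *\<^sub>R N c (X (y s)))" for s
  have "(Z has_vector_derivative (?w, \<nu> ?p *\<^sub>R b + a *\<^sub>R N c ?p)) (at 0)"
    unfolding Z_def[abs_def]
    by (intro has_vector_derivative_Pair pc(1) bounded_bilinear.has_vector_derivative[OF bounded_bilinear_scaleR a b])
  then obtain K where K: "\<forall>\<^sub>F s in nhds 0. norm (Z (0 + s) - Z 0) \<le> K * \<bar>s\<bar>"
    by (rule has_vector_derivative_lipschitz)
  have Z: "phase c (\<lambda>t. f t (X (y s))) 0 = Z s" if "X (y s) \<in> S" "X (y s) \<in> cdom c" for s
    using shiftD(2,3)[OF that(1)] that c(1) by (simp add: phase_def Z_def)
  have "\<forall>\<^sub>F s in nhds 0. f 0 (X (y s)) \<in> cdom c \<and>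
      norm (phase c (\<lambda>t. f t (X (y s))) 0 - phase c (\<lambda>t. f t (X (y 0))) 0) \<le> K * \<bar>s\<bar>"
    using K curve_in_S(2) pc(3)
  proof eventually_elim
    case (elim s)
    then show ?case using Z[of s] Z[OF curve_in_S(1) c(2)] shiftD(2)[OF elim(2)] by simp
  qed
  then show "SF.near c 0" unfolding SF.near_def by blast
  have "((\<lambda>s. coord c (f 0 (X (y s)))) has_vector_derivative ?w) (at 0)"
    by (rule has_vector_derivative_eventually[OF pc(1)])
      (use curve_in_S(2) in \<open>eventually_elim, simp add: shiftD(2)\<close>)
  then have \<zeta>: "SF.\<zeta> c 0 = ?w" unfolding SF.\<zeta>_def by (rule vector_derivative_at)
  have "metric g c ?p (N c ?p) ?w = 0"
    using normal c curve_in_S(1) pc(2) unfolding unit_normal_field_def by blast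
  then have "?w \<bullet> (g c ?p *v N c ?p) = 0"
    using g_inner_sym[OF c] by (simp add: metric_eq_inner)
  then show "SF.\<psi> c 0 = 0"
    unfolding SF.\<psi>_def \<zeta> using shiftD(2,3)[OF curve_in_S(1)] c
    by (simp add: matrix_vector_mult_scaleR)
qed

lemma orthogonal_of_constant_W:
  assumes W: "\<And>q. q \<in> S \<Longrightarrow> W q (\<nu> q) = W0" and t: "t \<in> I" and c: "c \<in> A" "f t (X (y 0)) \<in> cdom c"
    and w: "((\<lambda>s. coord c (f t (X (y s)))) has_vector_derivative w) (at 0)"
  shows "metric g c (f t (X (y 0))) (velocity c (\<lambda>s. f s (X (y 0))) t) w = 0"
proof -
  obtain c0 where c0: "c0 \<in> A" "f 0 (X (y 0)) \<in> cdom c0" by (rule chart_at[OF SF.traj0 I(3)])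
  have c0': "X (y 0) \<in> cdom c0" using c0 shiftD(2)[OF curve_in_S(1)] by simp
  have "\<forall>\<^sub>F s in nhds 0. W_along (\<lambda>t. f t (X (y s))) 0 = W_along (\<lambda>t. f t (X (y 0))) 0"
    using curve_in_S(2)
  proof eventually_elim
    case (elim s)
    then show ?case using W_along_start[OF elim] W_along_start[OF curve_in_S(1)] W[OF elim] W[OF curve_in_S(1)] by simp
  qed
  from SF.\<psi>_zero[OF this c0 start_near[OF c0(1) c0'] t c]
  have "w \<bullet> (g c (f t (X (y 0))) *v velocity c (\<lambda>s. f s (X (y 0))) t) = 0"
    unfolding SF.\<psi>_def SF.\<zeta>_def vector_derivative_at[OF w] .
  then show ?thesis using g_inner_sym[OF c] by (simp add: metric_eq_inner)
qed

text \<open>Normality makes \<psi> vanish near time 0, hence also its derivative there. What remains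
  of the equation is \<open>|v| / W_v\<close> times the derivative of \<open>W\<close> along the
  curve, and this factor is nonzero.\<close>

lemma W_stationary_of_normal_shift:
  assumes ns: "normal_shift TYPE('m) A g S \<epsilon> f"
  shows "((\<lambda>s. W (X (y s)) (\<nu> (X (y s)))) has_vector_derivative 0) (at 0)"
proof -
  let ?p = "X (y 0)"
  obtain c where c: "c \<in> A" "f 0 ?p \<in> cdom c" by (rule chart_at[OF SF.traj0 I(3)])
  have c': "?p \<in> cdom c" using c shiftD(2)[OF curve_in_S(1)] by simp
  interpret C: coordinate_field "dom c" "gc c" "Wcc c" h H by (rule coordinate_field[OF c(1)])
  obtain e where e: "e > 0" "\<And>t. dist t 0 < e \<Longrightarrow> t \<in> I \<and> f t ?p \<in> cdom c"
    using trajectory_in_chart[OF SF.traj0 I(1,3) chart_open(1)[OF c(1)] c(2)] unfolding eventually_nhds_metric by blast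
  define \<delta> where "\<delta> = e / 2"
  have \<delta>: "\<delta> > 0" "cball 0 \<delta> \<subseteq> I" "\<And>t. t \<in> cball 0 \<delta> \<Longrightarrow> f t ?p \<in> cdom c"
    using e by (auto simp: \<delta>_def subset_iff simp del: greaterThanLessThan_iff)
  have \<psi>0: "SF.\<psi> c t = 0" if "t \<in> ball 0 \<delta>" for t
  proof -
    have "t \<in> cball 0 \<delta>" using that by simp
    then have t: "t \<in> I" "f t ?p \<in> cdom c" using \<delta>(2,3) by blast+
    obtain w where w: "w \<in> tangent_space TYPE('m) A c (f t ` S) (f t ?p)"
      "((\<lambda>s. coord c (f t (X (y s)))) has_vector_derivative w) (at 0)"
      by (rule shifted_curve[OF t(1) c(1) t(2)])
    have "metric g c (f t ?p) (velocity c (\<lambda>s. f s ?p) t) w = 0"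
      using ns t c(1) w(1) curve_in_S(1) unfolding normal_shift_def by blast
    then show ?thesis
      unfolding SF.\<psi>_def SF.\<zeta>_def vector_derivative_at[OF w(2)]
      using g_inner_sym[OF c(1) t(2)] by (simp add: metric_eq_inner)
  qed
  show ?thesis
  proof (rule SF.\<psi>_deriv[OF c(1) \<delta>(2,3) _ start_near(1)[OF c(1) c'], of 0])
    fix \<omega> :: real
    let ?x = "coord c (f 0 ?p)" and ?v = "velocity c (\<lambda>t. f t ?p) 0"
    assume \<omega>: "((\<lambda>s. W_along (\<lambda>t. f t (X (y s))) 0) has_vector_derivative \<omega>) (at 0)"
      and D: "(SF.\<psi> c has_vector_derivative
         C.nrm ?x ?v / C.Wv (?x, C.nrm ?x ?v) * \<omega> + C.\<kappa> (phase c (\<lambda>t. f t ?p) 0) * SF.\<psi> c 0) (at 0)"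
    have "(SF.\<psi> c has_vector_derivative 0) (at 0)"
    proof (rule has_vector_derivative_transform_within_open[OF has_vector_derivative_const[of 0] open_ball[of 0 \<delta>]])
      fix t :: real assume "t \<in> ball 0 \<delta>"
      from \<psi>0[OF this] show "0 = SF.\<psi> c t" by simp
    qed (use \<delta>(1) in simp)
    then have "C.nrm ?x ?v / C.Wv (?x, C.nrm ?x ?v) * \<omega> = 0"
      using vector_derivative_unique_at[OF D] \<psi>0[of 0] \<delta>(1) by simp
    moreover have "C.nrm ?x ?v > 0" "C.Wv (?x, C.nrm ?x ?v) \<noteq> 0"
      using C.nrm_pos[of ?x ?v] C.Wv_nonzero trajectory_chart(3)[OF c(1) SF.traj0 I(3) c(2)] c(2) by auto
    ultimately have "\<omega> = 0" by simp
    with \<omega> show ?thesis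
      using has_vector_derivative_eventually[OF _ W_along_curve] by blast
  qed (use \<delta>(1) in auto)
qed

end

text \<open>Every tangent vector of the shifted hypersurface must come from a curve in
  \<open>S\<close>. Here the smooth inverse of \<open>f t\<close> enters: a straight line in the
  parameters of the shifted hypersurface is pulled back to \<open>S\<close>, and shifting it again
  returns the given vector.\<close>

lemma normal_shift_if_constant_W:
  assumes W: "\<And>q. q \<in> S \<Longrightarrow> W q (\<nu> q) = W0"
  shows "normal_shift TYPE('m) A g S \<epsilon> f"
  unfolding normal_shift_def
proof (intro ballI impI)
  fix t p c w
  assume t: "t \<in> I" and p: "p \<in> S" and c: "c \<in> A" "f t p \<in> cdom c"
    and "w \<in> tangent_space TYPE('m) A c (f t ` S) (f t p)"
  then obtain V' X' u' e where V': "(V', X' :: real^'m \<Rightarrow> 'a) \<in> parametrizations A (f t ` S)" "u' \<in> V'"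
    "X' u' = f t p" and w: "w = frechet_derivative (\<lambda>u. coord c (X' u)) (at u') e"
    unfolding tangent_space_def by blast
  have d: "bij_betw (f t) S (f t ` S)" "smooth_map TYPE('m) A (f t ` S) S (inv_into S (f t))"
    using diffeo[of t] t unfolding hypersurface_diffeomorphism_def by auto
  define z where "z s = u' + s *\<^sub>R e" for s :: real
  have z: "(z has_vector_derivative e) (at 0)" "z 0 = u'"
    unfolding z_def[abs_def] by (rule derivative_eq_intros refl | simp)+
  obtain V X where VX: "(V, X :: real^'m \<Rightarrow> 'a) \<in> parametrizations A S" "p \<in> X ` V"
    using S p unfolding hypersurface_def by blast
  have inv: "inv_into S (f t) (X' (z 0)) = p"
    using d(1) p by (simp add: z(2) V'(3) bij_betw_def inv_into_f_f)
  have z0: "z 0 \<in> V'" and hit: "inv_into S (f t) (X' (z 0)) \<in> X ` V" "X' (z 0) \<in> cdom c"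
    using z(2) V' inv VX(2) c by simp_all
  obtain y y' where y: "(y has_vector_derivative y') (at 0)" "y 0 \<in> V" "X (y 0) = inv_into S (f t) (X' (z 0))"
    "\<forall>\<^sub>F s in nhds 0. z s \<in> V' \<and> y s \<in> V \<and> X (y s) = inv_into S (f t) (X' (z s))"
    by (rule smooth_map_curve[OF d(2) V'(1) z(1) z0 VX(1) hit(1)])
  have "((\<lambda>s. coord c (f t (X (y s)))) has_vector_derivative w) (at 0)"
  proof (rule has_vector_derivative_eventually)
    show "((\<lambda>s. coord c (X' (z s))) has_vector_derivative w) (at 0)"
      using parametrized_curve(1)[OF V'(1) z(1) z0 c(1) chart_open(1)[OF c(1)] hit(2)] by (simp add: w z(2))
    show "\<forall>\<^sub>F s in nhds 0. coord c (X' (z s)) = coord c (f t (X (y s)))"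
      using y(4)
    proof eventually_elim
      case (elim s)
      then have "X' (z s) \<in> f t ` S" using parametrizationsD(4)[OF V'(1)] by blast
      then show ?case using elim by (simp add: f_inv_into_f)
    qed
  qed
  from orthogonal_of_constant_W[OF VX(1) y(1,2) W t c(1) _ this] c(2) y(3) inv
  show "metric g c (f t p) (velocity c (\<lambda>s. f s p) t) w = 0" by simp
qed

text \<open>A ball in the parameters is filled by segments from its centre, and \<open>W\<close> is
  stationary along each of them. Thus it is locally constant on \<open>S\<close>, and connectedness
  makes it constant.\<close>

lemma constant_W_if_normal_shift:
  assumes ns: "normal_shift TYPE('m) A g S \<epsilon> f"
  shows "(\<lambda>p. W p (\<nu> p)) constant_on S"
proof (rule locally_constant_imp_constant[OF S_connected])
  fix p assume "p \<in> S"
  then obtain V X where VX: "(V, X :: real^'m \<Rightarrow> 'a) \<in> parametrizations A S" "p \<in> X ` V"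
    using S unfolding hypersurface_def by blast
  then obtain u0 where u0: "u0 \<in> V" "X u0 = p" by blast
  note P = parametrizationsD[OF VX(1)]
  obtain d where d: "d > 0" "ball u0 d \<subseteq> V" using P(1) u0 openE by blast
  have "openin (top_of_set (X ` V)) (X ` ball u0 d)"
    by (rule homeomorphism_imp_open_map[OF P(3)]) (rule open_subset[OF d(2) open_ball])
  then have op: "openin (top_of_set S) (X ` ball u0 d)" using openin_trans P(2) by blast
  have loc: "W (X u) (\<nu> (X u)) = W p (\<nu> p)" if u: "u \<in> ball u0 d" for u
  proof -
    define l where "l s = u0 + s *\<^sub>R (u - u0)" for s :: real
    define \<Phi> where "\<Phi> s = W (X (l s)) (\<nu> (X (l s)))" for s
    have lV: "l s \<in> V" if "s \<in> {0..1}" for s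
    proof -
      have "dist u0 (l s) = s * norm (u - u0)" using that by (simp add: l_def dist_norm)
      also have "\<dots> \<le> 1 * norm (u - u0)" using that by (intro mult_right_mono) auto
      also have "\<dots> < d" using u by (simp add: dist_norm norm_minus_commute)
      finally show ?thesis using d(2) by auto
    qed
    have "(\<Phi> has_vector_derivative 0) (at s)" if s: "s \<in> {0..1}" for s
    proof -
      \<comment> \<open>Stationarity is available at parameter 0 of a curve only, so the segment is
        translated in its parameter by \<open>s\<close>.\<close>
      have "((\<lambda>k. l (s + k)) has_vector_derivative (u - u0)) (at 0)"
        unfolding l_def by (rule derivative_eq_intros refl | simp)+
      from W_stationary_of_normal_shift[OF VX(1) this _ ns] lV[OF s]
      have "((\<lambda>k. \<Phi> (s + k)) has_vector_derivative 0) (at 0)" by (simp add: \<Phi>_def)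
      then show ?thesis unfolding has_vector_derivative_iff_quotient by simp
    qed
    then obtain k where "\<And>s. s \<in> {0..1} \<Longrightarrow> \<Phi> s = k"
      using has_vector_derivative_zero_constant[of "{0..1}" \<Phi>] has_vector_derivative_at_within by (metis convex_real_interval(5))
    then have "\<Phi> 1 = \<Phi> 0" by simp
    then show ?thesis by (simp add: \<Phi>_def l_def u0)
  qed
  show "\<exists>T. openin (top_of_set S) T \<and> p \<in> T \<and> (\<forall>q\<in>T. W q (\<nu> q) = W p (\<nu> p))"
  proof (intro exI[of _ "X ` ball u0 d"] conjI ballI)
    show "p \<in> X ` ball u0 d" using u0(2) d(1) by (intro image_eqI[of _ _ u0]) simp_all
    fix q assume "q \<in> X ` ball u0 d"
    then obtain u where "q = X u" "u \<in> ball u0 d" by blast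
    with loc show "W q (\<nu> q) = W p (\<nu> p)" by simp
  qed (rule op)
qed

end

theorem theorem10p1:
  fixes A :: "('a::{t2_space,second_countable_topology}, 'n::finite) chart set"
    and g :: "('a, 'n) metric_tensor"
    and W :: "'a \<Rightarrow> real \<Rightarrow> real"
    and h :: "real \<Rightarrow> real" and H :: "real set"
    and F :: "('a, 'n) chart \<Rightarrow> 'a \<Rightarrow> real^'n \<Rightarrow> real^'n"
    and S :: "'a set"
    and N :: "('a, 'n) chart \<Rightarrow> 'a \<Rightarrow> real^'n"
    and p\<^sub>0 :: 'a and \<nu>\<^sub>0 :: real and \<nu> :: "'a \<Rightarrow> real"
    and \<epsilon> :: real and f :: "real \<Rightarrow> 'a \<Rightarrow> 'a"
  assumes dim: "CARD('n) \<ge> 3" "CARD('n) = CARD('m::finite) + 1"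
    and manifold: "smooth_atlas A" "riemannian_metric A g"
    and W_smooth: "\<And>c. c \<in> A \<Longrightarrow>
          smooth_on (coord c ` cdom c \<times> {0<..}) (\<lambda>(x, v). W (point_at c x) v)"
    and W_v: "\<And>p v. p \<in> points A \<Longrightarrow> v > 0 \<Longrightarrow> deriv (W p) v \<noteq> 0"
    and h_smooth: "open H" "smooth_on H h"
    and h_dom: "\<And>p v. p \<in> points A \<Longrightarrow> v > 0 \<Longrightarrow> W p v \<in> H"
    and force: "\<And>c p w k. c \<in> A \<Longrightarrow> p \<in> cdom c \<Longrightarrow> w \<noteq> 0 \<Longrightarrow>
          lower g c p (F c p w) $ k =
            (let v = gnorm g c p w;
                 Nu = w /\<^sub>R v;
                 Nl = lower g c p Nu;
                 W\<^sub>v = deriv (W p) v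
             in h (W p v) * Nl $ k / W\<^sub>v
                - v * (\<Sum>i\<in>UNIV. partial c i (\<lambda>q. W q v) p / W\<^sub>v
                         * (2 * Nu $ i * Nl $ k - (if i = k then 1 else 0))))"
    and S: "hypersurface TYPE('m) A S" "connected S" "unit_normal_field TYPE('m) A g S N"
    and start: "p\<^sub>0 \<in> S" "\<nu>\<^sub>0 > 0" "smooth_function TYPE('m) A S \<nu>" "\<And>p. p \<in> S \<Longrightarrow> \<nu> p > 0" "\<nu> p\<^sub>0 = \<nu>\<^sub>0"
    and shift: "\<epsilon> > 0" "newtonian_shift A g F S N \<nu> \<epsilon> f"
    and shift_diffeo: "\<And>t. \<bar>t\<bar> < \<epsilon> \<Longrightarrow>
          hypersurface TYPE('m) A (f t ` S) \<and> hypersurface_diffeomorphism TYPE('m) A S (f t ` S) (f t)"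
  shows "normal_shift TYPE('m) A g S \<epsilon> f \<longleftrightarrow> (\<forall>p\<in>S. W p (\<nu> p) = W p\<^sub>0 \<nu>\<^sub>0)"
proof -
  have "manifold_field A g W h H F"
    by (rule manifold_field.intro[OF manifold W_smooth W_v h_smooth h_dom force])
  then interpret hypersurface_shift A g W h H F "TYPE('m)" S N \<nu> \<epsilon> f
    by (rule hypersurface_shift.intro[OF _ hypersurface_shift_axioms.intro[OF S start(3,4) shift shift_diffeo]])
  show ?thesis
  proof
    assume "normal_shift TYPE('m) A g S \<epsilon> f"
    from constant_W_if_normal_shift[OF this] obtain k where "\<And>p. p \<in> S \<Longrightarrow> W p (\<nu> p) = k"
      unfolding constant_on_def by blast
    then show "\<forall>p\<in>S. W p (\<nu> p) = W p\<^sub>0 \<nu>\<^sub>0" using start(1,5) by metis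
  next
    assume "\<forall>p\<in>S. W p (\<nu> p) = W p\<^sub>0 \<nu>\<^sub>0"
    then show "normal_shift TYPE('m) A g S \<epsilon> f" by (intro normal_shift_if_constant_W) blast
  qed
qed

end
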